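(* Let $d\ge 2$. There exists $C<\infty$ such that for every $t\in[0,1]$ and every nonnegative measurable function $f$ on $\mathbb{R}^d$, $$\Big(\int_{\mathbb{R}^d}(Tf)^{q_t}\,\upsilon^{-tq_t/d}\Big)^{1/q_t}\le C\Big(\int_{\mathbb{R}^d} f^{p_t}\,\upsilon_*^{-tp_t}\Big)^{1/p_t}$$ and $$\Big(\int_{\mathbb{R}^d}(T^*f)^{q_t}\,\upsilon_*^{-tq_t/d}\Big)^{1/q_t}\le C\Big(\int_{\mathbb{R}^d} f^{p_t}\,\upsilon^{-tp_t}\Big)^{1/p_t}.$$ For $t=1$, where $p_1=q_1=\infty$, the expressions are interpreted as $L^\infty$ norms: $\|\upsilon^{-1/d}Tf\|_\infty\le C\|\upsilon_*^{-1}f\|_\infty$ and $\|\upsilon_*^{-1/d}T^*f\|_\infty\le C\|\upsilon^{-1}f\|_\infty$.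
   Context: Points of $\mathbb{R}^d$ are written $x=(x',x_d)\in\mathbb{R}^{d-1}\times\mathbb{R}$. The operators are $$Tf(x)=\int_{\mathbb{R}^{d-1}} f(x'-t,x_d-|t|^2)\,dt,\qquad T^*f(x)=\int_{\mathbb{R}^{d-1}} f(x'+t,x_d+|t|^2)\,dt.$$ The weights are $$\upsilon(x)=\min\big(1,|x'|^{-d},|x_d-|x'|^2|^{-d}\big),\qquad \upsilon_*(x)=\min\big(1,|x'|^{-d},|x_d+|x'|^2|^{-d}\big).$$ Exponents: $p_0=(d+1)/d$, $q_0=d+1$, and for $\theta\in[0,1]$, $p_\theta^{-1}=(1-\theta)p_0^{-1}$, $q_\theta^{-1}=(1-\theta)q_0^{-1}$. It is known that $T$ and $T^*$ are bounded from $L^{p_0}(\mathbb{R}^d)$ to $L^{q_0}(\mathbb{R}^d)$. *)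

theory Defs
  imports "HOL-Analysis.Analysis" "HOL-Probability.Essential_Supremum"
begin

text \<open>
  The space of dimension \<open>d = CARD('n) + 1\<close> is the type \<^typ>\<open>(real ^ 'n) \<times> real\<close>, a point
  being the pair of its first \<open>d - 1\<close> coordinates and its last one. As \<^typ>\<open>'n\<close> is nonempty,
  every \<open>d \<ge> 2\<close> arises this way. Nonnegative functions take values in \<^typ>\<open>ennreal\<close>, and all
  measurability and integration is with respect to (completed) Lebesgue measure.
\<close>

type_synonym 'n pt = "(real ^ 'n) \<times> real"

text \<open>
  Real powers of elements of \<open>[0,\<infinity>]\<close>, with \<open>x\<^sup>0 = 1\<close>, and \<open>0\<close> and \<open>\<infinity>\<close> exchanged by negative
  exponents.
\<close>

definition epow :: "ennreal \<Rightarrow> real \<Rightarrow> ennreal" where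
  "epow x a =
     (if a = 0 then 1
      else if x = 0 then (if a > 0 then 0 else \<infinity>)
      else if x = \<infinity> then (if a > 0 then \<infinity> else 0)
      else ennreal (enn2real x powr a))"

lemma epow_ennreal: "x > 0 \<Longrightarrow> epow (ennreal x) a = ennreal (x powr a)"
  by (auto simp: epow_def)

text \<open>
  For Lebesgue measurable \<open>f\<close> the integrand of \<open>parab_T f x\<close> is Lebesgue measurable in \<open>t\<close>
  for almost every \<open>x\<close>, not necessarily for every \<open>x\<close>; as usual the function \<open>parab_T f\<close> is
  relevant only up to null sets.
\<close>

definition parab_T :: "('n::finite pt \<Rightarrow> ennreal) \<Rightarrow> 'n pt \<Rightarrow> ennreal" where
  "parab_T f x = (\<integral>\<^sup>+ t. f (fst x - t, snd x - (norm t)\<^sup>2) \<partial>lebesgue)"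

definition parab_Tstar :: "('n::finite pt \<Rightarrow> ennreal) \<Rightarrow> 'n pt \<Rightarrow> ennreal" where
  "parab_Tstar f x = (\<integral>\<^sup>+ t. f (fst x + t, snd x + (norm t)\<^sup>2) \<partial>lebesgue)"

text \<open>
  The weights take values in \<open>(0,1]\<close>, but are formed in \<^typ>\<open>ennreal\<close>, where
  \<^prop>\<open>inverse (0::ennreal) = \<infinity>\<close>, so that a negative power of zero drops out of the minimum;
  on the reals it would be \<open>0\<close>.
\<close>

definition upsilon :: "'n::finite pt \<Rightarrow> ennreal" where
  "upsilon x =
     min 1 (min (inverse (ennreal (norm (fst x) ^ (CARD('n) + 1))))
                (inverse (ennreal (\<bar>snd x - (norm (fst x))\<^sup>2\<bar> ^ (CARD('n) + 1)))))"

definition upsilon_star :: "'n::finite pt \<Rightarrow> ennreal" where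
  "upsilon_star x =
     min 1 (min (inverse (ennreal (norm (fst x) ^ (CARD('n) + 1))))
                (inverse (ennreal (\<bar>snd x + (norm (fst x))\<^sup>2\<bar> ^ (CARD('n) + 1)))))"

lemma upsilon_pos_le_1: "0 < upsilon x" "upsilon x \<le> 1"
  by (auto simp: upsilon_def zero_less_iff_neq_zero)

lemma upsilon_star_pos_le_1: "0 < upsilon_star x" "upsilon_star x \<le> 1"
  by (auto simp: upsilon_star_def zero_less_iff_neq_zero)

text \<open>
  The exponents, meaningful for \<open>0 \<le> \<theta> < 1\<close>. The exponent \<open>\<infinity>\<close> at \<open>\<theta> = 1\<close> is not represented
  (there the real inverse yields \<open>0\<close>); essential suprema are used in that case.
\<close>

definition p_exp :: "nat \<Rightarrow> real \<Rightarrow> real" where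
  "p_exp d \<theta> = inverse ((1 - \<theta>) * inverse ((real d + 1) / real d))"

definition q_exp :: "nat \<Rightarrow> real \<Rightarrow> real" where
  "q_exp d \<theta> = inverse ((1 - \<theta>) * inverse (real d + 1))"

end

(*
  Substituting y = x' - t turns T into an integral of g(y, s) = f(y, s - |y|^2) over the
  nonvertical hyperplanes s = b + 2 a.y with a = x' and b = x_d - |x'|^2, and (x', x_d) -> (a, b)
  is a shear. So the unweighted bound is the endpoint estimate for the Radon transform R. With
  n = d - 1, the (n+2)-th power of R g is an integral over n+2 points y_i; for fixed points the
  (a, b)-integral is a rank one Brascamp-Lieb integral, which Hoelder's inequality and a linear
  change of variables bound by products of |det|^(-1/(n+2)), the determinants being those of the
  n+1 points left after omitting one. The Loomis-Whitney inequality (in Finner's form) separates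
  these determinants, leaving

    INT prod_j u(y_j)^(1-delta) |det(1, y_j)|^(-(n+1) delta) dy <= C prod_j (INT u)^(1-delta).

  This goes by induction on n: expanding the determinant along one column of coordinates, a
  one-dimensional multilinear Hardy-Littlewood-Sobolev inequality integrates that column out and
  produces the minors, and Loomis-Whitney again separates them.

  At t = 1 the claim is the pointwise bound T w <= C v^(1/d), where v and w are the two weights.
  Between the endpoints no complex interpolation is needed, T being positive: writing
  f = w^t h^(1-t), Hoelder gives T f <= (T w)^t (T h)^(1-t). The reflection of the last coordinate
  exchanges T with its adjoint and v with w.
*)
theory Submission
  imports Defs
begin

section \<open>Real powers and Hoelder's inequality\<close>

text \<open>The number of points is dictated by a singularity. With n+1 points the (a, b)-integral
  would be |det|^(-1) times a product of integrals, and |det|^(-1) is not locally integrable: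
  one-dimensional fractional integration needs an exponent above -1. One further point lets n+2
  determinants share the singularity, each with the exponent -\<delta> = -1/(n+2); after the
  separation each carries -(n+1)/(n+2), which is in range. Powers are taken in [0, \<infinity>],
  where a negative power of 0 is \<infinity>. Degenerate configurations, such as affinely dependent
  points, thus make an upper bound infinite and need no exceptional set. The price is that a
  vanishing integral has to be treated before an infinite factor, as 0 * \<infinity> = 0. The
  constant of the theorem is uniform in t because the endpoint constants enter as C1^t and C2^(1/q),
  with exponents in [0, 1].\<close>

lemma epow_zero_right [simp]: "epow x 0 = 1"
  by (simp add: epow_def)

lemma epow_one_right [simp]: "epow x 1 = x"
  by (cases x) (auto simp: epow_def)

lemma epow_one_left [simp]: "epow 1 a = 1"
  using epow_ennreal[of 1 a] by simp

lemma epow_zero_left: "a > 0 \<Longrightarrow> epow 0 a = 0"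
  by (simp add: epow_def)

lemma epow_top_left: "a > 0 \<Longrightarrow> epow \<infinity> a = \<infinity>"
  by (simp add: epow_def)

lemma epow_zero_left_neg: "a < 0 \<Longrightarrow> epow 0 a = \<infinity>"
  by (simp add: epow_def)

lemma ennreal_cases3:
  obtains "x = (0::ennreal)" | "x = \<infinity>" | r where "r > 0" "x = ennreal r"
  by (metis ennreal_0 ennreal_cases infinity_ennreal_def order_le_less)

lemma epow_eq_0_iff: "epow x a = 0 \<longleftrightarrow> (x = 0 \<and> a > 0) \<or> (x = \<infinity> \<and> a < 0)"
  by (cases x rule: ennreal_cases3) (auto simp: epow_def)

lemma epow_eq_top_iff: "epow x a = \<infinity> \<longleftrightarrow> (x = 0 \<and> a < 0) \<or> (x = \<infinity> \<and> a > 0)"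
  by (cases x rule: ennreal_cases3) (auto simp: epow_def)

lemma epow_mult: "a \<ge> 0 \<Longrightarrow> epow (x * y) a = epow x a * epow y a"
proof (cases "a = 0")
  case False
  assume "a \<ge> 0"
  with False have a: "a > 0" by simp
  show ?thesis
    by (cases x rule: ennreal_cases3; cases y rule: ennreal_cases3)
       (use a in \<open>simp_all add: epow_zero_left epow_top_left epow_ennreal ennreal_mult_top ennreal_top_mult
           ennreal_mult[symmetric] powr_mult top_unique epow_top_left[unfolded infinity_ennreal_def]\<close>)
qed simp

lemma epow_prod: "a \<ge> 0 \<Longrightarrow> epow (\<Prod>i\<in>I. f i) a = (\<Prod>i\<in>I. epow (f i) a)"
  by (induction I rule: infinite_finite_induct) (simp_all add: epow_mult)

lemma epow_epow: "epow (epow x a) b = epow x (a * b)"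
  by (cases x rule: ennreal_cases3)
     (auto simp: epow_def powr_powr mult_less_0_iff zero_less_mult_iff)

lemma epow_add: "a \<ge> 0 \<Longrightarrow> b \<ge> 0 \<Longrightarrow> epow x (a + b) = epow x a * epow x b"
  by (cases x rule: ennreal_cases3; cases "a = 0"; cases "b = 0")
     (auto simp: epow_def powr_add ennreal_mult)

text \<open>With exponents of opposite sign the law fails at 0 and \<infinity>, where 0 is
  multiplied by \<infinity>. The weights lie strictly between, so their powers cancel by this
  form.\<close>

lemma epow_add_pos: "0 < x \<Longrightarrow> x < \<infinity> \<Longrightarrow> epow x (a + b) = epow x a * epow x b"
  by (cases x rule: ennreal_cases3) (auto simp: epow_ennreal powr_add ennreal_mult)

lemma epow_sum:
  assumes "\<And>i. i \<in> I \<Longrightarrow> a i \<ge> 0"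
  shows "epow x (\<Sum>i\<in>I. a i) = (\<Prod>i\<in>I. epow x (a i))"
  using assms
  by (induction I rule: infinite_finite_induct) (simp_all add: epow_add sum_nonneg)

lemma epow_mono: "a \<ge> 0 \<Longrightarrow> x \<le> y \<Longrightarrow> epow x a \<le> epow y a"
  by (cases x rule: ennreal_cases3; cases y rule: ennreal_cases3; cases "a = 0")
     (auto simp: epow_def powr_mono2 ennreal_leI top_unique)

lemma epow_antimono: "a \<le> 0 \<Longrightarrow> x \<le> y \<Longrightarrow> epow y a \<le> epow x a"
  by (cases x rule: ennreal_cases3; cases y rule: ennreal_cases3; cases "a = 0")
     (auto simp: epow_def powr_mono2' ennreal_leI top_unique)

lemma epow_of_nat: "epow x (real k) = x ^ k"
proof (induction k)
  case (Suc k)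
  have "epow x (real (Suc k)) = epow x (real k + 1)" by (simp add: add.commute)
  also have "\<dots> = x ^ k * x" using Suc by (subst epow_add) auto
  finally show ?case by (simp add: mult.commute)
qed simp

lemma borel_measurable_epow [measurable]:
  assumes [measurable]: "f \<in> borel_measurable M"
  shows "(\<lambda>x. epow (f x) a) \<in> borel_measurable M"
  unfolding epow_def by measurable

section \<open>Products of powers, the inequality of the means, and Hoelder's inequality\<close>

lemma ennreal_prod_mono:
  fixes f g :: "'i \<Rightarrow> ennreal"
  assumes "\<And>i. i \<in> I \<Longrightarrow> f i \<le> g i"
  shows "(\<Prod>i\<in>I. f i) \<le> (\<Prod>i\<in>I. g i)"
  using assms by (induction I rule: infinite_finite_induct) (auto intro!: mult_mono)

text \<open>Each \<open>b j\<close> occurs once for every index other than \<open>j\<close>. This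
  counts the factors whenever one point at a time is omitted.\<close>

lemma prod_prod_Diff_epow:
  assumes "finite J" "v \<ge> 0"
  shows "(\<Prod>i\<in>J. \<Prod>j\<in>J-{i}. epow (b j) v) = (\<Prod>j\<in>J. epow (b j) (real (card J - 1) * v))"
proof -
  have "(\<Prod>i\<in>J. \<Prod>j\<in>J-{i}. epow (b j) v) = (\<Prod>i\<in>J. \<Prod>j\<in>J. if i = j then 1 else epow (b j) v)"
    using assms by (intro prod.cong refl prod.mono_neutral_cong_left) auto
  also have "\<dots> = (\<Prod>j\<in>J. \<Prod>i\<in>J. if i = j then 1 else epow (b j) v)" by (rule prod.swap)
  also have "\<dots> = (\<Prod>j\<in>J. \<Prod>i\<in>J-{j}. epow (b j) v)"
    using assms by (intro prod.cong refl prod.mono_neutral_cong_right) auto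
  also have "\<dots> = (\<Prod>j\<in>J. epow (b j) (real (card J - 1) * v))"
    using assms by (intro prod.cong refl) (simp add: epow_epow epow_of_nat[symmetric] mult.commute)
  finally show ?thesis .
qed

text \<open>Jensen's inequality for exp at the points \<open>ln (a k)\<close>.\<close>

lemma weighted_AM_GM:
  fixes a w :: "'k \<Rightarrow> real"
  assumes "finite K" "\<And>k. k \<in> K \<Longrightarrow> a k > 0" "\<And>k. k \<in> K \<Longrightarrow> w k \<ge> 0" "(\<Sum>k\<in>K. w k) = 1"
  shows "(\<Prod>k\<in>K. a k powr w k) \<le> (\<Sum>k\<in>K. w k * a k)"
proof -
  have "(\<Prod>k\<in>K. a k powr w k) = exp (\<Sum>k\<in>K. w k *\<^sub>R ln (a k))"
    using assms(1,2) by (subst exp_sum) (auto intro!: prod.cong simp: powr_def dest!: assms(2))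
  also have "\<dots> \<le> (\<Sum>k\<in>K. w k * exp (ln (a k)))"
    using assms by (intro convex_on_sum[OF _ _ exp_convex]) auto
  also have "\<dots> = (\<Sum>k\<in>K. w k * a k)"
    using assms(2) by (intro sum.cong) auto
  finally show ?thesis .
qed

lemma ennreal_weighted_AM_GM:
  assumes K: "finite K" "\<And>k. k \<in> K \<Longrightarrow> w k > 0" "(\<Sum>k\<in>K. w k) = 1"
  shows "(\<Prod>k\<in>K. epow (a k) (w k)) \<le> (\<Sum>k\<in>K. ennreal (w k) * a k)"
proof -
  consider k where "k \<in> K" "a k = 0" | k where "k \<in> K" "a k = \<infinity>"
    | "\<And>k. k \<in> K \<Longrightarrow> a k \<noteq> 0 \<and> a k \<noteq> \<infinity>" by blast
  then show ?thesis
  proof cases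
    case (1 k)
    then have "(\<Prod>k\<in>K. epow (a k) (w k)) = 0"
      using K by (auto simp: epow_eq_0_iff intro!: prod_zero bexI[of _ k])
    then show ?thesis by (simp only: zero_le)
  next
    case (2 k)
    then have "ennreal (w k) * a k = \<infinity>" using K(2)[of k] by (simp add: ennreal_mult_top)
    then have "(\<Sum>k\<in>K. ennreal (w k) * a k) = \<infinity>"
      using 2 K(1) by (metis (no_types, lifting) ennreal_top_neq_zero infinity_ennreal_def member_le_sum top.extremum_unique zero_le)
    then show ?thesis by simp
  next
    case 3
    define b where "b k = enn2real (a k)" for k
    have b: "a k = ennreal (b k)" "b k > 0" if "k \<in> K" for k
      using 3[OF that] by (auto simp: b_def enn2real_positive_iff less_top zero_less_iff_neq_zero)
    have "(\<Prod>k\<in>K. epow (a k) (w k)) = (\<Prod>k\<in>K. ennreal (b k powr w k))"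
      using b by (intro prod.cong) (auto simp: epow_ennreal)
    also have "\<dots> = ennreal (\<Prod>k\<in>K. b k powr w k)"
      by (rule prod_ennreal) simp
    also have "\<dots> \<le> ennreal (\<Sum>k\<in>K. w k * b k)"
      using K b by (intro ennreal_leI weighted_AM_GM) (auto intro: less_imp_le)
    also have "\<dots> = (\<Sum>k\<in>K. ennreal (w k * b k))"
      using K b by (intro sum_ennreal[symmetric]) (auto intro!: mult_nonneg_nonneg less_imp_le)
    also have "\<dots> = (\<Sum>k\<in>K. ennreal (w k) * a k)"
      using K b by (intro sum.cong refl) (simp add: ennreal_mult less_imp_le)
    finally show ?thesis .
  qed
qed

text \<open>After each function is divided by its integral, the inequality of the means is applied
  pointwise and integrated; the weights sum to 1.\<close>

lemma nn_integral_Holder: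
  assumes "finite K" and f [measurable]: "\<And>k. k \<in> K \<Longrightarrow> f k \<in> borel_measurable M"
    and w: "\<And>k. k \<in> K \<Longrightarrow> w k \<ge> 0" "(\<Sum>k\<in>K. w k) = 1"
  shows "(\<integral>\<^sup>+x. (\<Prod>k\<in>K. epow (f k x) (w k)) \<partial>M) \<le> (\<Prod>k\<in>K. epow (\<integral>\<^sup>+x. f k x \<partial>M) (w k))"
proof -
  \<comment> \<open>Indices of weight 0 contribute the factor 1 even where the function or its
    integral is 0 or \<infinity>, so they must stay out of the case distinction.\<close>
  define L where "L = {k \<in> K. w k \<noteq> 0}"
  have L: "finite L" "L \<subseteq> K" "\<And>k. k \<in> L \<Longrightarrow> w k > 0" "\<And>k. k \<in> L \<Longrightarrow> f k \<in> borel_measurable M"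
    using assms by (auto simp: L_def order_le_less)
  have "(\<Sum>k\<in>L. w k) = (\<Sum>k\<in>K. w k)"
    unfolding L_def using assms by (intro sum.mono_neutral_left) auto
  then have sumL: "(\<Sum>k\<in>L. w k) = 1" using w by simp
  have red: "(\<Prod>k\<in>K. epow (g k) (w k)) = (\<Prod>k\<in>L. epow (g k) (w k))" for g
    unfolding L_def using assms(1) by (intro prod.mono_neutral_right) auto
  note [measurable] = L(4)
  define c where "c k = (\<integral>\<^sup>+x. f k x \<partial>M)" for k
  \<comment> \<open>A vanishing integral comes first because 0 * \<infinity> = 0; only in its
    absence does an infinite integral make the right-hand side infinite.\<close>
  consider k where "k \<in> L" "c k = 0" | k where "k \<in> L" "c k = \<infinity>" "\<And>k. k \<in> L \<Longrightarrow> c k \<noteq> 0"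
    | "\<And>k. k \<in> L \<Longrightarrow> c k \<noteq> 0 \<and> c k \<noteq> \<infinity>" by blast
  then have "(\<integral>\<^sup>+x. (\<Prod>k\<in>L. epow (f k x) (w k)) \<partial>M) \<le> (\<Prod>k\<in>L. epow (c k) (w k))"
  proof cases
    case (1 k)
    then have "AE x in M. f k x = 0"
      unfolding c_def using L(4)[of k] by (simp add: nn_integral_0_iff_AE)
    then have "AE x in M. (\<Prod>k\<in>L. epow (f k x) (w k)) = 0"
      by eventually_elim (use 1 L in \<open>auto simp: prod_zero_iff epow_eq_0_iff\<close>)
    then have "(\<integral>\<^sup>+x. (\<Prod>k\<in>L. epow (f k x) (w k)) \<partial>M) = (\<integral>\<^sup>+x. 0 \<partial>M)"
      by (rule nn_integral_cong_AE)
    then show ?thesis by simp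
  next
    case (2 k)
    have "(\<Prod>k\<in>L-{k}. epow (c k) (w k)) \<noteq> 0"
      using 2 L by (auto simp: prod_zero_iff epow_eq_0_iff dest: less_asym L(3))
    then have "(\<Prod>k\<in>L. epow (c k) (w k)) = \<infinity>"
      using 2 L(1) L(3)[of k] by (subst prod.remove[of _ k]) (auto simp: epow_top_left[unfolded infinity_ennreal_def] ennreal_top_mult)
    then show ?thesis by simp
  next
    case 3
    define d where "d k = inverse (c k)" for k
    have cd: "c k * d k = 1" if "k \<in> L" for k
      using 3[OF that] by (auto simp: d_def ennreal_mult_divide_eq less_top divide_ennreal_def[symmetric] zero_less_iff_neq_zero)
    have "(\<Prod>k\<in>L. epow (f k x) (w k)) \<le> (\<Prod>k\<in>L. epow (c k) (w k)) * (\<Sum>k\<in>L. ennreal (w k) * (f k x * d k))" for x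
    proof -
      have "(\<Prod>k\<in>L. epow (f k x) (w k)) = (\<Prod>k\<in>L. epow (c k) (w k) * epow (f k x * d k) (w k))"
      proof (rule prod.cong[OF refl])
        fix k assume "k \<in> L"
        have "f k x = c k * (f k x * d k)" using cd[OF \<open>k \<in> L\<close>] by (metis mult.left_commute mult.right_neutral)
        then show "epow (f k x) (w k) = epow (c k) (w k) * epow (f k x * d k) (w k)"
          using L(3)[OF \<open>k \<in> L\<close>] epow_mult[of "w k" "c k" "f k x * d k"] by simp
      qed
      also have "\<dots> = (\<Prod>k\<in>L. epow (c k) (w k)) * (\<Prod>k\<in>L. epow (f k x * d k) (w k))"
        by (simp add: prod.distrib)
      also have "\<dots> \<le> (\<Prod>k\<in>L. epow (c k) (w k)) * (\<Sum>k\<in>L. ennreal (w k) * (f k x * d k))"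
        using L sumL by (intro mult_left_mono ennreal_weighted_AM_GM) auto
      finally show ?thesis .
    qed
    then have "(\<integral>\<^sup>+x. (\<Prod>k\<in>L. epow (f k x) (w k)) \<partial>M)
        \<le> (\<integral>\<^sup>+x. (\<Prod>k\<in>L. epow (c k) (w k)) * (\<Sum>k\<in>L. ennreal (w k) * (f k x * d k)) \<partial>M)"
      by (intro nn_integral_mono)
    also have "\<dots> = (\<Prod>k\<in>L. epow (c k) (w k)) * (\<Sum>k\<in>L. ennreal (w k) * (c k * d k))"
      by (simp add: nn_integral_cmult nn_integral_sum nn_integral_multc c_def)
    also have "(\<Sum>k\<in>L. ennreal (w k) * (c k * d k)) = (\<Sum>k\<in>L. ennreal (w k))"
      by (intro sum.cong) (auto simp: cd)
    also have "\<dots> = 1" using L(3) sumL by (subst sum_ennreal) (auto intro: less_imp_le)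
    finally show ?thesis by simp
  qed
  then show ?thesis by (simp add: red c_def)
qed

lemma nn_integral_Holder2:
  assumes [measurable]: "f \<in> borel_measurable M" "g \<in> borel_measurable M" and "0 \<le> a" "a \<le> 1"
  shows "(\<integral>\<^sup>+x. epow (f x) a * epow (g x) (1 - a) \<partial>M) \<le> epow (\<integral>\<^sup>+x. f x \<partial>M) a * epow (\<integral>\<^sup>+x. g x \<partial>M) (1 - a)"
  using nn_integral_Holder[of "UNIV :: bool set" "\<lambda>b. if b then f else g" M "\<lambda>b. if b then a else 1 - a"] assms
  by (simp add: UNIV_bool mult.commute)

section \<open>Finner's inequality\<close>

text \<open>Induction on the coordinates, with \<open>S\<close> and \<open>F\<close> varying. The
  weights of the sets containing the new coordinate \<open>i\<close> sum to 1, so Hoelder's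
  inequality in that variable alone integrates it out of exactly the functions that depend on it;
  these become functions on \<open>S k - {i}\<close>. Loomis-Whitney is the case where each set
  omits one block of coordinates and all weights are equal.\<close>

lemma (in product_sigma_finite) nn_integral_PiM_Finner:
  assumes "finite I" "finite K" and "\<And>k. k \<in> K \<Longrightarrow> S k \<subseteq> I"
    and "\<And>k. k \<in> K \<Longrightarrow> F k \<in> borel_measurable (PiM (S k) M)"
    and "\<And>k. k \<in> K \<Longrightarrow> w k \<ge> 0" "\<And>i. i \<in> I \<Longrightarrow> (\<Sum>k | k \<in> K \<and> i \<in> S k. w k) = 1"
  shows "(\<integral>\<^sup>+y. (\<Prod>k\<in>K. epow (F k (restrict y (S k))) (w k)) \<partial>PiM I M)
         \<le> (\<Prod>k\<in>K. epow (\<integral>\<^sup>+y. F k y \<partial>PiM (S k) M) (w k))"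
  using assms(1,3,4,6)
proof (induction I arbitrary: S F)
  case empty
  then have "S k = {}" if "k \<in> K" for k using that by auto
  then have "(\<Prod>k\<in>K. epow (\<integral>\<^sup>+y. F k y \<partial>PiM (S k) M) (w k)) = (\<Prod>k\<in>K. epow (F k (\<lambda>_. undefined)) (w k))"
      "(\<Prod>k\<in>K. epow (F k (restrict (\<lambda>x. undefined) (S k))) (w k)) = (\<Prod>k\<in>K. epow (F k (\<lambda>_. undefined)) (w k))"
    using nn_integral_empty by (auto intro!: prod.cong simp: restrict_def)
  then show ?case by (simp add: nn_integral_empty)
next
  case (insert i I)
  note [measurable] = insert.prems(2)
  define F' where "F' k z = (if i \<in> S k then \<integral>\<^sup>+y. F k (z(i := y)) \<partial>M i else F k z)" for k z
  have m1: "(\<lambda>(z, y). F k (z(i := y))) \<in> borel_measurable (PiM (S k - {i}) M \<Otimes>\<^sub>M M i)"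
    if "k \<in> K" "i \<in> S k" for k
  proof -
    have "(\<lambda>(z, y). z(i := y)) \<in> measurable (PiM (S k - {i}) M \<Otimes>\<^sub>M M i) (PiM (insert i (S k - {i})) M)"
      by (rule measurable_add_dim)
    from measurable_compose[OF this[unfolded insert_Diff[OF that(2)]] insert.prems(2)[OF that(1)]] show ?thesis
      by (simp add: split_beta' fun_upd_def)
  qed
  have F'm: "F' k \<in> borel_measurable (PiM (S k - {i}) M)" if "k \<in> K" for k
  proof (cases "i \<in> S k")
    case True
    interpret sigma_finite_measure "M i" by (rule sigma_finite_measures)
    from borel_measurable_nn_integral[OF m1[OF that True]] True show ?thesis
      by (simp add: F'_def[abs_def])
  next
    case False
    then show ?thesis using insert.prems(2)[OF that] by (simp add: F'_def[abs_def])
  qed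
  have F'int: "(\<integral>\<^sup>+z. F' k z \<partial>PiM (S k - {i}) M) = (\<integral>\<^sup>+y. F k y \<partial>PiM (S k) M)" if "k \<in> K" for k
  proof (cases "i \<in> S k")
    case True
    have "finite (S k - {i})" using insert.prems(1)[OF that] insert.hyps(1) finite_subset by auto
    from product_nn_integral_insert[OF this, of i "F k", unfolded insert_Diff[OF True], OF _ insert.prems(2)[OF that]] True
    show ?thesis by (simp only: F'_def if_True) simp
  qed (simp add: F'_def)
  have restr: "restrict y (S k) \<in> space (PiM (S k) M)" if "y \<in> space (PiM (insert i I) M)" "k \<in> K" for y k
    using that insert.prems(1)[OF that(2)] by (auto simp: space_PiM PiE_iff)
  have integrand: "(\<lambda>y. \<Prod>k\<in>K. epow (F k (restrict y (S k))) (w k)) \<in> borel_measurable (PiM (insert i I) M)"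
  proof (intro borel_measurable_prod_ennreal borel_measurable_epow)
    fix k assume k: "k \<in> K"
    have "(\<lambda>y. restrict y (S k)) \<in> measurable (PiM (insert i I) M) (PiM (S k) M)"
      using insert.prems(1)[OF k] by (rule measurable_restrict_subset)
    from measurable_compose[OF this insert.prems(2)[OF k]]
    show "(\<lambda>y. F k (restrict y (S k))) \<in> borel_measurable (PiM (insert i I) M)" .
  qed
  have "(\<integral>\<^sup>+y. (\<Prod>k\<in>K. epow (F k (restrict y (S k))) (w k)) \<partial>PiM (insert i I) M)
      = (\<integral>\<^sup>+x. (\<integral>\<^sup>+y. (\<Prod>k\<in>K. epow (F k (restrict (x(i := y)) (S k))) (w k)) \<partial>M i) \<partial>PiM I M)"
    by (rule product_nn_integral_insert[OF insert.hyps integrand])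
  also have "\<dots> \<le> (\<integral>\<^sup>+x. (\<Prod>k\<in>K. epow (F' k (restrict x (S k - {i}))) (w k)) \<partial>PiM I M)"
  proof (rule nn_integral_mono)
    fix x assume x: "x \<in> space (PiM I M)"
    define K1 where "K1 = {k \<in> K. i \<in> S k}"
    define K0 where "K0 = {k \<in> K. i \<notin> S k}"
    have K: "K = K0 \<union> K1" "K0 \<inter> K1 = {}" "finite K0" "finite K1"
      using assms(2) by (auto simp: K0_def K1_def)
    have r1: "restrict (x(i := y)) (S k) = (restrict x (S k - {i}))(i := y)" if "k \<in> K1" for k y
      using that by (auto simp: K1_def fun_eq_iff restrict_def)
    have r0: "restrict (x(i := y)) (S k) = restrict x (S k - {i})" if "k \<in> K0" for k y
      using that by (auto simp: K0_def fun_eq_iff restrict_def)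
    have m2: "(\<lambda>y. F k ((restrict x (S k - {i}))(i := y))) \<in> borel_measurable (M i)" if "k \<in> K1" for k
    proof -
      have k: "k \<in> K" "i \<in> S k" using that by (auto simp: K1_def)
      have "restrict x (S k - {i}) \<in> space (PiM (S k - {i}) M)"
        using x insert.prems(1)[OF k(1)] by (auto simp: space_PiM PiE_iff)
      from measurable_Pair2[OF m1[OF k] this] show ?thesis by simp
    qed
    have "(\<integral>\<^sup>+y. (\<Prod>k\<in>K. epow (F k (restrict (x(i := y)) (S k))) (w k)) \<partial>M i)
       = (\<integral>\<^sup>+y. (\<Prod>k\<in>K0. epow (F k (restrict x (S k - {i}))) (w k)) *
            (\<Prod>k\<in>K1. epow (F k ((restrict x (S k - {i}))(i := y))) (w k)) \<partial>M i)"
      unfolding K(1) by (subst prod.union_disjoint[OF K(3,4,2)]) (simp add: r0 r1 cong: prod.cong)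
    also have "\<dots> = (\<Prod>k\<in>K0. epow (F k (restrict x (S k - {i}))) (w k)) *
            (\<integral>\<^sup>+y. (\<Prod>k\<in>K1. epow (F k ((restrict x (S k - {i}))(i := y))) (w k)) \<partial>M i)"
      using m2 by (intro nn_integral_cmult borel_measurable_prod_ennreal borel_measurable_epow)
    also have "\<dots> \<le> (\<Prod>k\<in>K0. epow (F k (restrict x (S k - {i}))) (w k)) *
            (\<Prod>k\<in>K1. epow (\<integral>\<^sup>+y. F k ((restrict x (S k - {i}))(i := y)) \<partial>M i) (w k))"
    proof (intro mult_left_mono nn_integral_Holder m2)
      show "(\<Sum>k\<in>K1. w k) = 1" using insert.prems(3)[of i] by (simp add: K1_def)
      show "0 \<le> w k" if "k \<in> K1" for k using that assms(5) by (simp add: K1_def)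
    qed (use K(4) in auto)
    also have "\<dots> = (\<Prod>k\<in>K0. epow (F' k (restrict x (S k - {i}))) (w k)) *
            (\<Prod>k\<in>K1. epow (F' k (restrict x (S k - {i}))) (w k))"
      by (intro arg_cong2[where f = "(*)"] prod.cong) (auto simp: F'_def K0_def K1_def)
    also have "\<dots> = (\<Prod>k\<in>K. epow (F' k (restrict x (S k - {i}))) (w k))"
      unfolding K(1) by (rule prod.union_disjoint[OF K(3,4,2), symmetric])
    finally show "(\<integral>\<^sup>+y. (\<Prod>k\<in>K. epow (F k (restrict (x(i := y)) (S k))) (w k)) \<partial>M i)
      \<le> (\<Prod>k\<in>K. epow (F' k (restrict x (S k - {i}))) (w k))" .
  qed
  also have "\<dots> \<le> (\<Prod>k\<in>K. epow (\<integral>\<^sup>+z. F' k z \<partial>PiM (S k - {i}) M) (w k))"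
  proof (rule insert.IH)
    fix j assume "j \<in> I"
    then have "{k. k \<in> K \<and> j \<in> S k - {i}} = {k. k \<in> K \<and> j \<in> S k}" using insert.hyps by auto
    then show "(\<Sum>k | k \<in> K \<and> j \<in> S k - {i}. w k) = 1"
      using insert.prems(3)[of j] \<open>j \<in> I\<close> by simp
  qed (use insert.prems(1) F'm in auto)
  also have "\<dots> = (\<Prod>k\<in>K. epow (\<integral>\<^sup>+y. F k y \<partial>PiM (S k) M) (w k))"
    by (intro prod.cong refl) (simp add: F'int)
  finally show ?case .
qed

section \<open>The Hardy-Littlewood-Sobolev inequality\<close>

lemma nn_integral_abs_le:
  fixes G :: "real \<Rightarrow> ennreal"
  assumes [measurable]: "G \<in> borel_measurable borel"
  shows "(\<integral>\<^sup>+u. G \<bar>u\<bar> \<partial>lborel) \<le> 2 * (\<integral>\<^sup>+u. indicator {0..} u * G u \<partial>lborel)"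
proof -
  have "(\<integral>\<^sup>+u. G \<bar>u\<bar> \<partial>lborel) \<le> (\<integral>\<^sup>+u. indicator {0..} u * G u + indicator {0..} (-u) * G (- u) \<partial>lborel)"
    by (intro nn_integral_mono) (auto split: split_indicator)
  also have "\<dots> = (\<integral>\<^sup>+u. indicator {0..} u * G u \<partial>lborel) + (\<integral>\<^sup>+u. indicator {0..} (-u) * G (- u) \<partial>lborel)"
    by (intro nn_integral_add) auto
  also have "(\<integral>\<^sup>+u. indicator {0..} (-u) * G (- u) \<partial>lborel) = (\<integral>\<^sup>+u. indicator {0..} u * G u \<partial>lborel)"
    using nn_integral_real_affine[of "\<lambda>u. indicator {0..} u * G u" "-1" 0] by simp
  finally show ?thesis by (simp add: mult_2)
qed

lemma nn_integral_shift:
  fixes G :: "real \<Rightarrow> ennreal"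
  assumes [measurable]: "G \<in> borel_measurable borel"
  shows "(\<integral>\<^sup>+u. G (u + s) \<partial>lborel) = (\<integral>\<^sup>+u. G u \<partial>lborel)"
  using nn_integral_real_affine[of G 1 s] by (simp add: add.commute)

lemma nn_integral_kernel_near:
  assumes "0 < \<gamma>" "\<gamma> < 1" "c > 0"
  shows "(\<integral>\<^sup>+u. indicator {0..c} \<bar>u\<bar> * epow (ennreal \<bar>u\<bar>) (-\<gamma>) \<partial>lborel) \<le> ennreal (2 / (1-\<gamma>) * c powr (1-\<gamma>))"
proof -
  have "(\<integral>\<^sup>+u. indicator {0..c} \<bar>u\<bar> * epow (ennreal \<bar>u\<bar>) (-\<gamma>) \<partial>lborel)
      \<le> 2 * (\<integral>\<^sup>+u. indicator {0..} u * (indicator {0..c} u * epow (ennreal u) (-\<gamma>)) \<partial>lborel)"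
    by (rule nn_integral_abs_le) simp
  also have "(\<integral>\<^sup>+u. indicator {0..} u * (indicator {0..c} u * epow (ennreal u) (-\<gamma>)) \<partial>lborel)
      = (\<integral>\<^sup>+u. ennreal (u powr (-\<gamma>)) * indicator {0..c} u \<partial>lborel)"
  proof (rule nn_integral_cong_AE)
    \<comment> \<open>At u = 0 the two sides differ: \<open>epow\<close> gives \<infinity> there and
      \<open>powr\<close> gives 0.\<close>
    show "AE u in lborel. indicator {0..} u * (indicator {0..c} u * epow (ennreal u) (-\<gamma>))
           = ennreal (u powr (-\<gamma>)) * indicator {0..c} u"
      using AE_lborel_singleton[of 0]
      by eventually_elim (auto split: split_indicator simp: epow_ennreal)
  qed
  also have "\<dots> = ennreal (c powr (-\<gamma>+1) / (-\<gamma>+1))"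
    using assms by (intro nn_integral_has_integral_lebesgue' has_integral_powr_from_0) auto
  also have "2 * \<dots> = ennreal (2 / (1-\<gamma>) * c powr (1-\<gamma>))"
    using assms by (subst ennreal_numeral[symmetric], subst ennreal_mult[symmetric]) (auto simp: add.commute)
  finally show ?thesis .
qed

lemma nn_integral_kernel_far:
  assumes "c > 0"
  shows "(\<integral>\<^sup>+u. indicator {c..} \<bar>u\<bar> * epow (ennreal \<bar>u\<bar>) (-2) \<partial>lborel) \<le> ennreal (2 / c)"
proof -
  have "(\<integral>\<^sup>+u. indicator {c..} \<bar>u\<bar> * epow (ennreal \<bar>u\<bar>) (-2) \<partial>lborel)
      \<le> 2 * (\<integral>\<^sup>+u. indicator {0..} u * (indicator {c..} u * epow (ennreal u) (-2)) \<partial>lborel)"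
    by (rule nn_integral_abs_le) simp
  also have "(\<integral>\<^sup>+u. indicator {0..} u * (indicator {c..} u * epow (ennreal u) (-2)) \<partial>lborel)
      = (\<integral>\<^sup>+u. ennreal (u powr (-2)) * indicator {c..} u \<partial>lborel)"
    using assms by (intro nn_integral_cong) (auto split: split_indicator simp: epow_ennreal)
  also have "\<dots> = ennreal (-(c powr (-2+1)) / (-2+1))"
    using assms by (intro nn_integral_has_integral_lebesgue' has_integral_powr_to_inf) auto
  also have "2 * \<dots> = ennreal (2 / c)"
    using assms by (subst ennreal_numeral[symmetric], subst ennreal_mult[symmetric]) (auto simp: powr_minus_divide)
  finally show ?thesis .
qed

text \<open>
  Half of a bilinear estimate with kernel \<open>\<bar>u + v + s\<bar> powr (-\<gamma>)\<close>. Where \<open>X u \<le> Y v = r\<close>, the part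
  \<open>\<bar>u + v + s\<bar> \<le> 1/r\<close> is estimated by \<open>X u \<le> r\<close>, the rest by Hoelder's inequality; both give
  exactly a multiple of \<open>r\<close>.
\<close>

lemma HLS_half:
  fixes X Y :: "real \<Rightarrow> ennreal"
  assumes [measurable]: "X \<in> borel_measurable borel" "Y \<in> borel_measurable borel"
    and \<gamma>: "0 < \<gamma>" "\<gamma> < 1" and X1: "(\<integral>\<^sup>+u. X u \<partial>lborel) \<le> 1"
  shows "(\<integral>\<^sup>+v. \<integral>\<^sup>+u. indicator {u. X u \<le> Y v} u * (epow (X u) (1-\<gamma>/2) * epow (Y v) (1-\<gamma>/2) *
            epow (ennreal \<bar>u+v+s\<bar>) (-\<gamma>)) \<partial>lborel \<partial>lborel)
     \<le> ennreal (2 / (1-\<gamma>) + 2 powr (\<gamma>/2)) * (\<integral>\<^sup>+v. Y v \<partial>lborel)"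
proof -
  let ?\<theta> = "1 - \<gamma>/2"
  let ?C = "2 / (1-\<gamma>) + 2 powr (\<gamma>/2)"
  have C: "?C > 0" using \<gamma> by (intro add_pos_pos) auto
  have "(\<integral>\<^sup>+u. indicator {u. X u \<le> Y v} u * (epow (X u) ?\<theta> * epow (Y v) ?\<theta> * epow (ennreal \<bar>u+v+s\<bar>) (-\<gamma>)) \<partial>lborel)
      \<le> ennreal ?C * Y v" for v
  proof (cases "Y v" rule: ennreal_cases3)
    case 1
    then show ?thesis using \<gamma> by (simp add: epow_zero_left)
  next
    case 2
    then show ?thesis using C by (simp add: ennreal_mult_top)
  next
    case (3 r)
    let ?t = "\<lambda>u. \<bar>u + (v + s)\<bar>"
    have "(\<integral>\<^sup>+u. indicator {u. X u \<le> Y v} u * (epow (X u) ?\<theta> * epow (Y v) ?\<theta> * epow (ennreal \<bar>u+v+s\<bar>) (-\<gamma>)) \<partial>lborel)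
      \<le> (\<integral>\<^sup>+u. epow (Y v) ?\<theta> * (epow (Y v) ?\<theta> * (indicator {0..1/r} (?t u) * epow (ennreal (?t u)) (-\<gamma>))
           + epow (X u) ?\<theta> * epow (indicator {1/r..} (?t u) * epow (ennreal (?t u)) (-2)) (1 - ?\<theta>)) \<partial>lborel)"
    proof (rule nn_integral_mono)
      fix u
      have *: "epow (X u) ?\<theta> \<le> epow (Y v) ?\<theta>" if "X u \<le> Y v" using that \<gamma> by (intro epow_mono) auto
      show "indicator {u. X u \<le> Y v} u * (epow (X u) ?\<theta> * epow (Y v) ?\<theta> * epow (ennreal \<bar>u+v+s\<bar>) (-\<gamma>))
        \<le> epow (Y v) ?\<theta> * (epow (Y v) ?\<theta> * (indicator {0..1/r} (?t u) * epow (ennreal (?t u)) (-\<gamma>))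
           + epow (X u) ?\<theta> * epow (indicator {1/r..} (?t u) * epow (ennreal (?t u)) (-2)) (1 - ?\<theta>))"
      proof (cases "X u \<le> Y v")
        case True
        show ?thesis
        proof (cases "?t u \<le> 1/r")
          case near: True
          have "epow (X u) ?\<theta> * epow (Y v) ?\<theta> * epow (ennreal \<bar>u+v+s\<bar>) (-\<gamma>)
             \<le> epow (Y v) ?\<theta> * (epow (Y v) ?\<theta> * epow (ennreal (?t u)) (-\<gamma>))"
            using mult_right_mono[OF *[OF True], of "epow (Y v) ?\<theta> * epow (ennreal (?t u)) (-\<gamma>)"] by (simp only: mult.assoc add.assoc zero_le)
          also have "\<dots> \<le> epow (Y v) ?\<theta> * (epow (Y v) ?\<theta> * (indicator {0..1/r} (?t u) * epow (ennreal (?t u)) (-\<gamma>))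
           + epow (X u) ?\<theta> * epow (indicator {1/r..} (?t u) * epow (ennreal (?t u)) (-2)) (1 - ?\<theta>))"
            using near by (intro mult_left_mono) auto
          finally show ?thesis using True by simp
        next
          case far: False
          then have "epow (X u) ?\<theta> * epow (Y v) ?\<theta> * epow (ennreal \<bar>u+v+s\<bar>) (-\<gamma>)
             = epow (Y v) ?\<theta> * (epow (X u) ?\<theta> * epow (indicator {1/r..} (?t u) * epow (ennreal (?t u)) (-2)) (1 - ?\<theta>))"
            by (simp add: epow_epow add.assoc mult_ac)
          then show ?thesis using True far by simp
        qed
      qed simp
    qed
    also have "\<dots> = epow (Y v) ?\<theta> * (epow (Y v) ?\<theta> * (\<integral>\<^sup>+u. indicator {0..1/r} (?t u) * epow (ennreal (?t u)) (-\<gamma>) \<partial>lborel)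
           + (\<integral>\<^sup>+u. epow (X u) ?\<theta> * epow (indicator {1/r..} (?t u) * epow (ennreal (?t u)) (-2)) (1 - ?\<theta>) \<partial>lborel))"
      by (simp add: nn_integral_cmult nn_integral_add)
    also have "(\<integral>\<^sup>+u. indicator {0..1/r} (?t u) * epow (ennreal (?t u)) (-\<gamma>) \<partial>lborel)
        = (\<integral>\<^sup>+u. indicator {0..1/r} \<bar>u\<bar> * epow (ennreal \<bar>u\<bar>) (-\<gamma>) \<partial>lborel)"
      by (rule nn_integral_shift[of "\<lambda>u. indicator {0..1/r} \<bar>u\<bar> * epow (ennreal \<bar>u\<bar>) (-\<gamma>)"]) simp
    also have "epow (Y v) ?\<theta> * (epow (Y v) ?\<theta> * \<dots>
           + (\<integral>\<^sup>+u. epow (X u) ?\<theta> * epow (indicator {1/r..} (?t u) * epow (ennreal (?t u)) (-2)) (1 - ?\<theta>) \<partial>lborel))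
        \<le> epow (Y v) ?\<theta> * (epow (Y v) ?\<theta> * ennreal (2 / (1-\<gamma>) * (1/r) powr (1-\<gamma>)) + ennreal ((2 * r) powr (\<gamma>/2)))"
    proof (intro mult_left_mono add_mono)
      show "(\<integral>\<^sup>+u. indicator {0..1/r} \<bar>u\<bar> * epow (ennreal \<bar>u\<bar>) (-\<gamma>) \<partial>lborel) \<le> ennreal (2 / (1-\<gamma>) * (1/r) powr (1-\<gamma>))"
        using 3 \<gamma> by (intro nn_integral_kernel_near) auto
      \<comment> \<open>As \<open>1 - ?\<theta>\<close> is \<gamma>/2, the far part of the kernel is
        the power of exponent \<open>1 - ?\<theta>\<close> of an inverse square, whose tail beyond
        1/r has integral at most 2r. It is therefore the right partner for
        \<open>epow (X u) ?\<theta>\<close> in Hoelder's inequality.\<close>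
      have "(\<integral>\<^sup>+u. epow (X u) ?\<theta> * epow (indicator {1/r..} (?t u) * epow (ennreal (?t u)) (-2)) (1 - ?\<theta>) \<partial>lborel)
          \<le> epow (\<integral>\<^sup>+u. X u \<partial>lborel) ?\<theta> * epow (\<integral>\<^sup>+u. indicator {1/r..} (?t u) * epow (ennreal (?t u)) (-2) \<partial>lborel) (1 - ?\<theta>)"
        using \<gamma> by (intro nn_integral_Holder2) auto
      also have "(\<integral>\<^sup>+u. indicator {1/r..} (?t u) * epow (ennreal (?t u)) (-2) \<partial>lborel)
        = (\<integral>\<^sup>+u. indicator {1/r..} \<bar>u\<bar> * epow (ennreal \<bar>u\<bar>) (-2) \<partial>lborel)"
        by (rule nn_integral_shift[of "\<lambda>u. indicator {1/r..} \<bar>u\<bar> * epow (ennreal \<bar>u\<bar>) (-2)"]) simp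
      also have "epow (\<integral>\<^sup>+u. X u \<partial>lborel) ?\<theta> * epow \<dots> (1 - ?\<theta>) \<le> epow 1 ?\<theta> * epow (ennreal (2 / (1/r))) (1 - ?\<theta>)"
        using \<gamma> X1 3 by (intro mult_mono epow_mono nn_integral_kernel_far) auto
      also have "\<dots> = ennreal ((2 * r) powr (\<gamma>/2))" using 3 by (simp add: epow_ennreal)
      finally show "(\<integral>\<^sup>+u. epow (X u) ?\<theta> * epow (indicator {1/r..} (?t u) * epow (ennreal (?t u)) (-2)) (1 - ?\<theta>) \<partial>lborel)
          \<le> ennreal ((2 * r) powr (\<gamma>/2))" .
    qed auto
    also have "\<dots> = ennreal (r powr ?\<theta> * (r powr ?\<theta> * (2 / (1-\<gamma>) * (1/r) powr (1-\<gamma>)) + (2 * r) powr (\<gamma>/2)))"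
      using \<gamma> by (simp add: 3(2) epow_ennreal[OF 3(1)] ennreal_mult[symmetric] ennreal_plus[symmetric] del: ennreal_plus)
    also have "r powr ?\<theta> * (r powr ?\<theta> * (2 / (1-\<gamma>) * (1/r) powr (1-\<gamma>)) + (2 * r) powr (\<gamma>/2)) = ?C * r"
    proof -
      have 1: "r powr ?\<theta> * (r powr ?\<theta> * (1/r) powr (1-\<gamma>)) = r"
        using 3 by (simp add: powr_divide powr_add[symmetric] powr_minus_divide[symmetric] divide_powr_uminus flip: )
      have 2: "r powr ?\<theta> * (2 * r) powr (\<gamma>/2) = 2 powr (\<gamma>/2) * r"
        using 3 by (simp add: powr_mult powr_add[symmetric] mult.left_commute)
      show ?thesis using 1 2 by (simp add: algebra_simps)
    qed
    also have "ennreal (?C * r) = ennreal ?C * Y v" using 3 C by (simp add: ennreal_mult)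
    finally show ?thesis .
  qed
  then have "(\<integral>\<^sup>+v. \<integral>\<^sup>+u. indicator {u. X u \<le> Y v} u * (epow (X u) ?\<theta> * epow (Y v) ?\<theta> *
            epow (ennreal \<bar>u+v+s\<bar>) (-\<gamma>)) \<partial>lborel \<partial>lborel) \<le> (\<integral>\<^sup>+v. ennreal ?C * Y v \<partial>lborel)"
    by (rule nn_integral_mono)
  then show ?thesis by (simp add: nn_integral_cmult)
qed

text \<open>Twice the constant of \<open>HLS_half\<close>: one half is used where
  \<open>X u \<le> Y v\<close>, the other where \<open>Y v \<le> X u\<close>.\<close>

definition HLS_const :: "real \<Rightarrow> real" where
  "HLS_const \<gamma> = 2 * (2 / (1-\<gamma>) + 2 powr (\<gamma>/2))"

lemma HLS_const_pos: "0 < \<gamma> \<Longrightarrow> \<gamma> < 1 \<Longrightarrow> 0 < HLS_const \<gamma>"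
  by (simp add: HLS_const_def add_pos_pos)

lemma HLS_normalized:
  fixes X Y :: "real \<Rightarrow> ennreal"
  assumes [measurable]: "X \<in> borel_measurable borel" "Y \<in> borel_measurable borel"
    and \<gamma>: "0 < \<gamma>" "\<gamma> < 1" and X1: "(\<integral>\<^sup>+u. X u \<partial>lborel) \<le> 1" and Y1: "(\<integral>\<^sup>+u. Y u \<partial>lborel) \<le> 1"
  shows "(\<integral>\<^sup>+v. \<integral>\<^sup>+u. epow (X u) (1-\<gamma>/2) * epow (Y v) (1-\<gamma>/2) * epow (ennreal \<bar>u+v+s\<bar>) (-\<gamma>) \<partial>lborel \<partial>lborel)
     \<le> ennreal (HLS_const \<gamma>)"
proof -
  let ?C = "2 / (1-\<gamma>) + 2 powr (\<gamma>/2)"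
  let ?G = "\<lambda>u v. epow (X u) (1-\<gamma>/2) * epow (Y v) (1-\<gamma>/2) * epow (ennreal \<bar>u+v+s\<bar>) (-\<gamma>)"
  have C: "?C > 0" using \<gamma> by (intro add_pos_pos) auto
  have "(\<integral>\<^sup>+v. \<integral>\<^sup>+u. ?G u v \<partial>lborel \<partial>lborel)
     \<le> (\<integral>\<^sup>+v. \<integral>\<^sup>+u. indicator {u. X u \<le> Y v} u * ?G u v + indicator {v. Y v \<le> X u} v * ?G u v \<partial>lborel \<partial>lborel)"
    by (intro nn_integral_mono) (auto split: split_indicator)
  also have "\<dots> = (\<integral>\<^sup>+v. \<integral>\<^sup>+u. indicator {u. X u \<le> Y v} u * ?G u v \<partial>lborel \<partial>lborel)
      + (\<integral>\<^sup>+v. \<integral>\<^sup>+u. indicator {v. Y v \<le> X u} v * ?G u v \<partial>lborel \<partial>lborel)"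
    by (simp add: nn_integral_add indicator_def of_bool_def)
  also have "(\<integral>\<^sup>+v. \<integral>\<^sup>+u. indicator {v. Y v \<le> X u} v * ?G u v \<partial>lborel \<partial>lborel)
      = (\<integral>\<^sup>+u. \<integral>\<^sup>+v. indicator {v. Y v \<le> X u} v * ?G u v \<partial>lborel \<partial>lborel)"
    by (intro lborel_pair.Fubini') (simp add: indicator_def of_bool_def)
  also have "\<dots> = (\<integral>\<^sup>+u. \<integral>\<^sup>+v. indicator {v. Y v \<le> X u} v * (epow (Y v) (1-\<gamma>/2) * epow (X u) (1-\<gamma>/2) * epow (ennreal \<bar>v+u+s\<bar>) (-\<gamma>)) \<partial>lborel \<partial>lborel)"
    by (simp add: mult_ac add_ac)
  also have "(\<integral>\<^sup>+v. \<integral>\<^sup>+u. indicator {u. X u \<le> Y v} u * ?G u v \<partial>lborel \<partial>lborel) + \<dots>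
     \<le> ennreal ?C * (\<integral>\<^sup>+v. Y v \<partial>lborel) + ennreal ?C * (\<integral>\<^sup>+u. X u \<partial>lborel)"
    using assms by (intro add_mono HLS_half) auto
  also have "\<dots> \<le> ennreal ?C * 1 + ennreal ?C * 1"
    using X1 Y1 by (intro add_mono mult_left_mono) auto
  also have "\<dots> = ennreal (HLS_const \<gamma>)" using C by (simp add: HLS_const_def ennreal_plus[symmetric] del: ennreal_plus)
  finally show ?thesis .
qed

text \<open>Reduction to the normalized case by dilating each variable and dividing by the
  integrals. The dilation by \<alpha> gives |\<alpha>|^(1-\<gamma>/2) from the normalization of
  \<open>X\<close> and 1/|\<alpha>| from the measure, together |\<alpha>|^(-\<gamma>/2); likewise
  for \<beta>. Once vanishing integrals are dealt with, a vanishing coefficient or an infinite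
  integral makes the right-hand side \<infinity>.\<close>

lemma HLS_bilinear:
  fixes X Y :: "real \<Rightarrow> ennreal"
  assumes [measurable]: "X \<in> borel_measurable borel" "Y \<in> borel_measurable borel"
    and \<gamma>: "0 < \<gamma>" "\<gamma> < 1"
  shows "(\<integral>\<^sup>+v. \<integral>\<^sup>+u. epow (X u) (1-\<gamma>/2) * epow (Y v) (1-\<gamma>/2) * epow (ennreal \<bar>\<alpha> * u+\<beta> * v+s\<bar>) (-\<gamma>) \<partial>lborel \<partial>lborel)
     \<le> ennreal (HLS_const \<gamma>) * (epow (ennreal \<bar>\<alpha>\<bar>) (-(\<gamma>/2)) * epow (\<integral>\<^sup>+u. X u \<partial>lborel) (1-\<gamma>/2))
        * (epow (ennreal \<bar>\<beta>\<bar>) (-(\<gamma>/2)) * epow (\<integral>\<^sup>+v. Y v \<partial>lborel) (1-\<gamma>/2))"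
proof -
  let ?\<theta> = "1 - \<gamma>/2"
  define A where "A = (\<integral>\<^sup>+u. X u \<partial>lborel)"
  define B where "B = (\<integral>\<^sup>+u. Y u \<partial>lborel)"
  let ?L = "\<integral>\<^sup>+v. \<integral>\<^sup>+u. epow (X u) ?\<theta> * epow (Y v) ?\<theta> * epow (ennreal \<bar>\<alpha> * u+\<beta> * v+s\<bar>) (-\<gamma>) \<partial>lborel \<partial>lborel"
  let ?R = "ennreal (HLS_const \<gamma>) * (epow (ennreal \<bar>\<alpha>\<bar>) (-(\<gamma>/2)) * epow A ?\<theta>) * (epow (ennreal \<bar>\<beta>\<bar>) (-(\<gamma>/2)) * epow B ?\<theta>)"
  have \<theta>: "?\<theta> > 0" using \<gamma> by simp
  consider "A = 0" | "B = 0" | "A \<noteq> 0" "B \<noteq> 0" "\<alpha> = 0 \<or> \<beta> = 0 \<or> A = \<infinity> \<or> B = \<infinity>"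
    | "A \<noteq> 0" "B \<noteq> 0" "\<alpha> \<noteq> 0" "\<beta> \<noteq> 0" "A \<noteq> \<infinity>" "B \<noteq> \<infinity>" by blast
  then have "?L \<le> ?R"
  proof cases
    case 1
    then have X0: "AE u in lborel. X u = 0" by (simp add: A_def nn_integral_0_iff_AE)
    have "(\<integral>\<^sup>+u. epow (X u) ?\<theta> * epow (Y v) ?\<theta> * epow (ennreal \<bar>\<alpha> * u+\<beta> * v+s\<bar>) (-\<gamma>) \<partial>lborel) = (\<integral>\<^sup>+(u::real). 0 \<partial>lborel)" for v
    proof (rule nn_integral_cong_AE)
      show "AE u in lborel. epow (X u) ?\<theta> * epow (Y v) ?\<theta> * epow (ennreal \<bar>\<alpha> * u+\<beta> * v+s\<bar>) (-\<gamma>) = 0"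
        using X0 by eventually_elim (simp add: epow_zero_left[OF \<theta>])
    qed
    then show ?thesis by simp
  next
    case 2
    then have Y0: "AE v in lborel. Y v = 0" by (simp add: B_def nn_integral_0_iff_AE)
    have "?L = (\<integral>\<^sup>+(v::real). 0 \<partial>lborel)"
    proof (rule nn_integral_cong_AE)
      show "AE v in lborel. (\<integral>\<^sup>+u. epow (X u) ?\<theta> * epow (Y v) ?\<theta> * epow (ennreal \<bar>\<alpha> * u+\<beta> * v+s\<bar>) (-\<gamma>) \<partial>lborel) = 0"
        using Y0 by eventually_elim (simp add: epow_zero_left[OF \<theta>])
    qed
    then show ?thesis by simp
  next
    case 3
    have nz: "epow A ?\<theta> \<noteq> 0" "epow B ?\<theta> \<noteq> 0" "epow (ennreal \<bar>\<alpha>\<bar>) (-(\<gamma>/2)) \<noteq> 0" "epow (ennreal \<bar>\<beta>\<bar>) (-(\<gamma>/2)) \<noteq> 0" "ennreal (HLS_const \<gamma>) \<noteq> 0"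
      using 3 \<theta> \<gamma> HLS_const_pos[OF \<gamma>] by (auto simp: epow_eq_0_iff ennreal_eq_0_iff)
    have "epow (ennreal \<bar>\<alpha>\<bar>) (-(\<gamma>/2)) = \<infinity> \<or> epow (ennreal \<bar>\<beta>\<bar>) (-(\<gamma>/2)) = \<infinity> \<or> epow A ?\<theta> = \<infinity> \<or> epow B ?\<theta> = \<infinity>"
      using 3(3) \<theta> \<gamma> by (auto simp: epow_eq_top_iff simp del: infinity_ennreal_def)
    then have "?R = \<infinity>" using nz by (auto simp: ennreal_mult_eq_top_iff)
    then show ?thesis by simp
  next
    case 4
    define a where "a = enn2real A"
    define b where "b = enn2real B"
    have a: "A = ennreal a" "a > 0" and b: "B = ennreal b" "b > 0"
      using 4 by (auto simp: a_def b_def enn2real_positive_iff less_top zero_less_iff_neq_zero)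
    define X1 where "X1 u = X (u/\<alpha>) / ennreal (\<bar>\<alpha>\<bar> * a)" for u
    define Y1 where "Y1 v = Y (v/\<beta>) / ennreal (\<bar>\<beta>\<bar> * b)" for v
    have [measurable]: "X1 \<in> borel_measurable borel" "Y1 \<in> borel_measurable borel"
      by (auto simp: X1_def[abs_def] Y1_def[abs_def])
    have scal: "(\<integral>\<^sup>+u. Z (u / c) \<partial>lborel) = ennreal \<bar>c\<bar> * (\<integral>\<^sup>+u. Z u \<partial>lborel)"
      if "c \<noteq> 0" and [measurable]: "Z \<in> borel_measurable borel" for c :: real and Z
      using nn_integral_real_affine[of "\<lambda>u. Z (u/c)" c 0] that(1) by simp
    have X1i: "(\<integral>\<^sup>+u. X1 u \<partial>lborel) \<le> 1"
    proof -
      have "(\<integral>\<^sup>+u. X1 u \<partial>lborel) = (\<integral>\<^sup>+u. X (u/\<alpha>) \<partial>lborel) / ennreal (\<bar>\<alpha>\<bar> * a)"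
        by (simp add: X1_def nn_integral_divide)
      also have "\<dots> = ennreal (\<bar>\<alpha>\<bar> * a) / ennreal (\<bar>\<alpha>\<bar> * a)"
        using a scal[OF 4(3), of X] by (simp add: A_def[symmetric] ennreal_mult)
      finally show ?thesis using a 4 by (simp add: divide_ennreal)
    qed
    have Y1i: "(\<integral>\<^sup>+u. Y1 u \<partial>lborel) \<le> 1"
    proof -
      have "(\<integral>\<^sup>+u. Y1 u \<partial>lborel) = (\<integral>\<^sup>+u. Y (u/\<beta>) \<partial>lborel) / ennreal (\<bar>\<beta>\<bar> * b)"
        by (simp add: Y1_def nn_integral_divide)
      also have "\<dots> = ennreal (\<bar>\<beta>\<bar> * b) / ennreal (\<bar>\<beta>\<bar> * b)"
        using b scal[OF 4(4), of Y] by (simp add: B_def[symmetric] ennreal_mult)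
      finally show ?thesis using b 4 by (simp add: divide_ennreal)
    qed
    have Xeq: "X u = ennreal (\<bar>\<alpha>\<bar> * a) * X1 (\<alpha> * u)" for u
      using 4 a by (simp add: X1_def ennreal_times_divide ennreal_mult_divide_eq[of _ "X u"] mult_divide_eq_ennreal mult.commute)
    have Yeq: "Y u = ennreal (\<bar>\<beta>\<bar> * b) * Y1 (\<beta> * u)" for u
      using 4 b by (simp add: Y1_def ennreal_times_divide mult_divide_eq_ennreal mult.commute)
    define G where "G u v = epow (X1 u) ?\<theta> * epow (Y1 v) ?\<theta> * epow (ennreal \<bar>u+v+s\<bar>) (-\<gamma>)" for u v
    have Gm [measurable]: "case_prod G \<in> borel_measurable (borel \<Otimes>\<^sub>M borel)"
      unfolding G_def[abs_def] by measurable
    let ?c = "ennreal ((\<bar>\<alpha>\<bar> * a) powr ?\<theta>) * ennreal ((\<bar>\<beta>\<bar> * b) powr ?\<theta>)"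
    have "?L = (\<integral>\<^sup>+v. \<integral>\<^sup>+u. ?c * G (\<alpha> * u) (\<beta> * v) \<partial>lborel \<partial>lborel)"
      using 4 a b \<theta> by (intro nn_integral_cong) (simp add: Xeq[of "_"] Yeq[of "_"] epow_mult epow_ennreal G_def mult_ac)
    also have "\<dots> = ?c * (\<integral>\<^sup>+v. \<integral>\<^sup>+u. G (\<alpha> * u) (\<beta> * v) \<partial>lborel \<partial>lborel)"
      by (simp add: nn_integral_cmult)
    also have "(\<integral>\<^sup>+v. \<integral>\<^sup>+u. G (\<alpha> * u) (\<beta> * v) \<partial>lborel \<partial>lborel)
       = (\<integral>\<^sup>+v. ennreal \<bar>1/\<alpha>\<bar> * (\<integral>\<^sup>+u. G u (\<beta> * v) \<partial>lborel) \<partial>lborel)"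
      using scal[of "1/\<alpha>" "\<lambda>u. G u (\<beta> * v)" for v] 4(3)
      by (intro nn_integral_cong) (simp add: mult.commute)
    also have "\<dots> = ennreal \<bar>1/\<alpha>\<bar> * (ennreal \<bar>1/\<beta>\<bar> * (\<integral>\<^sup>+v. \<integral>\<^sup>+u. G u v \<partial>lborel \<partial>lborel))"
      using scal[of "1/\<beta>" "\<lambda>v. \<integral>\<^sup>+u. G u v \<partial>lborel"] 4(4)
      by (simp add: nn_integral_cmult mult.commute)
    also have "?c * \<dots> \<le> ?c * (ennreal \<bar>1/\<alpha>\<bar> * (ennreal \<bar>1/\<beta>\<bar> * ennreal (HLS_const \<gamma>)))"
      unfolding G_def using X1i Y1i \<gamma> by (intro mult_left_mono HLS_normalized) auto
    also have "\<dots> = ennreal (HLS_const \<gamma>) * (ennreal ((\<bar>\<alpha>\<bar> * a) powr ?\<theta>) * ennreal \<bar>1/\<alpha>\<bar>) * (ennreal ((\<bar>\<beta>\<bar> * b) powr ?\<theta>) * ennreal \<bar>1/\<beta>\<bar>)"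
      by (simp only: mult_ac)
    also have "ennreal ((\<bar>\<alpha>\<bar> * a) powr ?\<theta>) * ennreal \<bar>1/\<alpha>\<bar> = epow (ennreal \<bar>\<alpha>\<bar>) (-(\<gamma>/2)) * epow A ?\<theta>"
    proof -
      have "\<bar>\<alpha>\<bar> powr ?\<theta> * \<bar>1/\<alpha>\<bar> = \<bar>\<alpha>\<bar> powr (-(\<gamma>/2))"
        using 4(3) by (simp add: powr_diff powr_minus_divide)
      moreover have "(\<bar>\<alpha>\<bar> * a) powr ?\<theta> * \<bar>1/\<alpha>\<bar> = (\<bar>\<alpha>\<bar> powr ?\<theta> * \<bar>1/\<alpha>\<bar>) * a powr ?\<theta>"
        using a by (simp add: powr_mult)
      ultimately have "(\<bar>\<alpha>\<bar> * a) powr ?\<theta> * \<bar>1/\<alpha>\<bar> = \<bar>\<alpha>\<bar> powr (-(\<gamma>/2)) * a powr ?\<theta>"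
        by simp
      then show ?thesis using a 4(3) by (simp add: epow_ennreal ennreal_mult[symmetric])
    qed
    also have "ennreal ((\<bar>\<beta>\<bar> * b) powr ?\<theta>) * ennreal \<bar>1/\<beta>\<bar> = epow (ennreal \<bar>\<beta>\<bar>) (-(\<gamma>/2)) * epow B ?\<theta>"
    proof -
      have "\<bar>\<beta>\<bar> powr ?\<theta> * \<bar>1/\<beta>\<bar> = \<bar>\<beta>\<bar> powr (-(\<gamma>/2))"
        using 4(4) by (simp add: powr_diff powr_minus_divide)
      moreover have "(\<bar>\<beta>\<bar> * b) powr ?\<theta> * \<bar>1/\<beta>\<bar> = (\<bar>\<beta>\<bar> powr ?\<theta> * \<bar>1/\<beta>\<bar>) * b powr ?\<theta>"
        using b by (simp add: powr_mult)
      ultimately have "(\<bar>\<beta>\<bar> * b) powr ?\<theta> * \<bar>1/\<beta>\<bar> = \<bar>\<beta>\<bar> powr (-(\<gamma>/2)) * b powr ?\<theta>"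
        by simp
      then show ?thesis using b 4(4) by (simp add: epow_ennreal ennreal_mult[symmetric])
    qed
    finally show ?thesis .
  qed
  then show ?thesis by (simp add: A_def B_def)
qed

interpretation lborel_product: product_sigma_finite "\<lambda>_. lborel :: real measure"
  by standard

text \<open>
  The integrand is the geometric mean, over all ordered pairs of distinct indices, of integrands in
  which only the two functions of the pair are raised to a power other than one: those are
  bilinear estimates.
\<close>

lemma HLS_multilinear:
  fixes x :: "'i \<Rightarrow> real \<Rightarrow> ennreal" and c :: "'i \<Rightarrow> real"
  assumes J: "finite J" "card J \<ge> 2" and x [measurable]: "\<And>j. j \<in> J \<Longrightarrow> x j \<in> borel_measurable borel"
    and \<gamma>: "0 < \<gamma>" "\<gamma> < 1"
  shows "(\<integral>\<^sup>+u. (\<Prod>j\<in>J. epow (x j (u j)) (1 - \<gamma>/card J)) * epow (ennreal \<bar>\<Sum>j\<in>J. c j * u j\<bar>) (-\<gamma>) \<partial>PiM J (\<lambda>_. lborel))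
     \<le> ennreal (HLS_const \<gamma>) * (\<Prod>j\<in>J. epow (ennreal \<bar>c j\<bar>) (-(\<gamma>/card J)) * epow (\<integral>\<^sup>+u. x j u \<partial>lborel) (1 - \<gamma>/card J))"
proof -
  define m where "m = real (card J)"
  have m: "m \<ge> 2" using J by (simp add: m_def)
  define E where "E = {(a,b). a \<in> J \<and> b \<in> J \<and> a \<noteq> b}"
  define w where "w = 1 / (m * (m-1))"
  have w: "w > 0" using m by (simp add: w_def)
  have E_eq: "E = (SIGMA a:J. J - {a})" by (auto simp: E_def)
  have finE: "finite E" unfolding E_eq using J by auto
  have cardE: "real (card E) = m * (m-1)"
    unfolding E_eq using J by (simp add: m_def of_nat_diff)
  \<comment> \<open>The amount by which the exponent of \<open>x j\<close> falls short of 1 in the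
    estimate belonging to the pair \<open>e\<close>. An index lies in 2(m-1) of the m(m-1) ordered
    pairs, so the average of \<open>d e j\<close> over \<open>E\<close> is \<gamma>/m.\<close>
  define d where "d e j = (if j = fst e then \<gamma>/2 else 0) + (if j = snd e then \<gamma>/2 else 0)" for e :: "'i \<times> 'i" and j
  have d: "0 \<le> d e j" "d e j \<le> 1" for e j using \<gamma> by (auto simp: d_def)
  have sum_w: "(\<Sum>e\<in>E. w) = 1" using cardE m by (simp add: w_def)
  have sum_d: "(\<Sum>e\<in>E. d e j * w) = \<gamma>/m" if "j \<in> J" for j
  proof -
    have "(\<Sum>e\<in>E. d e j) = (\<Sum>a\<in>J. \<Sum>b\<in>J-{a}. (if j = a then \<gamma>/2 else 0) + (if j = b then \<gamma>/2 else 0))"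
      unfolding E_eq d_def using J by (subst sum.Sigma) (auto simp: case_prod_beta)
    also have "\<dots> = (\<Sum>a\<in>J. (if j = a then (m-1) * (\<gamma>/2) else 0) + (if j = a then 0 else \<gamma>/2))"
    proof (rule sum.cong[OF refl])
      fix a assume a: "a \<in> J"
      have "real (card (J - {a})) = m - 1" using J a by (simp add: m_def of_nat_diff)
      then show "(\<Sum>b\<in>J-{a}. (if j = a then \<gamma>/2 else 0) + (if j = b then \<gamma>/2 else 0))
          = (if j = a then (m-1) * (\<gamma>/2) else 0) + (if j = a then 0 else \<gamma>/2)"
        using J a that by (auto simp: sum.distrib sum.delta)
    qed
    also have "\<dots> = (m-1) * (\<gamma>/2) + (\<Sum>a\<in>J-{j}. \<gamma>/2)"
    proof -
      have "(\<Sum>a\<in>J-{j}. (if j = a then (m-1) * (\<gamma>/2) else 0) + (if j = a then 0 else \<gamma>/2)) = (\<Sum>a\<in>J-{j}. \<gamma>/2)"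
        by (intro sum.cong) auto
      then show ?thesis by (simp only: sum.remove[OF J(1) that] if_True simp_thms add_0_right)
    qed
    also have "\<dots> = (m-1) * \<gamma>" using J that by (simp add: m_def of_nat_diff)
    finally have "(\<Sum>e\<in>E. d e j) * w = (m-1) * \<gamma> * w" by simp
    also have "\<dots> = \<gamma>/m" using m by (simp add: w_def)
    finally show ?thesis by (simp only: sum_distrib_right)
  qed
  have sum_d': "(\<Sum>e\<in>E. (1 - d e j) * w) = 1 - \<gamma>/m" if "j \<in> J" for j
    using sum_d[OF that] sum_w by (simp add: left_diff_distrib sum_subtractf)
  define k where "k u = epow (ennreal \<bar>\<Sum>j\<in>J. c j * u j\<bar>) (-\<gamma>)" for u
  define X where "X j = (\<integral>\<^sup>+u. x j u \<partial>lborel)" for j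
  \<comment> \<open>The inverse is named so that only nonnegative exponents are applied to it, for
    which \<open>epow_add\<close> and \<open>epow_mult\<close> hold at 0 and \<infinity> as
    well.\<close>
  define D where "D j = epow (ennreal \<bar>c j\<bar>) (-1)" for j
  define G where "G e u = (\<Prod>j\<in>J. epow (x j (u j)) (1 - d e j)) * k u" for e u
  have xm [measurable]: "(\<lambda>u. x j (u j)) \<in> borel_measurable (PiM I (\<lambda>_. lborel))" if "j \<in> J" "j \<in> I" for I j
    using measurable_compose[OF measurable_component_singleton[OF that(2), where M = "\<lambda>_. lborel"], of "x j" borel] x[OF that(1)] by simp
  have um: "(\<lambda>u. u j :: real) \<in> borel_measurable (PiM J (\<lambda>_. lborel))" if "j \<in> J" for j
    using measurable_component_singleton[OF that, where M = "\<lambda>_. lborel :: real measure"] by simp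
  have km [measurable]: "k \<in> borel_measurable (PiM J (\<lambda>_. lborel))"
    unfolding k_def[abs_def]
    by (intro borel_measurable_epow measurable_compose[OF _ measurable_ennreal] borel_measurable_abs borel_measurable_sum borel_measurable_times um) auto
  have Gm: "G e \<in> borel_measurable (PiM J (\<lambda>_. lborel))" for e
    unfolding G_def[abs_def] by (intro borel_measurable_times_ennreal borel_measurable_prod_ennreal borel_measurable_epow xm km)
  have G_le: "(\<integral>\<^sup>+u. G e u \<partial>PiM J (\<lambda>_. lborel))
      \<le> ennreal (HLS_const \<gamma>) * (\<Prod>j\<in>J. epow (D j) (d e j) * epow (X j) (1 - d e j))" if e: "e \<in> E" for e
  proof -
    obtain a b where ab: "e = (a,b)" "a \<in> J" "b \<in> J" "a \<noteq> b" using e by (auto simp: E_def)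
    define J' where "J' = J - {a,b}"
    have J': "finite J'" "a \<notin> insert b J'" "b \<notin> J'" "insert a (insert b J') = J" "J' \<subseteq> J" "a \<notin> J'"
      using J ab by (auto simp: J'_def)
    have split: "(\<Prod>j\<in>J. f j) = f a * (f b * (\<Prod>j\<in>J'. f j))" for f :: "'i \<Rightarrow> ennreal"
      unfolding J'(4)[symmetric] using J'(1,2,3) by simp
    have splits: "(\<Sum>j\<in>J. f j) = f a + (f b + (\<Sum>j\<in>J'. f j))" for f :: "'i \<Rightarrow> real"
      unfolding J'(4)[symmetric] using J'(1,2,3) by simp
    have dJ': "d e j = 0" if "j \<in> J'" for j using that ab by (auto simp: d_def J'_def)
    have dab: "d e a = \<gamma>/2" "d e b = \<gamma>/2" using ab by (auto simp: d_def)
    define H where "H z = (\<integral>\<^sup>+u. G e (z(a := u)) \<partial>lborel)" for z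
    have "(\<lambda>(z, u). z(a := u)) \<in> measurable (PiM (insert b J') (\<lambda>_. lborel) \<Otimes>\<^sub>M lborel) (PiM (insert a (insert b J')) (\<lambda>_. lborel))"
      by (rule measurable_add_dim)
    from measurable_compose[OF this[unfolded J'(4)] Gm[of e]]
    have "(\<lambda>(z, u). G e (z(a := u))) \<in> borel_measurable (PiM (insert b J') (\<lambda>_. lborel) \<Otimes>\<^sub>M lborel)"
      by (simp add: case_prod_beta)
    then have Hm: "H \<in> borel_measurable (PiM (insert b J') (\<lambda>_. lborel))"
      unfolding H_def[abs_def] by (rule lborel.borel_measurable_nn_integral)
    have "(\<integral>\<^sup>+u. G e u \<partial>PiM J (\<lambda>_. lborel)) = (\<integral>\<^sup>+z. H z \<partial>PiM (insert b J') (\<lambda>_. lborel))"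
      using lborel_product.product_nn_integral_insert[OF _ J'(2), of "G e"] J' Gm[of e] by (simp add: H_def)
    also have "\<dots> = (\<integral>\<^sup>+y. \<integral>\<^sup>+v. H (y(b := v)) \<partial>lborel \<partial>PiM J' (\<lambda>_. lborel))"
      by (rule lborel_product.product_nn_integral_insert[OF J'(1,3) Hm])
    also have "\<dots> \<le> (\<integral>\<^sup>+y. (\<Prod>j\<in>J'. x j (y j)) * (ennreal (HLS_const \<gamma>) * (epow (ennreal \<bar>c a\<bar>) (-(\<gamma>/2)) * epow (X a) (1-\<gamma>/2))
        * (epow (ennreal \<bar>c b\<bar>) (-(\<gamma>/2)) * epow (X b) (1-\<gamma>/2))) \<partial>PiM J' (\<lambda>_. lborel))"
    proof (rule nn_integral_mono)
      fix y :: "'i \<Rightarrow> real" 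
      \<comment> \<open>For fixed \<open>y\<close> the variables outside the pair only translate the
        argument of the kernel, and the bilinear bound is uniform in the translation.\<close>
      let ?s = "\<Sum>j\<in>J'. c j * y j"
      have [measurable]: "x a \<in> borel_measurable borel" "x b \<in> borel_measurable borel" using x ab by auto
      have "(\<integral>\<^sup>+v. H (y(b := v)) \<partial>lborel) = (\<integral>\<^sup>+v. \<integral>\<^sup>+u. (\<Prod>j\<in>J'. x j (y j)) *
          (epow (x a u) (1-\<gamma>/2) * epow (x b v) (1-\<gamma>/2) * epow (ennreal \<bar>c a * u + c b * v + ?s\<bar>) (-\<gamma>)) \<partial>lborel \<partial>lborel)"
      proof (unfold H_def, intro nn_integral_cong)
        fix u v :: real
        have p: "(\<Prod>j\<in>J'. epow (x j ((y(b := v, a := u)) j)) (1 - d e j)) = (\<Prod>j\<in>J'. x j (y j))"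
          using J' by (intro prod.cong) (auto simp: dJ')
        have q: "(\<Sum>j\<in>J'. c j * (y(b := v, a := u)) j) = ?s"
          using J' by (intro sum.cong) auto
        show "G e (y(b := v, a := u)) = (\<Prod>j\<in>J'. x j (y j)) *
          (epow (x a u) (1-\<gamma>/2) * epow (x b v) (1-\<gamma>/2) * epow (ennreal \<bar>c a * u + c b * v + ?s\<bar>) (-\<gamma>))"
          unfolding G_def k_def split splits p q using ab(4) by (simp add: dab mult_ac add.assoc)
      qed
      also have "\<dots> = (\<Prod>j\<in>J'. x j (y j)) *
          (\<integral>\<^sup>+v. \<integral>\<^sup>+u. (epow (x a u) (1-\<gamma>/2) * epow (x b v) (1-\<gamma>/2) * epow (ennreal \<bar>c a * u + c b * v + ?s\<bar>) (-\<gamma>)) \<partial>lborel \<partial>lborel)"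
        by (simp add: nn_integral_cmult)
      also have "\<dots> \<le> (\<Prod>j\<in>J'. x j (y j)) * (ennreal (HLS_const \<gamma>) * (epow (ennreal \<bar>c a\<bar>) (-(\<gamma>/2)) * epow (X a) (1-\<gamma>/2))
        * (epow (ennreal \<bar>c b\<bar>) (-(\<gamma>/2)) * epow (X b) (1-\<gamma>/2)))"
        unfolding X_def using \<gamma> by (intro mult_left_mono HLS_bilinear) auto
      finally show "(\<integral>\<^sup>+v. H (y(b := v)) \<partial>lborel) \<le> \<dots>" .
    qed
    also have "\<dots> = (\<integral>\<^sup>+y. (\<Prod>j\<in>J'. x j (y j)) \<partial>PiM J' (\<lambda>_. lborel)) * (ennreal (HLS_const \<gamma>) * (epow (ennreal \<bar>c a\<bar>) (-(\<gamma>/2)) * epow (X a) (1-\<gamma>/2))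
        * (epow (ennreal \<bar>c b\<bar>) (-(\<gamma>/2)) * epow (X b) (1-\<gamma>/2)))"
      using J'(5) by (intro nn_integral_multc borel_measurable_prod_ennreal xm) auto
    also have "(\<integral>\<^sup>+y. (\<Prod>j\<in>J'. x j (y j)) \<partial>PiM J' (\<lambda>_. lborel)) = (\<Prod>j\<in>J'. X j)"
      unfolding X_def using J' x by (intro lborel_product.product_nn_integral_prod) auto
    also have "(\<Prod>j\<in>J'. X j) = (\<Prod>j\<in>J'. epow (D j) (d e j) * epow (X j) (1 - d e j))"
      by (intro prod.cong) (auto simp: dJ')
    finally show ?thesis
      unfolding split by (simp add: dab D_def epow_epow mult_ac)
  qed
  have "(\<integral>\<^sup>+u. (\<Prod>j\<in>J. epow (x j (u j)) (1 - \<gamma>/m)) * k u \<partial>PiM J (\<lambda>_. lborel))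
      = (\<integral>\<^sup>+u. (\<Prod>e\<in>E. epow (G e u) w) \<partial>PiM J (\<lambda>_. lborel))"
  proof (rule nn_integral_cong)
    fix u :: "'i \<Rightarrow> real"
    have "(\<Prod>e\<in>E. epow (G e u) w) = (\<Prod>e\<in>E. \<Prod>j\<in>J. epow (x j (u j)) ((1 - d e j) * w)) * (\<Prod>e\<in>E. epow (k u) w)"
      using w by (simp add: G_def epow_mult epow_prod epow_epow prod.distrib)
    also have "(\<Prod>e\<in>E. epow (k u) w) = k u"
      using w by (subst epow_sum[symmetric]) (simp_all only: sum_w epow_one_right less_imp_le)
    also have "(\<Prod>e\<in>E. \<Prod>j\<in>J. epow (x j (u j)) ((1 - d e j) * w)) = (\<Prod>j\<in>J. \<Prod>e\<in>E. epow (x j (u j)) ((1 - d e j) * w))"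
      by (rule prod.swap)
    also have "\<dots> = (\<Prod>j\<in>J. epow (x j (u j)) (1 - \<gamma>/m))"
      using d w by (intro prod.cong refl) (simp add: epow_sum[symmetric] sum_d')
    finally show "(\<Prod>j\<in>J. epow (x j (u j)) (1 - \<gamma>/m)) * k u = (\<Prod>e\<in>E. epow (G e u) w)" by simp
  qed
  also have "\<dots> \<le> (\<Prod>e\<in>E. epow (\<integral>\<^sup>+u. G e u \<partial>PiM J (\<lambda>_. lborel)) w)"
    using finE w sum_w Gm by (intro nn_integral_Holder) auto
  also have "\<dots> \<le> (\<Prod>e\<in>E. epow (ennreal (HLS_const \<gamma>) * (\<Prod>j\<in>J. epow (D j) (d e j) * epow (X j) (1 - d e j))) w)"
    using w G_le by (intro ennreal_prod_mono epow_mono) auto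
  also have "\<dots> = (\<Prod>e\<in>E. epow (ennreal (HLS_const \<gamma>)) w) * (\<Prod>e\<in>E. \<Prod>j\<in>J. epow (D j) (d e j * w) * epow (X j) ((1 - d e j) * w))"
    using w by (simp add: epow_mult epow_prod epow_epow prod.distrib)
  also have "(\<Prod>e\<in>E. epow (ennreal (HLS_const \<gamma>)) w) = ennreal (HLS_const \<gamma>)"
    using w by (subst epow_sum[symmetric]) (simp_all only: sum_w epow_one_right less_imp_le)
  also have "(\<Prod>e\<in>E. \<Prod>j\<in>J. epow (D j) (d e j * w) * epow (X j) ((1 - d e j) * w))
      = (\<Prod>j\<in>J. \<Prod>e\<in>E. epow (D j) (d e j * w) * epow (X j) ((1 - d e j) * w))"
    by (rule prod.swap)
  also have "\<dots> = (\<Prod>j\<in>J. epow (ennreal \<bar>c j\<bar>) (-(\<gamma>/m)) * epow (X j) (1 - \<gamma>/m))"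
  proof (intro prod.cong refl)
    fix j assume "j \<in> J"
    then show "(\<Prod>e\<in>E. epow (D j) (d e j * w) * epow (X j) ((1 - d e j) * w)) = epow (ennreal \<bar>c j\<bar>) (-(\<gamma>/m)) * epow (X j) (1 - \<gamma>/m)"
      using d w by (simp add: prod.distrib epow_sum[symmetric] sum_d sum_d') (simp add: D_def epow_epow)
  qed
  finally show ?thesis by (simp add: k_def X_def m_def)
qed

section \<open>Minors of the matrix of affine functions\<close>

text \<open>
  The index type of the coefficients of an affine function on \<^typ>\<open>real ^ 'k\<close>. It is well-ordered
  since the formula for the measure of a linear image is available only for such index types.
\<close>

datatype 'k affine_index = Shift | Slope 'k

instance affine_index :: (finite) finite
proof
  have "(UNIV :: 'a affine_index set) = insert Shift (range Slope)"
    by (auto intro: affine_index.exhaust)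
  then show "finite (UNIV :: 'a affine_index set)" by (metis finite finite_imageI finite_insert)
qed

fun affine_rank :: "'k::finite affine_index \<Rightarrow> nat" where
  "affine_rank Shift = 0"
| "affine_rank (Slope k) = Suc (to_nat k)"

lemma affine_rank_inject [simp]: "affine_rank i = affine_rank j \<longleftrightarrow> i = j"
  by (cases i; cases j) auto

instantiation affine_index :: (finite) wellorder
begin
definition less_eq_affine_index :: "'a affine_index \<Rightarrow> 'a affine_index \<Rightarrow> bool" where
  "less_eq_affine_index i j \<longleftrightarrow> affine_rank i \<le> affine_rank j"
definition less_affine_index :: "'a affine_index \<Rightarrow> 'a affine_index \<Rightarrow> bool" where
  "less_affine_index i j \<longleftrightarrow> affine_rank i < affine_rank j"
instance
proof
  fix P :: "'a affine_index \<Rightarrow> bool" and a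
  assume step: "\<And>i. (\<And>j. j < i \<Longrightarrow> P j) \<Longrightarrow> P i"
  show "P a"
  proof (induction a rule: measure_induct_rule[of affine_rank])
    case (less i)
    show ?case by (rule step) (use less in \<open>simp only: less_affine_index_def\<close>)
  qed
qed (auto simp: less_eq_affine_index_def less_affine_index_def)
end

lemma card_affine_index: "CARD('k::finite affine_index) = CARD('k) + 1"
proof -
  have "(UNIV :: 'k affine_index set) = insert Shift (range Slope)"
    by (auto intro: affine_index.exhaust)
  moreover have "card (range (Slope :: 'k \<Rightarrow> _)) = CARD('k)" by (intro card_image) (auto simp: inj_def)
  moreover have "Shift \<notin> range (Slope :: 'k \<Rightarrow> _)" by auto
  ultimately show ?thesis by (metis Suc_eq_plus1 card_insert_disjoint finite)
qed

text \<open>Laplace expansion with minors of full size: row \<open>i\<close> and column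
  \<open>c\<close> become unit vectors instead of being deleted. A permutation sends exactly one
  index to \<open>c\<close>, so each term of the Leibniz formula is recovered from a single
  \<open>i\<close>.\<close>

lemma det_expand_column:
  fixes A :: "'a::comm_ring_1^'m^'m"
  shows "det A = (\<Sum>i\<in>UNIV. A$i$c *
      det (\<chi> i' r. if i' = i then (if r = c then 1 else 0) else if r = c then 0 else A$i'$r))"
proof -
  have *: "(\<Sum>i\<in>UNIV. A$i$c * (\<Prod>i'\<in>UNIV. if i' = i then (if p i' = c then 1 else 0) else if p i' = c then 0 else A$i'$p i'))
      = (\<Prod>i\<in>UNIV. A$i$p i)" if p: "p permutes UNIV" for p :: "'m \<Rightarrow> 'm"
  proof -
    obtain i0 where i0: "p i0 = c" using p by (metis permutes_def)
    have inj: "p i = c \<longleftrightarrow> i = i0" for i using p i0 by (metis permutes_def)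
    have "(\<Prod>i'\<in>UNIV. if i' = i then (if p i' = c then 1 else 0) else if p i' = c then 0 else A$i'$p i') = 0"
      if "i \<noteq> i0" for i
      using that by (intro prod_zero bexI[of _ i]) (auto simp: inj)
    then have "(\<Sum>i\<in>UNIV. A$i$c * (\<Prod>i'\<in>UNIV. if i' = i then (if p i' = c then 1 else 0) else if p i' = c then 0 else A$i'$p i'))
        = A$i0$c * (\<Prod>i'\<in>UNIV. if i' = i0 then (if p i' = c then 1 else 0) else if p i' = c then 0 else A$i'$p i')"
      by (subst sum.remove[of _ i0]) auto
    also have "(\<Prod>i'\<in>UNIV. if i' = i0 then (if p i' = c then 1 else 0) else if p i' = c then 0 else A$i'$p i')
        = (\<Prod>i'\<in>UNIV-{i0}. A$i'$p i')"
      by (subst prod.remove[of _ i0]) (auto simp: inj i0 intro!: prod.cong)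
    also have "A$i0$c * \<dots> = (\<Prod>i\<in>UNIV. A$i$p i)"
      by (subst prod.remove[of UNIV i0]) (auto simp: i0)
    finally show ?thesis .
  qed
  have "(\<Sum>i\<in>UNIV. A$i$c *
      det (\<chi> i' r. if i' = i then (if r = c then 1 else 0) else if r = c then 0 else A$i'$r))
    = (\<Sum>i\<in>UNIV. \<Sum>p | p permutes UNIV. of_int (sign p) * (A$i$c * (\<Prod>i'\<in>UNIV. if i' = i then (if p i' = c then 1 else 0) else if p i' = c then 0 else A$i'$p i')))"
    by (simp add: det_def sum_distrib_left mult_ac)
  also have "\<dots> = (\<Sum>p | p permutes UNIV. of_int (sign p) * (\<Sum>i\<in>UNIV. A$i$c * (\<Prod>i'\<in>UNIV. if i' = i then (if p i' = c then 1 else 0) else if p i' = c then 0 else A$i'$p i')))"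
    by (subst sum.swap) (simp add: sum_distrib_left)
  also have "\<dots> = det A"
    unfolding det_def by (intro sum.cong refl) (simp add: *)
  finally show ?thesis by simp
qed

lemma range_map_upd_None:
  assumes "\<rho> i = None"
  shows "Some c \<in> range (\<rho>(i \<mapsto> c')) \<longleftrightarrow> c = c' \<or> Some c \<in> range \<rho>"
proof
  assume "c = c' \<or> Some c \<in> range \<rho>"
  then show "Some c \<in> range (\<rho>(i \<mapsto> c'))"
  proof
    assume "Some c \<in> range \<rho>"
    then obtain i' where i': "\<rho> i' = Some c" by (metis imageE)
    then have "(\<rho>(i \<mapsto> c')) i' = Some c" using assms by auto
    then show ?thesis by (metis rangeI)
  qed (metis fun_upd_same rangeI)
qed (auto split: if_splits)

text \<open>
  For \<open>\<rho> = (\<lambda>_. None)\<close> this is the determinant of the system \<open>b + 2 a \<bullet> y\<^sub>i = s\<^sub>i\<close> in \<open>(a, b)\<close>. A row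
  with \<open>\<rho> i = Some c\<close> is replaced by the unit vector of \<open>c\<close> and column \<open>c\<close> is cleared elsewhere, so
  that minors are written with the full index type, up to sign.
\<close>

definition affine_minor ::
  "('k::finite affine_index \<Rightarrow> 'r) \<Rightarrow> ('r \<times> 'k \<Rightarrow> real) \<Rightarrow> ('k affine_index \<Rightarrow> 'k affine_index option) \<Rightarrow> real" where
  "affine_minor e y \<rho> = det (\<chi> i c. case \<rho> i of
       Some c' \<Rightarrow> if c = c' then 1 else 0
     | None \<Rightarrow> if Some c \<in> range \<rho> then 0 else (case c of Shift \<Rightarrow> 1 | Slope k \<Rightarrow> 2 * y (e i, k)))"

lemma affine_minor_cong:
  assumes "\<And>i k. \<rho> i = None \<Longrightarrow> Some (Slope k) \<notin> range \<rho> \<Longrightarrow> y (e i, k) = y' (e i, k)"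
  shows "affine_minor e y \<rho> = affine_minor e y' \<rho>"
  unfolding affine_minor_def
proof (intro arg_cong[where f = det] Cart_lambda_cong)
  fix i c :: "'a affine_index"
  show "(case \<rho> i of Some c' \<Rightarrow> if c = c' then 1 else 0
     | None \<Rightarrow> if Some c \<in> range \<rho> then 0 else (case c of Shift \<Rightarrow> 1 | Slope k \<Rightarrow> 2 * y (e i, k))) =
     (case \<rho> i of Some c' \<Rightarrow> if c = c' then 1 else 0
     | None \<Rightarrow> if Some c \<in> range \<rho> then 0 else (case c of Shift \<Rightarrow> 1 | Slope k \<Rightarrow> 2 * y' (e i, k)))"
    using assms[of i] by (cases "\<rho> i"; cases c) simp_all
qed

text \<open>The minors on the right have column \<open>Slope k\<close> cleared, so they are free of
  the coordinates \<open>y (e i, k)\<close>. Thus the determinant is a linear form in these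
  coordinates, which is the kernel of \<open>HLS_multilinear\<close>.\<close>

lemma affine_minor_expand:
  assumes "Some (Slope k) \<notin> range \<rho>"
  shows "affine_minor e y \<rho> = (\<Sum>i | \<rho> i = None. 2 * affine_minor e y (\<rho>(i \<mapsto> Slope k)) * y (e i, k))"
proof -
  let ?A = "(\<chi> i c. case \<rho> i of
       Some c' \<Rightarrow> if c = c' then 1 else 0
     | None \<Rightarrow> if Some c \<in> range \<rho> then 0 else (case c of Shift \<Rightarrow> 1 | Slope k \<Rightarrow> 2 * y (e i, k))) :: real^'a affine_index^'a affine_index"
  let ?c = "Slope k"
  let ?B = "\<lambda>i. (\<chi> i' r. if i' = i then (if r = ?c then 1 else 0) else if r = ?c then 0 else ?A$i'$r) :: real^'a affine_index^'a affine_index"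
  have B: "affine_minor e y (\<rho>(i \<mapsto> ?c)) = det (?B i)" if "\<rho> i = None" for i
  proof -
    note r = range_map_upd_None[of \<rho>, OF that]
    have "\<rho> i' \<noteq> Some ?c" for i' using assms by (metis rangeI)
    then show ?thesis
      unfolding affine_minor_def r
    proof (intro arg_cong[where f = det] Cart_lambda_cong)
      fix i' r
      show "(case (\<rho>(i \<mapsto> ?c)) i' of Some c' \<Rightarrow> if r = c' then 1 else 0
         | None \<Rightarrow> if r = ?c \<or> Some r \<in> range \<rho> then 0 else (case r of Shift \<Rightarrow> 1 | Slope k \<Rightarrow> 2 * y (e i', k)))
        = (if i' = i then (if r = ?c then 1 else 0) else if r = ?c then 0 else ?A$i'$r)"
        using that \<open>\<rho> i' \<noteq> Some ?c\<close> by (cases "i' = i"; cases "\<rho> i'") simp_all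
    qed
  qed
  have "affine_minor e y \<rho> = (\<Sum>i\<in>UNIV. ?A$i$?c * det (?B i))"
    unfolding affine_minor_def by (rule det_expand_column)
  also have "\<dots> = (\<Sum>i | \<rho> i = None. ?A$i$?c * det (?B i))"
  proof (intro sum.mono_neutral_right ballI)
    fix i assume "i \<in> UNIV - {i. \<rho> i = None}"
    then obtain c' where c': "\<rho> i = Some c'" by auto
    then have "c' \<noteq> ?c" using assms by (metis rangeI)
    then show "?A$i$?c * det (?B i) = 0" using c' by simp
  qed auto
  also have "\<dots> = (\<Sum>i | \<rho> i = None. 2 * affine_minor e y (\<rho>(i \<mapsto> Slope k)) * y (e i, k))"
    using assms by (intro sum.cong refl) (simp add: B[symmetric] del: vec_lambda_eta)
  finally show ?thesis .
qed

text \<open>The end of the expansion: one row is left and every slope column is gone, so the only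
  entry that survives is the constant 1 in column \<open>Shift\<close>.\<close>

lemma affine_minor_ne_0:
  assumes J: "{i. \<rho> i = None} = {j}" and \<rho>: "\<rho> ` (-{j}) = Some ` range Slope"
  shows "affine_minor e y \<rho> \<noteq> 0"
proof -
  let ?A = "(\<chi> i c. case \<rho> i of
       Some c' \<Rightarrow> if c = c' then 1 else 0
     | None \<Rightarrow> if Some c \<in> range \<rho> then 0 else (case c of Shift \<Rightarrow> 1 | Slope k \<Rightarrow> 2 * y (e i, k))) :: real^'a affine_index^'a affine_index"
  have nj: "\<rho> j = None" using J by auto
  have sh: "Some Shift \<notin> range \<rho>"
  proof
    assume "Some Shift \<in> range \<rho>"
    then obtain i where i: "\<rho> i = Some Shift" by (metis imageE)
    then have "i \<in> -{j}" using nj by auto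
    then have "Some Shift \<in> Some ` range (Slope :: 'a \<Rightarrow> _)" using i \<rho> by (metis imageI)
    then show False by auto
  qed
  have "v = 0" if "?A *v v = 0" for v
  proof -
    have row: "(\<Sum>c\<in>UNIV. ?A$i$c * v$c) = 0" for i
      using arg_cong[OF that, of "\<lambda>v. v$i"] by (simp add: matrix_vector_mult_def)
    have sl: "v$(Slope k) = 0" for k
    proof -
      have "Some (Slope k) \<in> \<rho> ` (-{j})" using \<rho> by auto
      then obtain i where i: "\<rho> i = Some (Slope k)" by (metis imageE)
      have "(\<Sum>c\<in>UNIV. ?A$i$c * v$c) = (\<Sum>c\<in>UNIV. if c = Slope k then v$c else 0)"
        by (intro sum.cong) (auto simp: i)
      then show ?thesis using row[of i] by simp
    qed
    have "(\<Sum>c\<in>UNIV. ?A$j$c * v$c) = (\<Sum>c\<in>UNIV. if c = Shift then v$c else 0)"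
      using sh by (intro sum.cong refl) (auto simp: nj sl split: affine_index.split)
    then have "v$Shift = 0" using row[of j] by simp
    then have "v$c = 0" for c using sl by (cases c) auto
    then show ?thesis by (simp add: vec_eq_iff)
  qed
  then have "\<exists>B. B ** ?A = mat 1" by (subst matrix_left_invertible_ker) blast
  then have "invertible ?A" by (simp only: invertible_left_inverse)
  then show ?thesis unfolding affine_minor_def by (rule iffD1[OF invertible_det_nz])
qed

section \<open>The determinant inequality\<close>

text \<open>Measurability is asked only of the coordinates that occur in the minor; after a deletion
  the others are no longer components of the product space.\<close>

lemma affine_minor_measurable:
  assumes "\<And>i k. \<rho> i = None \<Longrightarrow> Some (Slope k) \<notin> range \<rho> \<Longrightarrow> (\<lambda>y. Y y (e i, k)) \<in> borel_measurable M"
  shows "(\<lambda>y. affine_minor e (Y y) \<rho>) \<in> borel_measurable M"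
  unfolding affine_minor_def det_def vec_lambda_beta
proof (intro borel_measurable_sum borel_measurable_times borel_measurable_prod borel_measurable_const)
  fix p :: "'a affine_index \<Rightarrow> 'a affine_index" and i
  show "(\<lambda>y. case \<rho> i of None \<Rightarrow> if Some (p i) \<in> range \<rho> then 0
              else (case p i of Shift \<Rightarrow> 1 | Slope k \<Rightarrow> 2 * Y y (e i, k))
          | Some c' \<Rightarrow> if p i = c' then 1 else 0) \<in> borel_measurable M"
  proof (cases "\<rho> i = None \<and> Some (p i) \<notin> range \<rho>")
    case True
    then show ?thesis using assms[of i] by (cases "p i") auto
  next
    case False
    then show ?thesis by (cases "\<rho> i") auto
  qed
qed

text \<open>\<open>K\<close> is the set of slope columns still present, and the rows with
  \<open>\<rho> i = None\<close> are the points still present. They number m = |K| + 1, as column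
  \<open>Shift\<close> is never expanded. The exponents reproduce themselves: integrating out one
  column with \<gamma> = m \<delta> leaves every function with the exponent 1 - \<delta> and every
  minor with -\<delta>; Finner's inequality with weights 1/(m-1) raises the minors to the exponent
  -(m-1) \<delta>, which is the claim for m - 1 points with the same \<delta>.\<close>

lemma determinant_HLS:
  fixes e :: "'k::finite affine_index \<Rightarrow> 'r" and \<delta> :: real
  assumes e: "inj e" and \<delta>: "0 < \<delta>"
  assumes "finite K" "card {i. \<rho> i = None} = card K + 1" "\<And>k. Some (Slope k) \<in> range \<rho> \<longleftrightarrow> k \<notin> K"
    "Some Shift \<notin> range \<rho>" "card {i. \<rho> i = None} * \<delta> < 1"
  shows "\<exists>C::real. C > 0 \<and> (\<forall>x\<in>borel_measurable (PiM K (\<lambda>_. lborel)).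
     (\<integral>\<^sup>+y. (\<Prod>j | \<rho> j = None. epow (x (\<lambda>k\<in>K. y (e j, k))) (1 - \<delta>)) *
         epow (ennreal \<bar>affine_minor e y \<rho>\<bar>) (-(card {i. \<rho> i = None} * \<delta>)) \<partial>PiM (e ` {i. \<rho> i = None} \<times> K) (\<lambda>_. lborel))
     \<le> ennreal C * (\<Prod>j | \<rho> j = None. epow (\<integral>\<^sup>+z. x z \<partial>PiM K (\<lambda>_. lborel)) (1 - \<delta>)))"
  using assms(3-)
proof (induction K arbitrary: \<rho> rule: finite_induct)
  case empty
  from empty(1) obtain j where J: "{i. \<rho> i = None} = {j}" by (auto simp: card_Suc_eq)
  then have nj: "\<rho> j = None" by auto
  have "affine_minor e (\<lambda>_. undefined) \<rho> \<noteq> 0"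
  proof (rule affine_minor_ne_0[OF J])
    show "\<rho> ` (-{j}) = Some ` range Slope"
    proof (intro equalityI subsetI)
      fix s assume "s \<in> \<rho> ` (-{j})"
      then obtain i where i: "i \<noteq> j" "s = \<rho> i" by auto
      then obtain c where "\<rho> i = Some c" using J by (metis (mono_tags) mem_Collect_eq not_None_eq singletonD)
      then show "s \<in> Some ` range Slope"
        using i empty(3) by (cases c) (auto, metis rangeI)
    next
      fix s :: "'k affine_index option" assume "s \<in> Some ` range Slope"
      then obtain k where k: "s = Some (Slope k)" by auto
      then obtain i where "\<rho> i = s" using empty(2)[of k] by auto
      then show "s \<in> \<rho> ` (-{j})" using k nj by (intro image_eqI[of _ _ i]) auto
    qed
  qed
  \<comment> \<open>With no coordinates left the integral is the value at the single point of the
    empty product. There is one row, so the determinant has the exponent -\<delta> and its power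
    serves as the constant.\<close>
  then show ?case
    using \<delta> unfolding J
    by (intro exI[of _ "\<bar>affine_minor e (\<lambda>_. undefined) \<rho>\<bar> powr (-\<delta>)"])
       (auto simp: lborel_product.nn_integral_empty epow_ennreal restrict_def mult.commute)
next
  case (insert k K)
  define J where "J = {i. \<rho> i = None}"
  define m where "m = real (card J)"
  have J: "finite J" and cardJ: "card J = card K + 2" using insert.prems(1) insert.hyps by (auto simp: J_def)
  have m: "m \<ge> 2" "m * \<delta> < 1" using insert.prems(4) cardJ by (auto simp: m_def J_def)
  have Jne: "J \<noteq> {}" using cardJ by auto
  \<comment> \<open>Expansion along column \<open>k\<close> removes that column together with row
    \<open>i\<close>.\<close>
  define \<rho>' where "\<rho>' i = \<rho>(i \<mapsto> Slope k)" for i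
  have k\<rho>: "Some (Slope k) \<notin> range \<rho>" using insert.prems(2)[of k] by simp
  have J': "{j. \<rho>' i j = None} = J - {i}" for i by (auto simp: \<rho>'_def J_def)
  have r': "Some c \<in> range (\<rho>' i) \<longleftrightarrow> c = Slope k \<or> Some c \<in> range \<rho>" if "i \<in> J" for i c
    unfolding \<rho>'_def using that by (intro range_map_upd_None) (auto simp: J_def)
  have free: "j \<in> J" "j \<noteq> i" "k' \<in> K"
    if "i \<in> J" "\<rho>' i j = None" "Some (Slope k') \<notin> range (\<rho>' i)" for i j k'
    using J'[of i] that(2) r'[OF that(1)] that(3) insert.prems(2)[of k'] by auto
  have cardJ': "card (J - {i}) = card K + 1" "real (card (J - {i})) = m - 1" if "i \<in> J" for i
    using that J cardJ by (auto simp: m_def)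
  define P where "P i C \<longleftrightarrow> C > 0 \<and> (\<forall>x\<in>borel_measurable (PiM K (\<lambda>_. lborel)).
     (\<integral>\<^sup>+y. (\<Prod>j\<in>J-{i}. epow (x (\<lambda>k\<in>K. y (e j, k))) (1 - \<delta>)) *
         epow (ennreal \<bar>affine_minor e y (\<rho>' i)\<bar>) (-((m-1) * \<delta>)) \<partial>PiM (e ` (J-{i}) \<times> K) (\<lambda>_. lborel))
     \<le> ennreal C * (\<Prod>j\<in>J-{i}. epow (\<integral>\<^sup>+z. x z \<partial>PiM K (\<lambda>_. lborel)) (1 - \<delta>)))" for i and C :: real
  have "\<exists>C. P i C" if i: "i \<in> J" for i
  proof -
    have "(m - 1) * \<delta> < 1" using m \<delta> by (simp add: left_diff_distrib)
    show ?thesis unfolding P_def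
    proof (rule insert.IH[of "\<rho>' i", unfolded J' cardJ'(2)[OF i]])
      show "card (J - {i}) = card K + 1" by (rule cardJ'(1)[OF i])
      show "Some (Slope k') \<in> range (\<rho>' i) \<longleftrightarrow> k' \<notin> K" for k'
        using insert.prems(2)[of k'] insert.hyps by (auto simp: r'[OF i])
      show "Some Shift \<notin> range (\<rho>' i)" using insert.prems(3) by (auto simp: r'[OF i])
    qed fact
  qed
  then obtain Ci where P: "\<And>i. i \<in> J \<Longrightarrow> P i (Ci i)" by metis
  have Ci: "Ci i > 0"
     "x \<in> borel_measurable (PiM K (\<lambda>_. lborel)) \<Longrightarrow>
     (\<integral>\<^sup>+y. (\<Prod>j\<in>J-{i}. epow (x (\<lambda>k\<in>K. y (e j, k))) (1 - \<delta>)) *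
         epow (ennreal \<bar>affine_minor e y (\<rho>' i)\<bar>) (-((m-1) * \<delta>)) \<partial>PiM (e ` (J-{i}) \<times> K) (\<lambda>_. lborel))
     \<le> ennreal (Ci i) * (\<Prod>j\<in>J-{i}. epow (\<integral>\<^sup>+z. x z \<partial>PiM K (\<lambda>_. lborel)) (1 - \<delta>))"
    if "i \<in> J" for i x
    using P[OF that] unfolding P_def by blast+
  define CH where "CH = HLS_const (m * \<delta>)"
  have CH: "CH > 0" using m \<delta> unfolding CH_def by (intro HLS_const_pos) auto
  \<comment> \<open>One Hardy-Littlewood-Sobolev constant, times the constants of the m minors
    raised to the weight that each has in Finner's inequality.\<close>
  define C where "C = CH * (\<Prod>i\<in>J. Ci i powr (1 / (m - 1)))"
  have "C > 0" unfolding C_def using CH Ci(1) by (intro mult_pos_pos prod_pos) (auto dest!: Ci(1))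
  moreover have "(\<integral>\<^sup>+y. (\<Prod>j\<in>J. epow (x (\<lambda>k'\<in>insert k K. y (e j, k'))) (1 - \<delta>)) *
         epow (ennreal \<bar>affine_minor e y \<rho>\<bar>) (-(m * \<delta>)) \<partial>PiM (e ` J \<times> insert k K) (\<lambda>_. lborel))
     \<le> ennreal C * (\<Prod>j\<in>J. epow (\<integral>\<^sup>+z. x z \<partial>PiM (insert k K) (\<lambda>_. lborel)) (1 - \<delta>))"
    if x [measurable]: "x \<in> borel_measurable (PiM (insert k K) (\<lambda>_. lborel))" for x
  proof -
    \<comment> \<open>\<open>B\<close> is the column \<open>k\<close> of the remaining points. It is
      integrated first, for fixed values \<open>w\<close> of the other columns, which form
      \<open>A\<close>.\<close>
    define A where "A = e ` J \<times> K"
    define B where "B = e ` J \<times> {k}"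
    have AB: "A \<inter> B = {}" "finite A" "finite B" "A \<union> B = e ` J \<times> insert k K"
      using insert.hyps J by (auto simp: A_def B_def)
    have h: "inj_on (\<lambda>j. (e j, k)) J" "(\<lambda>j. (e j, k)) ` J = B"
      using e by (auto simp: inj_on_def B_def dest: injD)
    have cardB: "card B = card J" using h by (metis card_image)
    have reB: "(\<Prod>q\<in>B. F q) = (\<Prod>j\<in>J. F (e j, k))" for F :: "'r \<times> 'k \<Rightarrow> ennreal"
      unfolding h(2)[symmetric] using h(1) by (simp add: prod.reindex)
    have reBs: "(\<Sum>q\<in>B. F q) = (\<Sum>j\<in>J. F (e j, k))" for F :: "'r \<times> 'k \<Rightarrow> real"
      unfolding h(2)[symmetric] using h(1) by (simp add: sum.reindex)
    define ie where "ie = inv e"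
    have ie: "ie (e j) = j" for j using e by (simp add: ie_def)
    define X where "X z = (\<integral>\<^sup>+s. x (z(k := s)) \<partial>lborel)" for z
    have comp: "(\<lambda>y. y q :: real) \<in> borel_measurable (PiM I (\<lambda>_. lborel))" if "q \<in> I" for q and I :: "('r \<times> 'k) set"
      using measurable_component_singleton[OF that, where M = "\<lambda>_. lborel :: real measure"] by simp
    have pairm: "(\<lambda>(z, s). x (z(k := s))) \<in> borel_measurable (PiM K (\<lambda>_. lborel) \<Otimes>\<^sub>M lborel)"
    proof -
      have "(\<lambda>(z, s). z(k := s)) \<in> measurable (PiM K (\<lambda>_. lborel) \<Otimes>\<^sub>M lborel) (PiM (insert k K) (\<lambda>_. lborel))"
        by (rule measurable_add_dim)
      from measurable_compose[OF this x] show ?thesis by (simp add: case_prod_beta)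
    qed
    have Xm: "X \<in> borel_measurable (PiM K (\<lambda>_. lborel))"
      using lborel.borel_measurable_nn_integral[OF pairm] by (simp add: X_def[abs_def])
    have X_int: "(\<integral>\<^sup>+z. X z \<partial>PiM K (\<lambda>_. lborel)) = (\<integral>\<^sup>+z. x z \<partial>PiM (insert k K) (\<lambda>_. lborel))"
      unfolding X_def using lborel_product.product_nn_integral_insert[OF insert.hyps x] by simp
    have rowm: "(\<lambda>y. \<lambda>k'\<in>L. y (e j, k')) \<in> measurable (PiM I (\<lambda>_. lborel)) (PiM L (\<lambda>_. lborel))"
      if "\<And>k'. k' \<in> L \<Longrightarrow> (e j, k') \<in> I" for L I j
      using that by (intro measurable_restrict) (auto intro: comp)
    let ?f = "\<lambda>y. (\<Prod>j\<in>J. epow (x (\<lambda>k'\<in>insert k K. y (e j, k'))) (1 - \<delta>)) *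
         epow (ennreal \<bar>affine_minor e y \<rho>\<bar>) (-(m * \<delta>))"
    have fm: "?f \<in> borel_measurable (PiM (A \<union> B) (\<lambda>_. lborel))"
    proof (intro borel_measurable_times_ennreal borel_measurable_prod_ennreal borel_measurable_epow
        measurable_compose[OF _ measurable_ennreal] borel_measurable_abs affine_minor_measurable comp)
      show "(\<lambda>y. x (\<lambda>k'\<in>insert k K. y (e j, k'))) \<in> borel_measurable (PiM (A \<union> B) (\<lambda>_. lborel))" if "j \<in> J" for j
        by (rule measurable_compose[OF rowm x]) (use that AB(4) in auto)
      show "(e i, k') \<in> A \<union> B" if "\<rho> i = None" "Some (Slope k') \<notin> range \<rho>" for i k'
        using that insert.prems(2)[of k'] by (auto simp: AB(4) J_def)
    qed
    have "(\<integral>\<^sup>+y. ?f y \<partial>PiM (e ` J \<times> insert k K) (\<lambda>_. lborel))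
        = (\<integral>\<^sup>+w. \<integral>\<^sup>+u. ?f (merge A B (w, u)) \<partial>PiM B (\<lambda>_. lborel) \<partial>PiM A (\<lambda>_. lborel))"
      using lborel_product.product_nn_integral_fold[OF AB(1-3) fm] by (simp only: AB(4))
    also have "\<dots> \<le> (\<integral>\<^sup>+w. ennreal CH * (\<Prod>j\<in>J. epow (ennreal \<bar>affine_minor e w (\<rho>' j)\<bar>) (-\<delta>) *
          epow (X (\<lambda>k'\<in>K. w (e j, k'))) (1 - \<delta>)) \<partial>PiM A (\<lambda>_. lborel))"
    proof (rule nn_integral_mono)
      fix w assume w: "w \<in> space (PiM A (\<lambda>_. lborel :: real measure))"
      define z where "z q = (\<lambda>k'\<in>K. w (fst q, k'))" for q :: "'r \<times> 'k"
      define c where "c q = 2 * affine_minor e w (\<rho>' (ie (fst q)))" for q :: "'r \<times> 'k"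
      have zsp: "z q \<in> space (PiM K (\<lambda>_. lborel))" for q by (auto simp: z_def space_PiM)
      have xm: "(\<lambda>s. x ((z q)(k := s))) \<in> borel_measurable borel" for q
        using measurable_Pair2[OF pairm zsp[of q]] by simp
      have "(\<integral>\<^sup>+u. ?f (merge A B (w, u)) \<partial>PiM B (\<lambda>_. lborel))
         = (\<integral>\<^sup>+u. (\<Prod>q\<in>B. epow (x ((z q)(k := u q))) (1 - m * \<delta> / card B)) *
              epow (ennreal \<bar>\<Sum>q\<in>B. c q * u q\<bar>) (-(m * \<delta>)) \<partial>PiM B (\<lambda>_. lborel))"
      proof (rule nn_integral_cong)
        fix u :: "'r \<times> 'k \<Rightarrow> real"
        have mA: "merge A B (w, u) (e j, k') = w (e j, k')" if "j \<in> J" "k' \<in> K" for j k'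
          using that by (simp add: merge_def A_def)
        have mB: "merge A B (w, u) (e j, k) = u (e j, k)" if "j \<in> J" for j
          using that insert.hyps by (simp add: merge_def A_def B_def)
        have "(\<lambda>k'\<in>insert k K. merge A B (w, u) (e j, k')) = (z (e j, k))(k := u (e j, k))" if "j \<in> J" for j
          using that insert.hyps by (auto simp: fun_eq_iff z_def mA mB restrict_def)
        moreover have "affine_minor e (merge A B (w, u)) \<rho> = (\<Sum>q\<in>B. c q * u q)"
        proof -
          have "affine_minor e (merge A B (w, u)) (\<rho>' i) = affine_minor e w (\<rho>' i)" if "i \<in> J" for i
            using that by (intro affine_minor_cong mA) (auto dest: free)
          then show ?thesis
            unfolding affine_minor_expand[OF k\<rho>] reBs
            by (simp add: J_def[symmetric] \<rho>'_def[symmetric] c_def ie mB cong: sum.cong)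
        qed
        moreover have "m * \<delta> / card B = \<delta>" using Jne J by (simp add: cardB m_def)
        ultimately show "?f (merge A B (w, u)) = (\<Prod>q\<in>B. epow (x ((z q)(k := u q))) (1 - m * \<delta> / card B)) *
              epow (ennreal \<bar>\<Sum>q\<in>B. c q * u q\<bar>) (-(m * \<delta>))"
          unfolding reB by (simp cong: prod.cong)
      qed
      also have "\<dots> \<le> ennreal (HLS_const (m * \<delta>)) * (\<Prod>q\<in>B. epow (ennreal \<bar>c q\<bar>) (-(m * \<delta> / card B)) *
           epow (\<integral>\<^sup>+s. x ((z q)(k := s)) \<partial>lborel) (1 - m * \<delta> / card B))"
        using m \<delta> AB(3) xm cardB cardJ by (intro HLS_multilinear) auto
      also have "\<dots> = ennreal CH * (\<Prod>j\<in>J. epow (ennreal \<bar>c (e j, k)\<bar>) (-\<delta>) * epow (X (\<lambda>k'\<in>K. w (e j, k'))) (1 - \<delta>))"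
      proof -
        have "m * \<delta> / card B = \<delta>" using Jne J by (simp add: cardB m_def)
        then show ?thesis unfolding reB CH_def by (simp add: X_def z_def)
      qed
      \<comment> \<open>The factor 2 in \<open>c\<close> carries a negative exponent and can only
        help.\<close>
      also have "\<dots> \<le> ennreal CH * (\<Prod>j\<in>J. epow (ennreal \<bar>affine_minor e w (\<rho>' j)\<bar>) (-\<delta>) * epow (X (\<lambda>k'\<in>K. w (e j, k'))) (1 - \<delta>))"
        using \<delta> by (intro mult_left_mono ennreal_prod_mono mult_right_mono epow_antimono ennreal_leI) (auto simp: c_def ie)
      finally show "(\<integral>\<^sup>+u. ?f (merge A B (w, u)) \<partial>PiM B (\<lambda>_. lborel)) \<le> \<dots>" .
    qed
    also have "\<dots> = ennreal CH * (\<integral>\<^sup>+w. (\<Prod>j\<in>J. epow (ennreal \<bar>affine_minor e w (\<rho>' j)\<bar>) (-\<delta>) *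
          epow (X (\<lambda>k'\<in>K. w (e j, k'))) (1 - \<delta>)) \<partial>PiM A (\<lambda>_. lborel))"
    proof (intro nn_integral_cmult borel_measurable_times_ennreal borel_measurable_prod_ennreal borel_measurable_epow
        measurable_compose[OF _ measurable_ennreal] borel_measurable_abs affine_minor_measurable comp)
      show "(\<lambda>y. X (\<lambda>k'\<in>K. y (e j, k'))) \<in> borel_measurable (PiM A (\<lambda>_. lborel))" if "j \<in> J" for j
        by (rule measurable_compose[OF rowm Xm]) (use that in \<open>auto simp: A_def\<close>)
      show "(e i, k') \<in> A" if "j \<in> J" "\<rho>' j i = None" "Some (Slope k') \<notin> range (\<rho>' j)" for i j k'
        using free[OF that] by (auto simp: A_def)
    qed
    also have "(\<integral>\<^sup>+w. (\<Prod>j\<in>J. epow (ennreal \<bar>affine_minor e w (\<rho>' j)\<bar>) (-\<delta>) *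
          epow (X (\<lambda>k'\<in>K. w (e j, k'))) (1 - \<delta>)) \<partial>PiM A (\<lambda>_. lborel))
        \<le> ennreal (\<Prod>i\<in>J. Ci i powr (1 / (m - 1))) * (\<Prod>j\<in>J. epow (\<integral>\<^sup>+z. X z \<partial>PiM K (\<lambda>_. lborel)) (1 - \<delta>))"
    proof -
      \<comment> \<open>Each remaining point survives in m - 1 of the m minors, so these equal
        weights meet the condition of Finner's inequality. \<open>\<Psi> i\<close> compensates the
        weight by raising its minor to the power m - 1, while the repeated factors of
        \<open>X\<close> multiply up to the given ones.\<close>
      define v where "v = 1 / (m - 1)"
      have v: "v > 0" using m by (simp add: v_def)
      define S where "S i = e ` (J - {i}) \<times> K" for i
      define \<Psi> where "\<Psi> i z = (\<Prod>j\<in>J-{i}. epow (X (\<lambda>k\<in>K. z (e j, k))) (1 - \<delta>)) *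
         epow (ennreal \<bar>affine_minor e z (\<rho>' i)\<bar>) (-((m-1) * \<delta>))" for i z
      have v1: "real (card J - 1) * v = 1" using cardJ m by (simp add: v_def m_def)
      have swap: "(\<Prod>i\<in>J. \<Prod>j\<in>J-{i}. epow (b j) v) = (\<Prod>j\<in>J. b j)" for b
        by (simp only: prod_prod_Diff_epow[OF J less_imp_le[OF v]] v1 epow_one_right)
      have "(\<integral>\<^sup>+w. (\<Prod>j\<in>J. epow (ennreal \<bar>affine_minor e w (\<rho>' j)\<bar>) (-\<delta>) *
          epow (X (\<lambda>k'\<in>K. w (e j, k'))) (1 - \<delta>)) \<partial>PiM A (\<lambda>_. lborel))
        = (\<integral>\<^sup>+w. (\<Prod>i\<in>J. epow (\<Psi> i (restrict w (S i))) v) \<partial>PiM A (\<lambda>_. lborel))"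
      proof (rule nn_integral_cong)
        fix w :: "'r \<times> 'k \<Rightarrow> real"
        have "\<Psi> i (restrict w (S i)) = \<Psi> i w" if i: "i \<in> J" for i
        proof -
          have "affine_minor e (restrict w (S i)) (\<rho>' i) = affine_minor e w (\<rho>' i)"
            using i by (intro affine_minor_cong) (auto simp: S_def dest: free)
          moreover have "(\<lambda>k'\<in>K. restrict w (S i) (e j, k')) = (\<lambda>k'\<in>K. w (e j, k'))" if "j \<in> J - {i}" for j
            using that by (auto simp: S_def restrict_def fun_eq_iff)
          ultimately show ?thesis unfolding \<Psi>_def by (intro arg_cong2[where f = "(*)"] prod.cong) simp_all
        qed
        then have "(\<Prod>i\<in>J. epow (\<Psi> i (restrict w (S i))) v) = (\<Prod>i\<in>J. epow (\<Psi> i w) v)"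
          by (simp cong: prod.cong)
        also have "\<dots> = (\<Prod>i\<in>J. (\<Prod>j\<in>J-{i}. epow (epow (X (\<lambda>k\<in>K. w (e j, k))) (1 - \<delta>)) v)) *
           (\<Prod>i\<in>J. epow (ennreal \<bar>affine_minor e w (\<rho>' i)\<bar>) (-\<delta>))"
          using v m by (simp add: \<Psi>_def epow_mult epow_prod epow_epow prod.distrib) (simp add: v_def)
        also have "\<dots> = (\<Prod>j\<in>J. epow (ennreal \<bar>affine_minor e w (\<rho>' j)\<bar>) (-\<delta>) *
          epow (X (\<lambda>k'\<in>K. w (e j, k'))) (1 - \<delta>))"
          by (simp only: swap prod.distrib mult.commute)
        finally show "(\<Prod>j\<in>J. epow (ennreal \<bar>affine_minor e w (\<rho>' j)\<bar>) (-\<delta>) *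
          epow (X (\<lambda>k'\<in>K. w (e j, k'))) (1 - \<delta>)) = (\<Prod>i\<in>J. epow (\<Psi> i (restrict w (S i))) v)" by simp
      qed
      also have "\<dots> \<le> (\<Prod>i\<in>J. epow (\<integral>\<^sup>+z. \<Psi> i z \<partial>PiM (S i) (\<lambda>_. lborel)) v)"
      proof (rule lborel_product.nn_integral_PiM_Finner)
        show "\<Psi> i \<in> borel_measurable (PiM (S i) (\<lambda>_. lborel))" if i: "i \<in> J" for i
          unfolding \<Psi>_def[abs_def]
        proof (intro borel_measurable_times_ennreal borel_measurable_prod_ennreal borel_measurable_epow
            measurable_compose[OF _ measurable_ennreal] borel_measurable_abs affine_minor_measurable comp)
          show "(\<lambda>y. X (\<lambda>k'\<in>K. y (e j, k'))) \<in> borel_measurable (PiM (S i) (\<lambda>_. lborel))" if "j \<in> J - {i}" for j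
            by (rule measurable_compose[OF rowm Xm]) (use that in \<open>auto simp: S_def\<close>)
          show "(e j, k') \<in> S i" if "\<rho>' i j = None" "Some (Slope k') \<notin> range (\<rho>' i)" for j k'
            using free[OF i that] by (auto simp: S_def)
        qed
        show "(\<Sum>i | i \<in> J \<and> q \<in> S i. v) = 1" if qA: "q \<in> A" for q
        proof -
          obtain l k' where q: "q = (e l, k')" "l \<in> J" "k' \<in> K" using qA by (auto simp: A_def)
          have "{i. i \<in> J \<and> q \<in> S i} = J - {l}"
            using q e by (auto simp: S_def dest: injD)
          then show ?thesis using cardJ'(2)[OF q(2)] m by (simp add: v_def)
        qed
      qed (use AB J v in \<open>auto simp: S_def A_def\<close>)
      also have "\<dots> \<le> (\<Prod>i\<in>J. epow (ennreal (Ci i) * (\<Prod>j\<in>J-{i}. epow (\<integral>\<^sup>+z. X z \<partial>PiM K (\<lambda>_. lborel)) (1 - \<delta>))) v)"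
        using v Ci(2)[OF _ Xm] unfolding \<Psi>_def S_def by (intro ennreal_prod_mono epow_mono) auto
      also have "\<dots> = (\<Prod>i\<in>J. epow (ennreal (Ci i)) v) * (\<Prod>i\<in>J. \<Prod>j\<in>J-{i}. epow (epow (\<integral>\<^sup>+z. X z \<partial>PiM K (\<lambda>_. lborel)) (1 - \<delta>)) v)"
        using v by (simp only: epow_mult epow_prod prod.distrib less_imp_le)
      also have "\<dots> = (\<Prod>i\<in>J. ennreal (Ci i powr v)) * (\<Prod>j\<in>J. epow (\<integral>\<^sup>+z. X z \<partial>PiM K (\<lambda>_. lborel)) (1 - \<delta>))"
        unfolding swap using Ci(1) by (simp add: epow_ennreal cong: prod.cong)
      also have "(\<Prod>i\<in>J. ennreal (Ci i powr v)) = ennreal (\<Prod>i\<in>J. Ci i powr v)"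
        by (intro prod_ennreal) simp
      finally show ?thesis by (simp only: v_def)
    qed
    also have "ennreal CH * (ennreal (\<Prod>i\<in>J. Ci i powr (1 / (m - 1))) * (\<Prod>j\<in>J. epow (\<integral>\<^sup>+z. X z \<partial>PiM K (\<lambda>_. lborel)) (1 - \<delta>)))
       = ennreal C * (\<Prod>j\<in>J. epow (\<integral>\<^sup>+z. x z \<partial>PiM (insert k K) (\<lambda>_. lborel)) (1 - \<delta>))"
      unfolding C_def X_int using CH by (simp add: ennreal_mult prod_nonneg mult.assoc)
    finally show ?thesis by (simp add: mult_left_mono)
  qed
  ultimately show ?case
    unfolding J_def[symmetric] m_def[symmetric] by (intro exI[of _ C] conjI ballI)
qed

section \<open>Linear changes of variables\<close>

lemma prod_Basis_vec:
  fixes x :: "real^'n"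
  shows "(\<Prod>b\<in>Basis. x \<bullet> b) = (\<Prod>i\<in>UNIV. x $ i)"
proof -
  have B: "(Basis :: (real^'n) set) = (\<lambda>i. axis i 1) ` UNIV"
    by (auto simp: Basis_vec_def)
  have inj: "inj (\<lambda>i::'n. axis i (1::real))"
    by (auto simp: inj_def axis_eq_axis)
  show ?thesis unfolding B prod.reindex[OF inj] by (simp add: inner_axis)
qed

lemma prod_affine_index:
  fixes f :: "'k::finite affine_index \<Rightarrow> 'a::comm_monoid_mult"
  shows "(\<Prod>i\<in>UNIV. f i) = f Shift * (\<Prod>k\<in>UNIV. f (Slope k))"
proof -
  have U: "(UNIV :: 'k affine_index set) = insert Shift (range Slope)"
    by (auto intro: affine_index.exhaust)
  have "(\<Prod>i\<in>insert Shift (range Slope). f i) = f Shift * (\<Prod>k\<in>UNIV. f (Slope k))"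
    by (subst prod.insert) (auto simp: prod.reindex inj_def)
  then show ?thesis by (simp only: U)
qed

lemma sum_affine_index:
  fixes f :: "'k::finite affine_index \<Rightarrow> 'a::comm_monoid_add"
  shows "(\<Sum>i\<in>UNIV. f i) = f Shift + (\<Sum>k\<in>UNIV. f (Slope k))"
proof -
  have U: "(UNIV :: 'k affine_index set) = insert Shift (range Slope)"
    by (auto intro: affine_index.exhaust)
  have "(\<Sum>i\<in>insert Shift (range Slope). f i) = f Shift + (\<Sum>k\<in>UNIV. f (Slope k))"
    by (subst sum.insert) (auto simp: sum.reindex inj_def)
  then show ?thesis by (simp only: U)
qed

lemma borel_measurable_vec_lambda:
  fixes f :: "'a \<Rightarrow> 'n::finite \<Rightarrow> real"
  assumes "\<And>i. (\<lambda>x. f x i) \<in> borel_measurable M"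
  shows "(\<lambda>x. \<chi> i. f x i) \<in> borel_measurable M"
proof (rule borel_measurable_euclidean_space[THEN iffD2, rule_format])
  fix b :: "real^'n" assume "b \<in> Basis"
  then obtain i where "b = axis i 1" by (auto simp: Basis_vec_def)
  then show "(\<lambda>x. (\<chi> i. f x i) \<bullet> b) \<in> borel_measurable M"
    using assms[of i] by (simp add: inner_axis)
qed

lemma measurable_vec_lambda_PiM:
  "(\<lambda>y. \<chi> i::'n::finite. y i) \<in> measurable (PiM UNIV (\<lambda>_. lborel :: real measure)) borel"
proof -
  have "(\<lambda>y. y i) \<in> borel_measurable (PiM UNIV (\<lambda>_. lborel :: real measure))" for i :: 'n
    using measurable_component_singleton[of i UNIV "\<lambda>_. lborel :: real measure"] by simp
  from borel_measurable_vec_lambda[where f = "\<lambda>y i. y i", OF this] show ?thesis by simp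
qed

lemma all_affine_index: "(\<forall>i. P i) \<longleftrightarrow> P Shift \<and> (\<forall>k. P (Slope k))"
  by (metis affine_index.exhaust)

lemma lborel_vec_eq_PiM:
  "(lborel :: (real^'n) measure) = distr (PiM UNIV (\<lambda>_. lborel)) borel (\<lambda>y. \<chi> i. y i)"
proof (rule lborel_eqI)
  let ?M = "PiM UNIV (\<lambda>_. lborel) :: ('n \<Rightarrow> real) measure"
  note m = measurable_vec_lambda_PiM[where ?'n = 'n]
  fix l u :: "real^'n" assume lu: "\<And>b. b \<in> Basis \<Longrightarrow> l \<bullet> b \<le> u \<bullet> b"
  have lu': "l$i \<le> u$i" for i using lu[of "axis i 1"] by (auto simp: Basis_vec_def inner_axis)
  have pre: "(\<lambda>y. \<chi> i. y i) -` box l u \<inter> space ?M = PiE UNIV (\<lambda>i. {l$i <..< u$i})"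
    by (auto simp: mem_box_cart space_PiM PiE_def Pi_iff)
  have "emeasure (distr ?M borel (\<lambda>y. \<chi> i. y i)) (box l u) = emeasure ?M (PiE UNIV (\<lambda>i. {l$i <..< u$i}))"
    using m by (simp add: emeasure_distr pre)
  also have "\<dots> = (\<Prod>i\<in>UNIV. emeasure lborel {l$i <..< u$i})"
    by (intro lborel_product.emeasure_PiM) auto
  also have "\<dots> = ennreal (\<Prod>i\<in>UNIV. (u - l)$i)"
    using lu' by (simp add: prod_ennreal)
  finally show "emeasure (distr ?M borel (\<lambda>y. \<chi> i. y i)) (box l u) = ennreal (\<Prod>b\<in>Basis. (u - l) \<bullet> b)"
    by (simp only: prod_Basis_vec)
qed simp

lemma nn_integral_lborel_vec:
  fixes f :: "real^'n \<Rightarrow> ennreal"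
  assumes "f \<in> borel_measurable borel"
  shows "(\<integral>\<^sup>+x. f x \<partial>lborel) = (\<integral>\<^sup>+y. f (\<chi> i. y i) \<partial>PiM UNIV (\<lambda>_. lborel))"
proof -
  note m = measurable_vec_lambda_PiM[where ?'n = 'n]
  show ?thesis
    by (subst lborel_vec_eq_PiM, subst nn_integral_distr[OF m]) (use assms in auto)
qed

lemma borel_measurable_affine_index:
  "(\<lambda>(a :: real^'k::finite, b :: real). (\<chi> i. case i of Shift \<Rightarrow> b | Slope k \<Rightarrow> a $ k)) \<in> borel_measurable borel"
  unfolding case_prod_beta
proof (rule borel_measurable_vec_lambda)
  fix i :: "'k affine_index"
  have "(\<lambda>x. x $ k :: real) \<in> borel_measurable borel" for k :: 'k
    by (intro borel_measurable_continuous_onI continuous_intros)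
  then show "(\<lambda>x. case i of Shift \<Rightarrow> snd x | Slope k \<Rightarrow> fst x $ k) \<in> borel_measurable (borel :: 'k pt measure)"
    unfolding borel_prod[symmetric] by (cases i) (auto intro: measurable_compose[OF measurable_fst])
qed

text \<open>Slope and shift are merged into a single vector, so that the values of an affine
  function at n+1 points are the image of its coefficients under a square matrix.\<close>

lemma lborel_affine_index:
  "(lborel :: (real^'k::finite affine_index) measure)
     = distr lborel borel (\<lambda>(a, b). \<chi> i. case i of Shift \<Rightarrow> b | Slope k \<Rightarrow> a $ k)"
proof (rule lborel_eqI)
  let ?\<phi> = "\<lambda>(a :: real^'k, b :: real). (\<chi> i. case i of Shift \<Rightarrow> b | Slope k \<Rightarrow> a $ k)"
  note m = borel_measurable_affine_index[where ?'k = 'k]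
  fix l u :: "real^'k affine_index" assume lu: "\<And>b. b \<in> Basis \<Longrightarrow> l \<bullet> b \<le> u \<bullet> b"
  have lu': "l$i \<le> u$i" for i using lu[of "axis i 1"] by (auto simp: Basis_vec_def inner_axis)
  have pre: "?\<phi> -` box l u = box (\<chi> k. l$Slope k) (\<chi> k. u$Slope k) \<times> box (l$Shift) (u$Shift)"
    by (auto simp: mem_box_cart all_affine_index)
  have "emeasure (distr lborel borel ?\<phi>) (box l u) = emeasure lborel (box (\<chi> k. l$Slope k) (\<chi> k. u$Slope k) \<times> box (l$Shift) (u$Shift))"
    using m by (simp add: emeasure_distr pre)
  also have "\<dots> = emeasure lborel (box (\<chi> k. l$Slope k) (\<chi> k. u$Slope k)) * emeasure lborel (box (l$Shift) (u$Shift))"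
    unfolding lborel_prod[symmetric] by (intro lborel.emeasure_pair_measure_Times) auto
  also have "emeasure lborel (box (\<chi> k. l$Slope k) (\<chi> k. u$Slope k)) = ennreal (\<Prod>k\<in>UNIV. (u - l)$Slope k)"
  proof (subst emeasure_lborel_box)
    show "(\<chi> k. l$Slope k) \<bullet> b \<le> (\<chi> k. u$Slope k) \<bullet> b" if "b \<in> Basis" for b :: "real^'k"
      using that lu' by (auto simp: Basis_vec_def inner_axis)
  qed (simp add: prod_Basis_vec)
  also have "emeasure lborel (box (l$Shift) (u$Shift)) = ennreal ((u - l)$Shift)"
    using lu' by simp
  also have "ennreal (\<Prod>k\<in>UNIV. (u - l)$Slope k) * ennreal ((u - l)$Shift) = ennreal (\<Prod>i\<in>UNIV. (u - l)$i)"
    using lu' by (simp add: prod_affine_index ennreal_mult' mult.commute prod_nonneg)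
  finally show "emeasure (distr lborel borel ?\<phi>) (box l u) = ennreal (\<Prod>b\<in>Basis. (u - l) \<bullet> b)"
    by (simp only: prod_Basis_vec)
qed simp

lemma nn_integral_lborel_affine_index:
  fixes f :: "real^'k::finite affine_index \<Rightarrow> ennreal"
  assumes "f \<in> borel_measurable borel"
  shows "(\<integral>\<^sup>+x. f x \<partial>lborel) = (\<integral>\<^sup>+p. f (\<chi> i. case i of Shift \<Rightarrow> snd p | Slope k \<Rightarrow> fst p $ k) \<partial>lborel)"
proof -
  have m': "(\<lambda>(a :: real^'k, b :: real). (\<chi> i. case i of Shift \<Rightarrow> b | Slope k \<Rightarrow> a $ k)) \<in> measurable lborel borel"
    using borel_measurable_affine_index by simp
  show ?thesis
    by (subst lborel_affine_index, subst nn_integral_distr[OF m']) (use assms in \<open>auto simp: case_prod_beta\<close>)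
qed

text \<open>Lebesgue measure is determined by its values on boxes. The preimage of a box under
  \<open>A\<close> is its image under the inverse matrix \<open>B\<close>, whose measure is |det B|
  times that of the box.\<close>

lemma nn_integral_lborel_linear:
  fixes A :: "real^'m::_^'m::{finite,wellorder}" and f :: "real^'m::_ \<Rightarrow> ennreal"
  assumes A: "det A \<noteq> 0" and f [measurable]: "f \<in> borel_measurable borel"
  shows "(\<integral>\<^sup>+v. f (A *v v) \<partial>lborel) = ennreal (1 / \<bar>det A\<bar>) * (\<integral>\<^sup>+v. f v \<partial>lborel)"
proof -
  obtain B where B: "A ** B = mat 1" "B ** A = mat 1"
    using A by (metis invertible_def invertible_det_nz)
  have "det A * det B = 1" using B(1) by (metis det_I det_mul)
  then have detB: "\<bar>det B\<bar> = 1 / \<bar>det A\<bar>" using A by (simp add: abs_mult[symmetric] field_simps)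
  have Am [measurable]: "(\<lambda>v. A *v v) \<in> borel_measurable borel"
    by (intro borel_measurable_continuous_onI linear_continuous_on matrix_vector_mul_bounded_linear)
  have "lborel = density (distr lborel borel (\<lambda>v. A *v v)) (\<lambda>_. ennreal \<bar>det A\<bar>)"
  proof (rule lborel_eqI)
    fix l u :: "real^'m::_" assume lu: "\<And>b. b \<in> Basis \<Longrightarrow> l \<bullet> b \<le> u \<bullet> b"
    have pre: "(\<lambda>v. A *v v) -` box l u = (\<lambda>v. B *v v) ` box l u"
    proof (intro equalityI subsetI)
      fix v assume "v \<in> (\<lambda>v. A *v v) -` box l u"
      then show "v \<in> (\<lambda>v. B *v v) ` box l u"
        using B(2) by (intro image_eqI[of _ _ "A *v v"]) (auto simp: matrix_vector_mul_assoc)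
    next
      fix v assume "v \<in> (\<lambda>v. B *v v) ` box l u"
      then show "v \<in> (\<lambda>v. A *v v) -` box l u"
        using B(1) by (auto simp: matrix_vector_mul_assoc)
    qed
    have lm: "(\<lambda>v. B *v v) ` box l u \<in> lmeasurable"
      by (intro measurable_linear_image matrix_vector_mul_linear lmeasurable_box)
    have bor: "(\<lambda>v. B *v v) ` box l u \<in> sets borel"
      unfolding pre[symmetric] using measurable_sets[OF Am, of "box l u"] by simp
    have "emeasure lborel ((\<lambda>v. B *v v) ` box l u) = ennreal (measure lebesgue ((\<lambda>v. B *v v) ` box l u))"
      using emeasure_eq_measure2[OF lm] bor by simp
    also have "measure lebesgue ((\<lambda>v. B *v v) ` box l u) = \<bar>det (matrix ((*v) B))\<bar> * measure lebesgue (box l u)"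
      by (intro measure_linear_image matrix_vector_mul_linear lmeasurable_box)
    also have "\<dots> = \<bar>det B\<bar> * (\<Prod>b\<in>Basis. (u - l) \<bullet> b)"
      using lu by (simp add: measure_lborel_box)
    finally have e: "emeasure lborel ((\<lambda>v. B *v v) ` box l u) = ennreal (\<bar>det B\<bar> * (\<Prod>b\<in>Basis. (u - l) \<bullet> b))" .
    have "emeasure (density (distr lborel borel (\<lambda>v. A *v v)) (\<lambda>_. ennreal \<bar>det A\<bar>)) (box l u)
       = ennreal \<bar>det A\<bar> * emeasure lborel ((\<lambda>v. B *v v) ` box l u)"
      by (simp add: emeasure_density nn_integral_cmult emeasure_distr pre)
    also have "\<dots> = ennreal (\<Prod>b\<in>Basis. (u - l) \<bullet> b)"
      unfolding e using A by (subst ennreal_mult'[symmetric]) (auto simp: detB)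
    finally show "emeasure (density (distr lborel borel (\<lambda>v. A *v v)) (\<lambda>_. ennreal \<bar>det A\<bar>)) (box l u)
       = ennreal (\<Prod>b\<in>Basis. (u - l) \<bullet> b)" .
  qed simp
  then have "(\<integral>\<^sup>+v. f v \<partial>lborel) = (\<integral>\<^sup>+v. f v \<partial>density (distr lborel borel (\<lambda>v. A *v v)) (\<lambda>_. ennreal \<bar>det A\<bar>))"
    by simp
  also have "\<dots> = ennreal \<bar>det A\<bar> * (\<integral>\<^sup>+v. f (A *v v) \<partial>lborel)"
    by (simp add: nn_integral_density nn_integral_distr nn_integral_cmult)
  finally have "ennreal (1 / \<bar>det A\<bar>) * (\<integral>\<^sup>+v. f v \<partial>lborel) = (ennreal (1 / \<bar>det A\<bar>) * ennreal \<bar>det A\<bar>) * (\<integral>\<^sup>+v. f (A *v v) \<partial>lborel)"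
    by (simp add: mult.assoc)
  also have "ennreal (1 / \<bar>det A\<bar>) * ennreal \<bar>det A\<bar> = 1"
    using A by (simp add: ennreal_mult'[symmetric])
  finally show ?thesis by simp
qed

lemma nn_integral_lborel_scale:
  fixes f :: "'a::euclidean_space \<Rightarrow> ennreal"
  assumes [measurable]: "f \<in> borel_measurable borel" and c: "c \<noteq> 0"
  shows "(\<integral>\<^sup>+x. f x \<partial>lborel) = ennreal (\<bar>c\<bar> ^ DIM('a)) * (\<integral>\<^sup>+x. f (t + c *\<^sub>R x) \<partial>lborel)"
  by (subst lborel_affine[OF c, of t])
     (simp add: nn_integral_density nn_integral_distr nn_integral_cmult ennreal_power)

section \<open>The Radon transform\<close>

lemma nn_integral_PiM_row:
  fixes K :: "'k set" and i :: 'i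
  assumes "finite K" and F: "F \<in> borel_measurable (PiM K (\<lambda>_. lborel :: real measure))"
  shows "(\<integral>\<^sup>+y. F (\<lambda>k\<in>K. y (i, k)) \<partial>PiM ({i} \<times> K) (\<lambda>_. lborel)) = (\<integral>\<^sup>+z. F z \<partial>PiM K (\<lambda>_. lborel))"
proof -
  let ?P = "PiM ({i} \<times> K) (\<lambda>_. lborel) :: ('i \<times> 'k \<Rightarrow> real) measure"
  have comp: "(\<lambda>y. y q :: real) \<in> measurable ?P lborel" if "q \<in> {i} \<times> K" for q
    by (rule measurable_component_singleton[OF that])
  have m: "(\<lambda>y. \<lambda>k\<in>K. y (i, k)) \<in> measurable ?P (PiM K (\<lambda>_. lborel))"
    by (intro measurable_restrict comp) auto
  have "distr ?P (PiM K (\<lambda>_. lborel)) (\<lambda>y. \<lambda>k\<in>K. y (i, k)) = PiM K (\<lambda>_. lborel)"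
  proof (rule lborel_product.PiM_eqI[OF assms(1)])
    fix A :: "'k \<Rightarrow> real set" assume A: "\<And>k. k \<in> K \<Longrightarrow> A k \<in> sets lborel"
    have pre: "(\<lambda>y. \<lambda>k\<in>K. y (i, k)) -` PiE K A \<inter> space ?P = PiE ({i} \<times> K) (\<lambda>q. A (snd q))"
      by (auto simp: space_PiM PiE_iff extensional_def)
    have "emeasure (distr ?P (PiM K (\<lambda>_. lborel)) (\<lambda>y. \<lambda>k\<in>K. y (i, k))) (PiE K A)
        = emeasure ?P (PiE ({i} \<times> K) (\<lambda>q. A (snd q)))"
      using m A assms(1) by (subst emeasure_distr) (auto simp: pre intro!: sets_PiM_I_finite)
    also have "\<dots> = (\<Prod>q\<in>{i} \<times> K. emeasure lborel (A (snd q)))"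
      using A assms(1) by (intro lborel_product.emeasure_PiM) auto
    also have "\<dots> = (\<Prod>k\<in>K. emeasure lborel (A k))"
      by (rule prod.reindex_bij_witness[of _ "\<lambda>k. (i, k)" snd]) auto
    finally show "emeasure (distr ?P (PiM K (\<lambda>_. lborel)) (\<lambda>y. \<lambda>k\<in>K. y (i, k))) (PiE K A)
        = (\<Prod>k\<in>K. emeasure lborel (A k))" .
  qed simp
  then show ?thesis using nn_integral_distr[OF m, of F] F by simp
qed

text \<open>Tonelli for a matrix of variables with one row per factor. With equal factors it writes
  an integer power of an integral as an integral over several points.\<close>

lemma prod_nn_integral_PiM_rows:
  fixes K :: "'k set" and I :: "'i set"
  assumes "finite K" "finite I" and F: "\<And>i. i \<in> I \<Longrightarrow> F i \<in> borel_measurable (PiM K (\<lambda>_. lborel :: real measure))"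
  shows "(\<Prod>i\<in>I. \<integral>\<^sup>+z. F i z \<partial>PiM K (\<lambda>_. lborel)) = (\<integral>\<^sup>+y. (\<Prod>i\<in>I. F i (\<lambda>k\<in>K. y (i, k))) \<partial>PiM (I \<times> K) (\<lambda>_. lborel))"
  using assms(2) F
proof (induction I)
  case empty
  then show ?case by (simp add: lborel_product.nn_integral_empty del: nn_integral_const)
next
  case (insert i I)
  have rowm: "(\<lambda>y. F j (\<lambda>k\<in>K. y (j, k))) \<in> borel_measurable (PiM (L \<times> K) (\<lambda>_. lborel))"
    if "j \<in> insert i I" "j \<in> L" for j and L :: "'i set"
  proof (rule measurable_compose[OF _ insert.prems[OF that(1)]])
    show "(\<lambda>y. \<lambda>k\<in>K. y (j, k)) \<in> measurable (PiM (L \<times> K) (\<lambda>_. lborel)) (PiM K (\<lambda>_. lborel :: real measure))"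
      using that by (intro measurable_restrict measurable_component_singleton) auto
  qed
  let ?f = "\<lambda>y. \<Prod>j\<in>insert i I. F j (\<lambda>k\<in>K. y (j, k))"
  have U: "insert i I \<times> K = I \<times> K \<union> {i} \<times> K" by auto
  have dis: "I \<times> K \<inter> {i} \<times> K = {}" using insert.hyps by auto
  have fm: "?f \<in> borel_measurable (PiM (I \<times> K \<union> {i} \<times> K) (\<lambda>_. lborel))"
    unfolding U[symmetric] by (intro borel_measurable_prod_ennreal rowm) auto
  have "(\<integral>\<^sup>+y. ?f y \<partial>PiM (insert i I \<times> K) (\<lambda>_. lborel))
      = (\<integral>\<^sup>+w. \<integral>\<^sup>+u. ?f (merge (I \<times> K) ({i} \<times> K) (w, u)) \<partial>PiM ({i} \<times> K) (\<lambda>_. lborel) \<partial>PiM (I \<times> K) (\<lambda>_. lborel))"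
    unfolding U by (rule lborel_product.product_nn_integral_fold[OF dis _ _ fm]) (use assms(1) insert.hyps in auto)
  also have "\<dots> = (\<integral>\<^sup>+w. \<integral>\<^sup>+u. (\<Prod>j\<in>I. F j (\<lambda>k\<in>K. w (j, k))) * F i (\<lambda>k\<in>K. u (i, k)) \<partial>PiM ({i} \<times> K) (\<lambda>_. lborel) \<partial>PiM (I \<times> K) (\<lambda>_. lborel))"
  proof (intro nn_integral_cong)
    fix w u :: "'i \<times> 'k \<Rightarrow> real"
    have 1: "(\<lambda>k\<in>K. merge (I \<times> K) ({i} \<times> K) (w, u) (j, k)) = (\<lambda>k\<in>K. w (j, k))" if "j \<in> I" for j
      using that by (auto simp: merge_def restrict_def fun_eq_iff)
    have 2: "(\<lambda>k\<in>K. merge (I \<times> K) ({i} \<times> K) (w, u) (i, k)) = (\<lambda>k\<in>K. u (i, k))"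
      using insert.hyps by (auto simp: merge_def restrict_def fun_eq_iff)
    have "(\<Prod>j\<in>I. F j (\<lambda>k\<in>K. merge (I \<times> K) ({i} \<times> K) (w, u) (j, k))) = (\<Prod>j\<in>I. F j (\<lambda>k\<in>K. w (j, k)))"
      by (intro prod.cong refl) (simp only: 1)
    then show "?f (merge (I \<times> K) ({i} \<times> K) (w, u)) = (\<Prod>j\<in>I. F j (\<lambda>k\<in>K. w (j, k))) * F i (\<lambda>k\<in>K. u (i, k))"
      unfolding prod.insert[OF insert.hyps] 2 by (simp only: mult.commute)
  qed
  also have "\<dots> = (\<integral>\<^sup>+w. (\<Prod>j\<in>I. F j (\<lambda>k\<in>K. w (j, k))) \<partial>PiM (I \<times> K) (\<lambda>_. lborel)) * (\<integral>\<^sup>+u. F i (\<lambda>k\<in>K. u (i, k)) \<partial>PiM ({i} \<times> K) (\<lambda>_. lborel))"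
    by (subst nn_integral_cmult, intro rowm, simp, simp, subst nn_integral_multc, intro borel_measurable_prod_ennreal rowm, auto)
  also have "(\<integral>\<^sup>+u. F i (\<lambda>k\<in>K. u (i, k)) \<partial>PiM ({i} \<times> K) (\<lambda>_. lborel)) = (\<integral>\<^sup>+z. F i z \<partial>PiM K (\<lambda>_. lborel))"
    using assms(1) insert.prems by (intro nn_integral_PiM_row) auto
  finally show ?case
    using insert by (simp add: mult.commute)
qed

text \<open>
  If the minor vanishes, the right-hand side is \<open>\<infinity>\<close> unless some \<open>f j\<close> has integral \<open>0\<close>.
\<close>

lemma nn_integral_affine_prod_le:
  fixes e :: "'k::finite affine_index \<Rightarrow> 'r" and y :: "'r \<times> 'k \<Rightarrow> real"
  assumes f [measurable]: "\<And>j. f j \<in> borel_measurable borel"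
  shows "(\<integral>\<^sup>+p. (\<Prod>j\<in>UNIV. f j (snd p + 2 * (fst p \<bullet> (\<chi> k. y (e j, k))))) \<partial>lborel)
    \<le> epow (ennreal \<bar>affine_minor e y (\<lambda>_. None)\<bar>) (-1) * (\<Prod>j\<in>UNIV. \<integral>\<^sup>+s. f j s \<partial>lborel)"
proof -
  let ?s = "\<lambda>j p. snd p + 2 * (fst p \<bullet> (\<chi> k. y (e j, k)))"
  let ?A = "(\<chi> i c. case c of Shift \<Rightarrow> 1 | Slope k \<Rightarrow> 2 * y (e i, k)) :: real^'k affine_index^'k affine_index"
  have det: "affine_minor e y (\<lambda>_. None) = det ?A" by (simp add: affine_minor_def)
  have smeas [measurable]: "?s j \<in> borel_measurable borel" for j
    by (intro borel_measurable_continuous_onI continuous_intros)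
  consider j where "(\<integral>\<^sup>+s. f j s \<partial>lborel) = 0" | "det ?A = 0" "\<And>j. (\<integral>\<^sup>+s. f j s \<partial>lborel) \<noteq> 0" | "det ?A \<noteq> 0" by blast
  then show ?thesis
  proof cases
    case (1 j)
    \<comment> \<open>For fixed \<open>a\<close> the integral over \<open>b\<close> is that of a
      translate of \<open>f j\<close>, hence already 0.\<close>
    have "(\<integral>\<^sup>+p. f j (?s j p) \<partial>lborel) = (\<integral>\<^sup>+a. \<integral>\<^sup>+b. f j (?s j (a, b)) \<partial>lborel \<partial>lborel)"
      unfolding lborel_prod[symmetric]
      by (rule lborel.nn_integral_fst[symmetric]) (simp add: lborel_prod)
    also have "\<dots> = (\<integral>\<^sup>+(a::real^'k). 0 \<partial>lborel)"
    proof (rule nn_integral_cong)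
      fix a :: "real^'k"
      show "(\<integral>\<^sup>+b. f j (?s j (a, b)) \<partial>lborel) = 0"
        using nn_integral_shift[of "f j" "2 * (a \<bullet> (\<chi> k. y (e j, k)))"] 1 by simp
    qed
    finally have "(\<integral>\<^sup>+p. f j (?s j p) \<partial>lborel) = 0" by simp
    then have "AE p in lborel. f j (?s j p) = 0"
      by (simp add: nn_integral_0_iff_AE)
    then have "AE p in lborel. (\<Prod>j\<in>UNIV. f j (?s j p)) = 0"
      by eventually_elim (auto intro: prod_zero)
    then have "(\<integral>\<^sup>+p. (\<Prod>j\<in>UNIV. f j (?s j p)) \<partial>lborel) = (\<integral>\<^sup>+(p :: 'k pt). 0 \<partial>lborel)"
      by (rule nn_integral_cong_AE)
    then show ?thesis by simp
  next
    case 2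
    then have "(\<Prod>j\<in>UNIV. \<integral>\<^sup>+s. f j s \<partial>lborel) \<noteq> 0" by simp
    moreover have "epow (ennreal \<bar>det ?A\<bar>) (-1) = \<infinity>"
      unfolding 2(1) by (simp add: epow_zero_left_neg)
    ultimately have "epow (ennreal \<bar>det ?A\<bar>) (-1) * (\<Prod>j\<in>UNIV. \<integral>\<^sup>+s. f j s \<partial>lborel) = \<infinity>"
      by (metis ennreal_top_mult infinity_ennreal_def)
    then show ?thesis unfolding det by simp
  next
    case 3
    let ?\<phi> = "\<lambda>p :: 'k pt. (\<chi> i. case i of Shift \<Rightarrow> snd p | Slope k \<Rightarrow> fst p $ k) :: real^'k affine_index"
    have comp [measurable]: "(\<lambda>v. v $ j :: real) \<in> borel_measurable borel" for j :: "'k affine_index"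
      by (intro borel_measurable_continuous_onI continuous_intros)
    have lin [measurable]: "(\<lambda>v. ?A *v v) \<in> borel_measurable borel"
      by (intro borel_measurable_continuous_onI linear_continuous_on matrix_vector_mul_bounded_linear)
    have "(?A *v ?\<phi> p) $ j = ?s j p" for p j
      by (simp add: matrix_vector_mult_def sum_affine_index inner_vec_def sum_distrib_left mult_ac)
    then have "(\<integral>\<^sup>+p. (\<Prod>j\<in>UNIV. f j (?s j p)) \<partial>lborel) = (\<integral>\<^sup>+p. (\<Prod>j\<in>UNIV. f j ((?A *v ?\<phi> p) $ j)) \<partial>lborel)"
      by simp
    also have "\<dots> = (\<integral>\<^sup>+v. (\<Prod>j\<in>UNIV. f j ((?A *v v) $ j)) \<partial>lborel)"
      by (rule nn_integral_lborel_affine_index[symmetric]) measurable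
    also have "\<dots> = ennreal (1 / \<bar>det ?A\<bar>) * (\<integral>\<^sup>+v. (\<Prod>j\<in>UNIV. f j (v $ j)) \<partial>lborel)"
      using 3 by (intro nn_integral_lborel_linear) auto
    also have "(\<integral>\<^sup>+v. (\<Prod>j\<in>UNIV. f j (v $ j)) \<partial>lborel) = (\<integral>\<^sup>+v. (\<Prod>j\<in>UNIV. f j (v j)) \<partial>PiM UNIV (\<lambda>_. lborel))"
      by (subst nn_integral_lborel_vec) auto
    also have "\<dots> = (\<Prod>j\<in>UNIV. \<integral>\<^sup>+s. f j s \<partial>lborel)"
      by (intro lborel_product.product_nn_integral_prod) auto
    also have "ennreal (1 / \<bar>det ?A\<bar>) = epow (ennreal \<bar>det ?A\<bar>) (-1)"
      using 3 by (simp add: epow_ennreal powr_minus_divide)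
    finally show ?thesis unfolding det by simp
  qed
qed

text \<open>Each hyperplane carries the measure of its projection to the base. The factor 2 comes
  from the mixed term of |x' - y|^2.\<close>

definition radon :: "('n::finite pt \<Rightarrow> ennreal) \<Rightarrow> 'n pt \<Rightarrow> ennreal" where
  "radon g p = (\<integral>\<^sup>+z. g (z, snd p + 2 * (fst p \<bullet> z)) \<partial>lborel)"

text \<open>Here n + 2 = d + 1 = q_0, the exponent inside the right-hand integral is p_0, and the
  outer exponent n + 1 = d is q_0/p_0: this is the q_0-th power of the endpoint inequality. That q_0
  is an integer makes the left-hand side a multilinear integral.\<close>

theorem radon_bound:
  "\<exists>C::real. C > 0 \<and> (\<forall>g :: 'n::finite pt \<Rightarrow> ennreal. g \<in> borel_measurable borel \<longrightarrow>
     (\<integral>\<^sup>+p. epow (radon g p) (real CARD('n) + 2) \<partial>lborel)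
     \<le> ennreal C * epow (\<integral>\<^sup>+p. epow (g p) ((real CARD('n) + 2) / (real CARD('n) + 1)) \<partial>lborel) (real CARD('n) + 1))"
proof -
  define n where "n = real CARD('n)"
  have n: "n \<ge> 1" using zero_less_card_finite[where 'a='n] by (simp add: n_def)
  \<comment> \<open>Labels for the n+2 points: \<open>'n affine_index\<close> has n+1 elements and
    \<open>option\<close> adds one.\<close>
  define I where "I = (UNIV :: 'n affine_index option set)"
  have cardI: "card I = CARD('n) + 2" by (simp add: I_def card_affine_index)
  have finI: "finite I" by (simp add: I_def)
  define p where "p = (n + 2) / (n + 1)"
  \<comment> \<open>The Hoelder weight of each of the n+2 choices of an omitted point.\<close>
  define \<delta> where "\<delta> = 1 / (n + 2)"
  have "1 - \<delta> = (n + 1) / (n + 2)" using n by (simp add: \<delta>_def field_simps)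
  then have \<delta>: "0 < \<delta>" "(n + 1) * \<delta> = 1 - \<delta>" "1 - \<delta> > 0" "p * (1 - \<delta>) = 1" "p > 0"
    using n by (simp_all add: \<delta>_def p_def)
  have "\<exists>e. bij_betw e (UNIV :: 'n affine_index set) (I - {l})" for l
    using finI by (intro finite_same_card_bij) (auto simp: card_affine_index cardI I_def)
  then obtain e where e: "\<And>l. bij_betw (e l) (UNIV :: 'n affine_index set) (I - {l})" by metis
  define D where "D l y = ennreal \<bar>affine_minor (e l) y (\<lambda>_. None)\<bar>" for l y
  define P where "P l C \<longleftrightarrow> C > 0 \<and> (\<forall>x\<in>borel_measurable (PiM UNIV (\<lambda>_. lborel)).
     (\<integral>\<^sup>+y. (\<Prod>j\<in>UNIV. epow (x (\<lambda>k\<in>UNIV. y (e l j, k))) (1 - \<delta>)) * epow (D l y) (-(1 - \<delta>)) \<partial>PiM ((I - {l}) \<times> UNIV) (\<lambda>_. lborel))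
     \<le> ennreal C * (\<Prod>j\<in>(UNIV :: 'n affine_index set). epow (\<integral>\<^sup>+z. x z \<partial>PiM UNIV (\<lambda>_. lborel)) (1 - \<delta>)))" for l and C :: real
  have "\<exists>C. P l C" for l
  proof -
    have inj: "inj (e l)" and ran: "range (e l) = I - {l}" using e[of l] by (auto simp: bij_betw_def)
    have c: "real (card {i. (\<lambda>_::'n affine_index. None :: 'n affine_index option) i = None}) = n + 1"
      by (simp add: card_affine_index n_def)
    show ?thesis
      using determinant_HLS[OF inj \<delta>(1), of UNIV "\<lambda>_. None"] \<delta> n
      unfolding P_def D_def c by (simp add: card_affine_index ran)
  qed
  then obtain Cl where P: "\<And>l. P l (Cl l)" by metis
  \<comment> \<open>Each point is absent from exactly one of the n+2 determinants, so these weights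
    fit Finner's inequality. Since (1 - \<delta>) v = \<delta>, a determinant with the exponent
    -\<delta> enters it with the exponent -(1 - \<delta>) found in \<open>P\<close>.\<close>
  define v where "v = 1 / (n + 1)"
  have v: "v > 0" "(n + 1) * v = 1" using n by (auto simp: v_def)
  define C where "C = (\<Prod>l\<in>I. Cl l powr v)"
  have Cl: "Cl l > 0" for l using P[of l] by (simp add: P_def)
  have "C > 0" unfolding C_def using Cl by (intro prod_pos) (metis less_irrefl powr_gt_zero)
  moreover have "(\<integral>\<^sup>+q. epow (radon g q) (n + 2) \<partial>lborel) \<le> ennreal C * epow (\<integral>\<^sup>+q. epow (g q) p \<partial>lborel) (n + 1)"
    if g [measurable]: "g \<in> borel_measurable borel" for g :: "'n pt \<Rightarrow> ennreal"
  proof -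
    let ?Y = "PiM (I \<times> UNIV) (\<lambda>_. lborel) :: ('n affine_index option \<times> 'n \<Rightarrow> real) measure"
    define V where "V i y = (\<chi> k. y (i, k))" for i and y :: "'n affine_index option \<times> 'n \<Rightarrow> real"
    define s where "s i q y = snd q + 2 * (fst q \<bullet> V i y)" for i and q :: "'n pt" and y
    \<comment> \<open>The (a, b)-integration uses up the last coordinate of every factor, so
      \<open>g\<close> enters the determinant inequality only through these vertical
      integrals.\<close>
    define \<Phi> where "\<Phi> z = (\<integral>\<^sup>+t. epow (g (z, t)) p \<partial>lborel)" for z
    define x where "x z = \<Phi> (\<chi> k. z k)" for z
    have Vm [measurable]: "V i \<in> borel_measurable (PiM (L \<times> UNIV) (\<lambda>_. lborel))" if "i \<in> L" for i L
      unfolding V_def[abs_def] using that measurable_component_singleton[of "(i, _)" "L \<times> UNIV" "\<lambda>_. lborel :: real measure"]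
      by (intro borel_measurable_vec_lambda) auto
    have gm [measurable]: "g \<in> borel_measurable (borel \<Otimes>\<^sub>M borel)" using g by (simp add: borel_prod)
    have \<Phi>m [measurable]: "\<Phi> \<in> borel_measurable borel" unfolding \<Phi>_def[abs_def] by measurable
    have xm [measurable]: "x \<in> borel_measurable (PiM UNIV (\<lambda>_. lborel))"
      unfolding x_def[abs_def] using measurable_compose[OF measurable_vec_lambda_PiM \<Phi>m] by simp
    have x_int: "(\<integral>\<^sup>+z. x z \<partial>PiM UNIV (\<lambda>_. lborel)) = (\<integral>\<^sup>+q. epow (g q) p \<partial>lborel)"
    proof -
      have "(\<integral>\<^sup>+z. x z \<partial>PiM UNIV (\<lambda>_. lborel)) = (\<integral>\<^sup>+z. \<Phi> z \<partial>lborel)"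
        unfolding x_def by (rule nn_integral_lborel_vec[symmetric]) simp
      also have "\<dots> = (\<integral>\<^sup>+q. epow (g q) p \<partial>(lborel \<Otimes>\<^sub>M lborel))"
        unfolding \<Phi>_def by (rule lborel.nn_integral_fst) simp
      finally show ?thesis by (simp add: lborel_prod)
    qed
    interpret Y: finite_product_sigma_finite "\<lambda>_. lborel :: real measure" "I \<times> (UNIV :: 'n set)"
      by standard (simp add: finI)
    interpret YP: pair_sigma_finite "lborel :: 'n pt measure" ?Y ..
    have rad: "epow (radon g q) (n + 2) = (\<integral>\<^sup>+y. (\<Prod>i\<in>I. g (V i y, s i q y)) \<partial>?Y)" for q
    proof -
      have "radon g q = (\<integral>\<^sup>+z. g ((\<chi> k. z k), snd q + 2 * (fst q \<bullet> (\<chi> k. z k))) \<partial>PiM UNIV (\<lambda>_. lborel))"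
        unfolding radon_def by (rule nn_integral_lborel_vec) measurable
      moreover have "epow (radon g q) (n + 2) = (\<Prod>i\<in>I. radon g q)"
        using epow_of_nat[of "radon g q" "card I"] by (simp add: cardI n_def add.commute)
      moreover have "(\<lambda>z. g ((\<chi> k. z k), snd q + 2 * (fst q \<bullet> (\<chi> k. z k)))) \<in> borel_measurable (PiM UNIV (\<lambda>_. lborel))"
        by (rule measurable_compose[OF measurable_vec_lambda_PiM, of "\<lambda>z. g (z, snd q + 2 * (fst q \<bullet> z))"]) measurable
      ultimately show ?thesis
        using prod_nn_integral_PiM_rows[of UNIV I "\<lambda>_ z. g ((\<chi> k. z k), snd q + 2 * (fst q \<bullet> (\<chi> k. z k)))"] finI
        by (simp add: V_def s_def)
    qed
    have "(\<integral>\<^sup>+q. epow (radon g q) (n + 2) \<partial>lborel) = (\<integral>\<^sup>+q. \<integral>\<^sup>+y. (\<Prod>i\<in>I. g (V i y, s i q y)) \<partial>?Y \<partial>lborel)"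
      by (simp only: rad)
    also have "\<dots> = (\<integral>\<^sup>+y. \<integral>\<^sup>+q. (\<Prod>i\<in>I. g (V i y, s i q y)) \<partial>lborel \<partial>?Y)"
    proof (rule YP.Fubini'[symmetric])
      have "(\<lambda>(q, y). \<Prod>i\<in>I. g (V i y, s i q y)) \<in> borel_measurable ((borel \<Otimes>\<^sub>M borel) \<Otimes>\<^sub>M ?Y)"
        unfolding s_def case_prod_beta by measurable
      then have "(\<lambda>(q, y). \<Prod>i\<in>I. g (V i y, s i q y)) \<in> borel_measurable (borel \<Otimes>\<^sub>M ?Y)"
        by (simp only: borel_prod)
      then show "(\<lambda>(q, y). \<Prod>i\<in>I. g (V i y, s i q y)) \<in> borel_measurable (lborel \<Otimes>\<^sub>M ?Y)"
        by (simp cong: measurable_cong_sets)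
    qed
    also have "\<dots> \<le> (\<integral>\<^sup>+y. (\<Prod>l\<in>I. epow (epow (D l y) (-1) * (\<Prod>j\<in>UNIV. \<Phi> (V (e l j) y))) \<delta>) \<partial>?Y)"
    proof (rule nn_integral_mono)
      fix y :: "'n affine_index option \<times> 'n \<Rightarrow> real"
      have sm [measurable]: "(\<lambda>q. s i q y) \<in> borel_measurable borel" for i
        unfolding s_def by (intro borel_measurable_continuous_onI continuous_intros)
      define h where "h i t = epow (g (V i y, t)) p" for i t
      have hm [measurable]: "h i \<in> borel_measurable borel" for i unfolding h_def[abs_def] by measurable
      have geq: "g (V i y, t) = epow (h i t) (1 - \<delta>)" for i t
        by (simp add: h_def epow_epow \<delta>)
      have re: "(\<Prod>i\<in>I-{l}. F i) = (\<Prod>j\<in>UNIV. F (e l j))" for F :: "_ \<Rightarrow> ennreal" and l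
        using prod.reindex_bij_betw[OF e[of l], of F] by simp
      \<comment> \<open>A point belongs to n+1 of the products over \<open>I - {l}\<close>, so
        \<open>h i\<close> receives the total exponent (n+1) \<delta> = 1 - \<delta>, which turns it
        back into \<open>g\<close>.\<close>
      have "(\<integral>\<^sup>+q. (\<Prod>i\<in>I. g (V i y, s i q y)) \<partial>lborel) = (\<integral>\<^sup>+q. (\<Prod>l\<in>I. epow (\<Prod>i\<in>I-{l}. h i (s i q y)) \<delta>) \<partial>lborel)"
      proof (rule nn_integral_cong)
        fix q
        have "(\<Prod>l\<in>I. epow (\<Prod>i\<in>I-{l}. h i (s i q y)) \<delta>) = (\<Prod>l\<in>I. \<Prod>i\<in>I-{l}. epow (h i (s i q y)) \<delta>)"
          using \<delta> by (simp add: epow_prod)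
        also have "\<dots> = (\<Prod>i\<in>I. g (V i y, s i q y))"
          using \<delta> finI by (subst prod_prod_Diff_epow) (simp_all add: cardI geq n_def add.commute)
        finally show "(\<Prod>i\<in>I. g (V i y, s i q y)) = (\<Prod>l\<in>I. epow (\<Prod>i\<in>I-{l}. h i (s i q y)) \<delta>)" by simp
      qed
      also have "\<dots> \<le> (\<Prod>l\<in>I. epow (\<integral>\<^sup>+q. (\<Prod>i\<in>I-{l}. h i (s i q y)) \<partial>lborel) \<delta>)"
      proof (rule nn_integral_Holder)
        show "(\<Sum>l\<in>I. \<delta>) = 1" using n by (simp add: cardI \<delta>_def n_def)
      qed (use finI \<delta> in auto)
      also have "\<dots> \<le> (\<Prod>l\<in>I. epow (epow (D l y) (-1) * (\<Prod>j\<in>UNIV. \<Phi> (V (e l j) y))) \<delta>)"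
      proof (intro ennreal_prod_mono epow_mono)
        fix l
        show "(\<integral>\<^sup>+q. (\<Prod>i\<in>I-{l}. h i (s i q y)) \<partial>lborel) \<le> epow (D l y) (-1) * (\<Prod>j\<in>UNIV. \<Phi> (V (e l j) y))"
          unfolding re D_def using nn_integral_affine_prod_le[of "\<lambda>j. h (e l j)" y "e l"]
          by (simp add: \<Phi>_def h_def s_def V_def)
      qed (use \<delta> in auto)
      finally show "(\<integral>\<^sup>+q. (\<Prod>i\<in>I. g (V i y, s i q y)) \<partial>lborel) \<le> \<dots>" .
    qed
    also have "\<dots> = (\<integral>\<^sup>+y. (\<Prod>l\<in>I. epow ((\<lambda>y. (\<Prod>j\<in>UNIV. epow (x (\<lambda>k\<in>UNIV. y (e l j, k))) (1 - \<delta>)) * epow (D l y) (-(1 - \<delta>)))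
          (restrict y ((I - {l}) \<times> UNIV))) v) \<partial>?Y)"
    proof (intro nn_integral_cong prod.cong refl)
      fix l and y :: "'n affine_index option \<times> 'n \<Rightarrow> real"
      have el: "e l j \<in> I - {l}" for j using e[of l] by (auto simp: bij_betw_def)
      have 1: "D l (restrict y ((I - {l}) \<times> UNIV)) = D l y"
        unfolding D_def using el by (intro arg_cong[where f = "\<lambda>a. ennreal \<bar>a\<bar>"] affine_minor_cong) auto
      have 2: "x (\<lambda>k\<in>UNIV. restrict y ((I - {l}) \<times> UNIV) (e l j, k)) = \<Phi> (V (e l j) y)" for j
        using el[of j] by (auto simp: x_def V_def)
      have dv: "(1 - \<delta>) * v = \<delta>" using \<delta>(2) v(2) by (metis mult.commute mult.left_commute mult.right_neutral)
      show "epow (epow (D l y) (-1) * (\<Prod>j\<in>UNIV. \<Phi> (V (e l j) y))) \<delta>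
          = epow ((\<Prod>j\<in>UNIV. epow (x (\<lambda>k\<in>UNIV. restrict y ((I - {l}) \<times> UNIV) (e l j, k))) (1 - \<delta>)) * epow (D l (restrict y ((I - {l}) \<times> UNIV))) (-(1 - \<delta>))) v"
      proof -
        have dv': "-(1 - \<delta>) * v = -1 * \<delta>" using dv by (simp only: mult_minus_left mult_1)
        show ?thesis
          unfolding 1 2 epow_mult[OF less_imp_le[OF v(1)]] epow_mult[OF less_imp_le[OF \<delta>(1)]]
            epow_prod[OF less_imp_le[OF v(1)]] epow_prod[OF less_imp_le[OF \<delta>(1)]] epow_epow dv dv'
          by (rule mult.commute)
      qed
    qed
    also have "\<dots> \<le> (\<Prod>l\<in>I. epow (\<integral>\<^sup>+y. (\<Prod>j\<in>UNIV. epow (x (\<lambda>k\<in>UNIV. y (e l j, k))) (1 - \<delta>)) * epow (D l y) (-(1 - \<delta>)) \<partial>PiM ((I - {l}) \<times> UNIV) (\<lambda>_. lborel)) v)"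
    proof (rule lborel_product.nn_integral_PiM_Finner)
      fix l
      have el: "e l j \<in> I - {l}" for j using e[of l] by (auto simp: bij_betw_def)
      have comp: "(\<lambda>y. y q :: real) \<in> borel_measurable (PiM ((I - {l}) \<times> UNIV) (\<lambda>_. lborel))" if "q \<in> (I - {l}) \<times> UNIV" for q :: "'n affine_index option \<times> 'n"
        using measurable_component_singleton[OF that, where M = "\<lambda>_. lborel :: real measure"] by simp
      show "(\<lambda>y. (\<Prod>j\<in>UNIV. epow (x (\<lambda>k\<in>UNIV. y (e l j, k))) (1 - \<delta>)) * epow (D l y) (-(1 - \<delta>))) \<in> borel_measurable (PiM ((I - {l}) \<times> UNIV) (\<lambda>_. lborel))"
        unfolding D_def
      proof (intro borel_measurable_times_ennreal borel_measurable_prod_ennreal borel_measurable_epow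
          measurable_compose[OF _ measurable_ennreal] borel_measurable_abs affine_minor_measurable comp)
        show "(\<lambda>y. x (\<lambda>k\<in>UNIV. y (e l j, k))) \<in> borel_measurable (PiM ((I - {l}) \<times> UNIV) (\<lambda>_. lborel))" for j
          by (rule measurable_compose[OF measurable_restrict xm]) (use el in \<open>auto intro!: measurable_component_singleton\<close>)
      qed (use el in auto)
    next
      fix q assume "q \<in> I \<times> (UNIV :: 'n set)"
      then have "{l. l \<in> I \<and> q \<in> (I - {l}) \<times> UNIV} = I - {fst q}" "fst q \<in> I" by auto
      then show "(\<Sum>l | l \<in> I \<and> q \<in> (I - {l}) \<times> UNIV. v) = 1"
        using finI v(2) by (simp add: cardI n_def add.commute)
    qed (use finI v in auto)
    also have "\<dots> \<le> (\<Prod>l\<in>I. epow (ennreal (Cl l) * (\<Prod>j\<in>(UNIV :: 'n affine_index set). epow (\<integral>\<^sup>+z. x z \<partial>PiM UNIV (\<lambda>_. lborel)) (1 - \<delta>))) v)"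
      using P xm v by (intro ennreal_prod_mono epow_mono) (auto simp: P_def)
    also have "\<dots> = (\<Prod>l\<in>I. ennreal (Cl l powr v)) * (\<Prod>l\<in>I. epow (\<integral>\<^sup>+z. x z \<partial>PiM UNIV (\<lambda>_. lborel)) (1 - \<delta>))"
    proof -
      have "epow (ennreal (Cl l) * (\<Prod>j\<in>(UNIV :: 'n affine_index set). epow (\<integral>\<^sup>+z. x z \<partial>PiM UNIV (\<lambda>_. lborel)) (1 - \<delta>))) v
         = ennreal (Cl l powr v) * epow (\<integral>\<^sup>+z. x z \<partial>PiM UNIV (\<lambda>_. lborel)) (1 - \<delta>)" for l
      proof -
        have "(1 - \<delta>) * (real (CARD('n) + 1) * v) = 1 - \<delta>" using v(2) by (simp add: n_def add.commute)
        then show ?thesis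
          using v(1) Cl[of l] by (simp only: epow_mult less_imp_le prod_constant epow_of_nat[symmetric] epow_epow epow_ennreal card_affine_index mult.assoc)
      qed
      then show ?thesis by (simp only: prod.distrib)
    qed
    also have "(\<Prod>l\<in>I. ennreal (Cl l powr v)) = ennreal C"
      unfolding C_def by (intro prod_ennreal) simp
    also have "(\<Prod>l\<in>I. epow (\<integral>\<^sup>+z. x z \<partial>PiM UNIV (\<lambda>_. lborel)) (1 - \<delta>)) = epow (\<integral>\<^sup>+q. epow (g q) p \<partial>lborel) (n + 1)"
    proof -
      have "(1 - \<delta>) * (n + 2) = n + 1" using n by (simp add: \<delta>_def field_simps)
      then show ?thesis
        unfolding x_int prod_constant epow_of_nat[symmetric] epow_epow by (simp add: cardI n_def add.commute)
    qed
    finally show ?thesis .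
  qed
  ultimately show ?thesis unfolding n_def p_def by blast
qed

section \<open>The image of the weight\<close>

text \<open>For \<open>r = 1\<close> this is \<open>upsilon_star\<close> at
  \<open>(y, b + a \<bullet> y - (norm y)\<^sup>2)\<close>, where the quadratic terms cancel. Other
  values of \<open>r\<close> arise from dilations.\<close>

definition radial_profile :: "real \<Rightarrow> real^'n::finite \<Rightarrow> real \<Rightarrow> real^'n \<Rightarrow> ennreal" where
  "radial_profile r a b y = epow (ennreal (max r (max (norm y) \<bar>b + a \<bullet> y\<bar>))) (-(real CARD('n) + 1))"

text \<open>
  The exponent is chosen so that the product of \<open>m\<close> such factors decays with exponent \<open>m + 1\<close>, while
  each factor remains integrable.
\<close>

definition decay :: "real \<Rightarrow> real \<Rightarrow> ennreal" where
  "decay m s = epow (ennreal (max 1 \<bar>s\<bar>)) (-((m + 1) / m))"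

lemma decay_measurable [measurable]: "decay m \<in> borel_measurable borel"
  unfolding decay_def[abs_def] by measurable

lemma decay_integral_finite:
  assumes "m > 0"
  obtains A where "A > 0" "(\<integral>\<^sup>+s. decay m s \<partial>lborel) \<le> ennreal A"
proof
  let ?e = "-((m + 1) / m)"
  have e: "?e < -1" using assms by (simp add: field_simps)
  let ?G = "\<lambda>s. indicator {0..1} s + ennreal (s powr ?e) * indicator {1..} s :: ennreal"
  have "(\<integral>\<^sup>+s. decay m s \<partial>lborel) \<le> (\<integral>\<^sup>+s. ?G \<bar>s\<bar> \<partial>lborel)"
    by (intro nn_integral_mono) (auto simp: decay_def epow_ennreal max_def split: split_indicator)
  also have "\<dots> \<le> 2 * (\<integral>\<^sup>+s. indicator {0..} s * ?G s \<partial>lborel)"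
    by (rule nn_integral_abs_le) measurable
  also have "(\<integral>\<^sup>+s. indicator {0..} s * ?G s \<partial>lborel) = (\<integral>\<^sup>+s. ?G s \<partial>lborel)"
    by (intro nn_integral_cong) (auto split: split_indicator)
  also have "\<dots> = 1 + (\<integral>\<^sup>+s. ennreal (s powr ?e) * indicator {1..} s \<partial>lborel)"
    by (subst nn_integral_add) auto
  also have "(\<integral>\<^sup>+s. ennreal (s powr ?e) * indicator {1..} s \<partial>lborel) = ennreal (-(1 powr (?e+1)) / (?e+1))"
    using e by (intro nn_integral_has_integral_lebesgue' has_integral_powr_to_inf) auto
  also have "-(1 powr (?e+1)) / (?e+1) = m"
    using assms by (simp add: field_simps)
  also have "2 * (1 + ennreal m) = ennreal (2 * (1 + m))"
    using assms by (simp add: ennreal_mult')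
  finally show "(\<integral>\<^sup>+s. decay m s \<partial>lborel) \<le> ennreal (2 * (1 + m))" .
  show "2 * (1 + m) > 0" using assms by simp
qed

lemma norm_le_card_mult_component:
  fixes a :: "real^'n::finite"
  obtains k where "norm a \<le> real CARD('n) * \<bar>a $ k\<bar>"
proof -
  define M where "M = Max (range (\<lambda>i. \<bar>a $ i\<bar>))"
  have "M \<in> range (\<lambda>i. \<bar>a $ i\<bar>)" unfolding M_def by (intro Max_in) auto
  then obtain k where k: "M = \<bar>a $ k\<bar>" by auto
  have "\<bar>a $ i\<bar> \<le> M" for i unfolding M_def by (intro Max_ge) auto
  then have "(\<Sum>i\<in>UNIV. \<bar>a $ i\<bar>) \<le> (\<Sum>i\<in>(UNIV::'n set). M)" by (intro sum_mono)
  then have "norm a \<le> real CARD('n) * \<bar>a $ k\<bar>"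
    using norm_le_l1_cart[of a] k by simp
  then show ?thesis by (rule that)
qed

text \<open>The power of the maximum is split into n equal factors, and in each of them the maximum
  is replaced by one of the quantities it dominates. The set \<open>K\<close> tells where the affine
  form takes the place of a coordinate.\<close>

lemma radial_profile_le_decay:
  fixes y a :: "real^'n::finite"
  shows "radial_profile 1 a b y \<le> (\<Prod>i\<in>UNIV. decay (real CARD('n)) (if i \<in> K then b + a \<bullet> y else y $ i))"
proof -
  define n where "n = real CARD('n)"
  have n: "n \<ge> 1" using zero_less_card_finite[where 'a='n] by (simp add: n_def)
  let ?M = "max 1 (max (norm y) \<bar>b + a \<bullet> y\<bar>)"
  have "radial_profile 1 a b y = epow (ennreal ?M) (-((n+1)/n)) ^ CARD('n)"
    unfolding epow_of_nat[symmetric] epow_epow radial_profile_def using n by (simp add: n_def)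
  also have "\<dots> = (\<Prod>i\<in>(UNIV::'n set). epow (ennreal ?M) (-((n+1)/n)))" by simp
  also have "\<dots> \<le> (\<Prod>i\<in>UNIV. decay n (if i \<in> K then b + a \<bullet> y else y $ i))"
    unfolding decay_def
  proof (intro ennreal_prod_mono epow_antimono ennreal_leI)
    fix i
    show "max 1 \<bar>if i \<in> K then b + a \<bullet> y else y $ i\<bar> \<le> ?M"
      using component_le_norm_cart[of y i] by auto
  qed (use n in auto)
  finally show ?thesis by (simp only: n_def)
qed

lemma radial_profile_measurable [measurable]: "radial_profile r a b \<in> borel_measurable borel"
  unfolding radial_profile_def[abs_def] by measurable

lemma radial_profile_integral_le:
  assumes A: "(\<integral>\<^sup>+s. decay (real CARD('n)) s \<partial>lborel) \<le> ennreal A" "A > 0"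
  shows "(\<integral>\<^sup>+y. radial_profile 1 (a :: real^'n::finite) b y \<partial>lborel) \<le> ennreal (A ^ CARD('n))"
proof -
  let ?n = "real CARD('n)"
  have "(\<integral>\<^sup>+y. radial_profile 1 a b y \<partial>lborel) \<le> (\<integral>\<^sup>+y. (\<Prod>i\<in>(UNIV :: 'n set). decay ?n (y $ i)) \<partial>lborel)"
  proof (rule nn_integral_mono)
    fix y
    show "radial_profile 1 a b y \<le> (\<Prod>i\<in>UNIV. decay ?n (y $ i))"
      using radial_profile_le_decay[of a b y "{}"] by simp
  qed
  also have "\<dots> = (\<integral>\<^sup>+y. (\<Prod>i\<in>UNIV. decay ?n (y i)) \<partial>PiM (UNIV :: 'n set) (\<lambda>_. lborel))"
    by (subst nn_integral_lborel_vec) auto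
  also have "\<dots> = (\<Prod>i\<in>(UNIV :: 'n set). \<integral>\<^sup>+s. decay ?n s \<partial>lborel)"
    by (intro lborel_product.product_nn_integral_prod) auto
  also have "\<dots> \<le> (\<Prod>i\<in>(UNIV :: 'n set). ennreal A)"
    using A by (intro ennreal_prod_mono) auto
  also have "\<dots> = ennreal (A ^ CARD('n))" using A by (simp add: ennreal_power)
  finally show ?thesis .
qed

text \<open>Along the largest component \<open>a $ k\<close> the decay in
  \<open>b + a \<bullet> y\<close> replaces that in \<open>y $ k\<close>. Substituting the affine
  form for this variable gains 1/|a_k|, which is at most n/|a|.\<close>

lemma radial_profile_integral_le_slope:
  fixes a :: "real^'n::finite"
  assumes A: "(\<integral>\<^sup>+s. decay (real CARD('n)) s \<partial>lborel) \<le> ennreal A" "A > 0" and a: "a \<noteq> 0"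
  shows "(\<integral>\<^sup>+y. radial_profile 1 a b y \<partial>lborel) \<le> ennreal (real CARD('n) * A ^ CARD('n) / norm a)"
proof -
  let ?n = "real CARD('n)"
  obtain k where k: "norm a \<le> ?n * \<bar>a $ k\<bar>" by (rule norm_le_card_mult_component)
  then have ak: "a $ k \<noteq> 0" using a by auto
  let ?R = "UNIV - {k}"
  let ?F = "\<lambda>y. (\<Prod>i\<in>?R. decay ?n (y i)) * decay ?n (b + (\<Sum>i\<in>?R. a $ i * y i) + a $ k * y k)"
  have U: "insert k ?R = UNIV" by auto
  have comp: "(\<lambda>y. y i :: real) \<in> borel_measurable (PiM UNIV (\<lambda>_. lborel))" for i :: 'n
    using measurable_component_singleton[of i UNIV "\<lambda>_. lborel :: real measure"] by simp
  have comp': "(\<lambda>y. y i :: real) \<in> borel_measurable (PiM ?R (\<lambda>_. lborel))" if "i \<in> ?R" for i :: 'n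
    using measurable_component_singleton[OF that, where M = "\<lambda>_. lborel :: real measure"] by simp
  have Fm: "?F \<in> borel_measurable (PiM UNIV (\<lambda>_. lborel))"
    by (intro borel_measurable_times_ennreal borel_measurable_prod_ennreal measurable_compose[OF _ decay_measurable]
        borel_measurable_add borel_measurable_sum borel_measurable_times comp borel_measurable_const)
  have "(\<integral>\<^sup>+y. radial_profile 1 a b y \<partial>lborel) = (\<integral>\<^sup>+y. radial_profile 1 a b (\<chi> i. y i) \<partial>PiM UNIV (\<lambda>_. lborel))"
    by (rule nn_integral_lborel_vec) simp
  also have "\<dots> \<le> (\<integral>\<^sup>+y. ?F y \<partial>PiM UNIV (\<lambda>_. lborel))"
  proof (rule nn_integral_mono)
    fix y :: "'n \<Rightarrow> real"
    have "b + a \<bullet> (\<chi> i. y i) = b + (\<Sum>i\<in>?R. a $ i * y i) + a $ k * y k"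
      by (simp add: inner_vec_def sum.remove[of UNIV k])
    then have "(\<Prod>i\<in>UNIV. decay ?n (if i \<in> {k} then b + a \<bullet> (\<chi> i. y i) else (\<chi> i. y i) $ i)) = ?F y"
      by (subst prod.remove[of UNIV k]) (auto simp: mult.commute add.assoc intro!: prod.cong)
    then show "radial_profile 1 a b (\<chi> i. y i) \<le> ?F y"
      using radial_profile_le_decay[of a b "\<chi> i. y i" "{k}"] by simp
  qed
  also have "\<dots> = (\<integral>\<^sup>+y. (\<integral>\<^sup>+u. ?F (y(k := u)) \<partial>lborel) \<partial>PiM ?R (\<lambda>_. lborel))"
    using lborel_product.product_nn_integral_insert[of ?R k ?F] Fm unfolding U by simp
  also have "\<dots> = (\<integral>\<^sup>+y. (\<Prod>i\<in>?R. decay ?n (y i)) * (ennreal (1 / \<bar>a $ k\<bar>) * (\<integral>\<^sup>+s. decay ?n s \<partial>lborel)) \<partial>PiM ?R (\<lambda>_. lborel))"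
  proof (rule nn_integral_cong)
    fix y :: "'n \<Rightarrow> real"
    let ?c = "b + (\<Sum>i\<in>?R. a $ i * y i)"
    have "(\<integral>\<^sup>+u. ?F (y(k := u)) \<partial>lborel) = (\<integral>\<^sup>+u. (\<Prod>i\<in>?R. decay ?n (y i)) * decay ?n (?c + a $ k * u) \<partial>lborel)"
      by (intro nn_integral_cong arg_cong2[where f = "(*)"] prod.cong arg_cong[where f = "decay ?n"] arg_cong2[where f = "(+)"] sum.cong) auto
    also have "\<dots> = (\<Prod>i\<in>?R. decay ?n (y i)) * (\<integral>\<^sup>+u. decay ?n (?c + a $ k * u) \<partial>lborel)"
      by (intro nn_integral_cmult) measurable
    also have "(\<integral>\<^sup>+u. decay ?n (?c + a $ k * u) \<partial>lborel) = ennreal (1 / \<bar>a $ k\<bar>) * (\<integral>\<^sup>+s. decay ?n s \<partial>lborel)"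
      using ak by (subst nn_integral_real_affine[of "decay ?n" "a $ k" ?c])
        (auto simp: mult.assoc[symmetric] ennreal_mult'[symmetric])
    finally show "(\<integral>\<^sup>+u. ?F (y(k := u)) \<partial>lborel)
        = (\<Prod>i\<in>?R. decay ?n (y i)) * (ennreal (1 / \<bar>a $ k\<bar>) * (\<integral>\<^sup>+s. decay ?n s \<partial>lborel))" .
  qed
  also have "\<dots> = (\<integral>\<^sup>+y. (\<Prod>i\<in>?R. decay ?n (y i)) \<partial>PiM ?R (\<lambda>_. lborel)) * (ennreal (1 / \<bar>a $ k\<bar>) * (\<integral>\<^sup>+s. decay ?n s \<partial>lborel))"
    by (intro nn_integral_multc borel_measurable_prod_ennreal measurable_compose[OF _ decay_measurable] comp')
  also have "(\<integral>\<^sup>+y. (\<Prod>i\<in>?R. decay ?n (y i)) \<partial>PiM ?R (\<lambda>_. lborel)) = (\<Prod>i\<in>?R. \<integral>\<^sup>+s. decay ?n s \<partial>lborel)"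
    by (intro lborel_product.product_nn_integral_prod) auto
  also have "\<dots> * (ennreal (1 / \<bar>a $ k\<bar>) * (\<integral>\<^sup>+s. decay ?n s \<partial>lborel)) = ennreal (1 / \<bar>a $ k\<bar>) * (\<Prod>i\<in>(UNIV :: 'n set). \<integral>\<^sup>+s. decay ?n s \<partial>lborel)"
    by (subst prod.remove[of UNIV k]) (auto simp: mult_ac)
  also have "\<dots> \<le> ennreal (1 / \<bar>a $ k\<bar>) * (\<Prod>i\<in>(UNIV :: 'n set). ennreal A)"
    using A by (intro mult_left_mono ennreal_prod_mono) auto
  also have "\<dots> = ennreal (1 / \<bar>a $ k\<bar> * A ^ CARD('n))" using A by (subst ennreal_mult') (auto simp: ennreal_power)
  also have "\<dots> \<le> ennreal (?n * A ^ CARD('n) / norm a)"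
  proof (rule ennreal_leI)
    have "1 / \<bar>a $ k\<bar> \<le> ?n / norm a" using k a ak by (simp add: field_simps)
    from mult_right_mono[OF this, of "A ^ CARD('n)"] A show "1 / \<bar>a $ k\<bar> * A ^ CARD('n) \<le> ?n * A ^ CARD('n) / norm a" by simp
  qed
  finally show ?thesis .
qed

text \<open>Under y = r y' the profile gains the factor r^(-(n+1)) and the volume r^n.\<close>

lemma radial_profile_integral_scale:
  fixes a :: "real^'n::finite"
  assumes r: "r > 0"
  shows "(\<integral>\<^sup>+y. radial_profile r a b y \<partial>lborel) = ennreal (1 / r) * (\<integral>\<^sup>+y. radial_profile 1 a (b / r) y \<partial>lborel)"
proof -
  let ?d = "real CARD('n) + 1"
  have "radial_profile r a b (r *\<^sub>R y) = ennreal (r powr (-?d)) * radial_profile 1 a (b / r) y" for y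
  proof -
    define M where "M = max 1 (max (norm y) \<bar>b / r + a \<bullet> y\<bar>)"
    have pos: "M > 0" by (simp add: M_def)
    have "b + a \<bullet> (r *\<^sub>R y) = r * (b / r + a \<bullet> y)" using r by (simp add: algebra_simps)
    then have eq: "max r (max (norm (r *\<^sub>R y)) \<bar>b + a \<bullet> (r *\<^sub>R y)\<bar>) = r * M"
      using r by (simp add: M_def abs_mult max_mult_distrib_left)
    show ?thesis
      unfolding radial_profile_def eq M_def[symmetric] epow_ennreal[OF pos] epow_ennreal[OF mult_pos_pos[OF r pos]]
      using r pos by (simp add: powr_mult ennreal_mult')
  qed
  then have "(\<integral>\<^sup>+y. radial_profile r a b y \<partial>lborel) = ennreal (r ^ CARD('n)) * (\<integral>\<^sup>+y. ennreal (r powr (-?d)) * radial_profile 1 a (b / r) y \<partial>lborel)"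
    using r nn_integral_lborel_scale[of "radial_profile r a b" r 0] by simp
  also have "\<dots> = ennreal (r ^ CARD('n) * r powr (-?d)) * (\<integral>\<^sup>+y. radial_profile 1 a (b / r) y \<partial>lborel)"
    using r by (simp add: nn_integral_cmult ennreal_mult' mult.assoc)
  also have "r ^ CARD('n) * r powr (-?d) = 1 / r"
    using r by (simp add: powr_realpow[symmetric] powr_add[symmetric] powr_minus_divide)
  finally show ?thesis .
qed

text \<open>
  Either \<open>\<bar>b + a \<bullet> y\<bar> \<ge> \<bar>b\<bar>/2\<close>, or \<open>norm y \<ge> \<bar>b\<bar> / (2 * norm a)\<close>; both regions are rescaled to the
  profile with \<open>r = 1\<close>.
\<close>

lemma radial_profile_integral_le_shift:
  fixes a :: "real^'n::finite"
  assumes A: "(\<integral>\<^sup>+s. decay (real CARD('n)) s \<partial>lborel) \<le> ennreal A" "A > 0" and b: "b \<noteq> 0"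
  shows "(\<integral>\<^sup>+y. radial_profile 1 a b y \<partial>lborel) \<le> ennreal ((2 + 2 * real CARD('n)) * A ^ CARD('n) / \<bar>b\<bar>)"
proof -
  let ?n = "real CARD('n)"
  have far: "(\<integral>\<^sup>+y. radial_profile (\<bar>b\<bar> / 2) (0 :: real^'n) 0 y \<partial>lborel) \<le> ennreal (2 * A ^ CARD('n) / \<bar>b\<bar>)"
  proof -
    have "(\<integral>\<^sup>+y. radial_profile (\<bar>b\<bar> / 2) (0 :: real^'n) 0 y \<partial>lborel) = ennreal (1 / (\<bar>b\<bar> / 2)) * (\<integral>\<^sup>+y. radial_profile 1 (0 :: real^'n) (0 / (\<bar>b\<bar> / 2)) y \<partial>lborel)"
      using b by (intro radial_profile_integral_scale) simp
    also have "\<dots> \<le> ennreal (1 / (\<bar>b\<bar> / 2)) * ennreal (A ^ CARD('n))"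
      by (intro mult_left_mono radial_profile_integral_le A) simp
    also have "\<dots> = ennreal (2 * A ^ CARD('n) / \<bar>b\<bar>)" using A by (simp add: ennreal_mult'[symmetric])
    finally show ?thesis .
  qed
  show ?thesis
  proof (cases "a = 0")
    case True
    have "(\<integral>\<^sup>+y. radial_profile 1 a b y \<partial>lborel) \<le> (\<integral>\<^sup>+y. radial_profile (\<bar>b\<bar> / 2) (0 :: real^'n) 0 y \<partial>lborel)"
      unfolding radial_profile_def using True
      by (intro nn_integral_mono epow_antimono ennreal_leI) auto
    also note far
    also have "ennreal (2 * A ^ CARD('n) / \<bar>b\<bar>) \<le> ennreal ((2 + 2 * ?n) * A ^ CARD('n) / \<bar>b\<bar>)"
      using A by (intro ennreal_leI divide_right_mono mult_right_mono) auto
    finally show ?thesis .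
  next
    case False
    define \<rho> where "\<rho> = \<bar>b\<bar> / (2 * norm a)"
    have \<rho>: "\<rho> > 0" using b False by (simp add: \<rho>_def)
    have "radial_profile 1 a b y \<le> radial_profile (\<bar>b\<bar> / 2) 0 0 y + radial_profile \<rho> a b y" for y
    proof (cases "\<bar>b + a \<bullet> y\<bar> \<ge> \<bar>b\<bar> / 2")
      case True
      have "\<bar>b\<bar> / 2 \<le> max 1 (max (norm y) \<bar>b + a \<bullet> y\<bar>)" by (rule order_trans[OF True]) simp
      then have "radial_profile 1 a b y \<le> radial_profile (\<bar>b\<bar> / 2) 0 0 y"
        unfolding radial_profile_def by (intro epow_antimono ennreal_leI max.boundedI) auto
      then show ?thesis by (rule order_trans) simp
    next
      case near: False
      have "\<bar>b\<bar> / 2 \<le> \<bar>a \<bullet> y\<bar>" using near by (auto simp: abs_if split: if_splits)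
      also have "\<dots> \<le> norm a * norm y" by (rule Cauchy_Schwarz_ineq2)
      finally have "\<rho> \<le> norm y" using False by (simp add: \<rho>_def field_simps)
      then have "radial_profile 1 a b y \<le> radial_profile \<rho> a b y"
        unfolding radial_profile_def by (intro epow_antimono ennreal_leI) auto
      then show ?thesis by (rule order_trans) simp
    qed
    then have "(\<integral>\<^sup>+y. radial_profile 1 a b y \<partial>lborel) \<le> (\<integral>\<^sup>+y. radial_profile (\<bar>b\<bar> / 2) 0 0 y + radial_profile \<rho> a b y \<partial>lborel)"
      by (rule nn_integral_mono)
    also have "\<dots> = (\<integral>\<^sup>+y. radial_profile (\<bar>b\<bar> / 2) (0 :: real^'n) 0 y \<partial>lborel) + (\<integral>\<^sup>+y. radial_profile \<rho> a b y \<partial>lborel)"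
      by (rule nn_integral_add) auto
    \<comment> \<open>The dilation by \<rho> costs 1/\<rho> = 2 |a|/|b|, and the slope bound gains
      1/|a|. The slope cancels, leaving the summand 2n of the constant 2 + 2n.\<close>
    also have "\<dots> \<le> ennreal (2 * A ^ CARD('n) / \<bar>b\<bar>) + ennreal (1 / \<rho>) * ennreal (?n * A ^ CARD('n) / norm a)"
      unfolding radial_profile_integral_scale[OF \<rho>]
      by (intro add_mono far mult_left_mono radial_profile_integral_le_slope A False) simp
    also have "\<dots> = ennreal (2 * A ^ CARD('n) / \<bar>b\<bar> + 1 / \<rho> * (?n * A ^ CARD('n) / norm a))"
      using A \<rho> by (simp add: ennreal_mult'[symmetric] ennreal_plus[symmetric] del: ennreal_plus)
    also have "2 * A ^ CARD('n) / \<bar>b\<bar> + 1 / \<rho> * (?n * A ^ CARD('n) / norm a) = (2 + 2 * ?n) * A ^ CARD('n) / \<bar>b\<bar>"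
      using b False by (simp add: \<rho>_def field_simps)
    finally show ?thesis .
  qed
qed

lemma radial_profile_integral_bound:
  "\<exists>C::real. C > 0 \<and> (\<forall>(a :: real^'n::finite) b. (\<integral>\<^sup>+y. radial_profile 1 a b y \<partial>lborel)
      \<le> ennreal C * epow (ennreal (max 1 (max (norm a) \<bar>b\<bar>))) (-1))"
proof -
  let ?n = "real CARD('n)"
  have n: "?n > 0" by simp
  obtain A where A: "A > 0" "(\<integral>\<^sup>+s. decay ?n s \<partial>lborel) \<le> ennreal A"
    using decay_integral_finite[OF n] by blast
  define C where "C = (2 + 2 * ?n) * A ^ CARD('n)"
  have C: "C > 0" using A by (simp add: C_def add_pos_nonneg)
  have le: "A ^ CARD('n) \<le> C" "?n * A ^ CARD('n) \<le> C"
    using A mult_right_mono[of 1 "2 + 2 * ?n" "A ^ CARD('n)"] by (auto simp: C_def intro!: mult_right_mono)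
  have "(\<integral>\<^sup>+y. radial_profile 1 a b y \<partial>lborel) \<le> ennreal C * epow (ennreal (max 1 (max (norm a) \<bar>b\<bar>))) (-1)" for a :: "real^'n" and b
  proof -
    let ?m = "max 1 (max (norm a) \<bar>b\<bar>)"
    have "?m = 1 \<or> ?m = norm a \<and> norm a > 0 \<or> ?m = \<bar>b\<bar> \<and> \<bar>b\<bar> > 0" by (auto simp: max_def)
    then consider "?m = 1" | "?m = norm a" "norm a > 0" | "?m = \<bar>b\<bar>" "\<bar>b\<bar> > 0" by blast
    then have "(\<integral>\<^sup>+y. radial_profile 1 a b y \<partial>lborel) \<le> ennreal (C / ?m)"
    proof cases
      case 1
      have "(\<integral>\<^sup>+y. radial_profile 1 a b y \<partial>lborel) \<le> ennreal (A ^ CARD('n))"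
        by (rule radial_profile_integral_le[OF A(2,1)])
      also have "\<dots> \<le> ennreal (C / ?m)" unfolding 1 using le by (intro ennreal_leI) simp
      finally show ?thesis .
    next
      case 2
      have "(\<integral>\<^sup>+y. radial_profile 1 a b y \<partial>lborel) \<le> ennreal (?n * A ^ CARD('n) / norm a)"
        using 2 by (intro radial_profile_integral_le_slope[OF A(2,1)]) auto
      also have "\<dots> \<le> ennreal (C / ?m)" unfolding 2(1) using le by (intro ennreal_leI divide_right_mono) auto
      finally show ?thesis .
    next
      case 3
      have "(\<integral>\<^sup>+y. radial_profile 1 a b y \<partial>lborel) \<le> ennreal ((2 + 2 * ?n) * A ^ CARD('n) / \<bar>b\<bar>)"
        using 3 by (intro radial_profile_integral_le_shift[OF A(2,1)]) auto
      also have "\<dots> = ennreal (C / ?m)" unfolding 3(1) C_def ..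
      finally show ?thesis .
    qed
    also have "ennreal (C / ?m) = ennreal C * epow (ennreal ?m) (-1)"
      using C by (subst epow_ennreal) (auto simp: powr_minus_divide ennreal_mult'[symmetric])
    finally show ?thesis .
  qed
  then show ?thesis using C by blast
qed

section \<open>Interpolation\<close>

lemma borel_measurable_completion_AE:
  assumes f: "f \<in> borel_measurable (completion M)" and eq: "AE x in M. f x = g x"
  shows "g \<in> borel_measurable (completion M)"
proof (rule measurableI)
  fix A :: "'b set" assume A: "A \<in> sets borel"
  have "AE x in completion M. f x = g x" using eq by (rule AE_completion)
  then have "AE x in completion M. x \<in> f -` A \<inter> space (completion M) \<longleftrightarrow> x \<in> g -` A \<inter> space (completion M)"
    by eventually_elim auto
  from completion.in_sets_AE[OF this measurable_sets[OF f A]]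
  show "g -` A \<inter> space (completion M) \<in> sets (completion M)" by auto
qed simp

text \<open>Both operators have this form, with \<open>c t\<close> running over a paraboloid, so the
  interpolation is carried out once for the two of them.\<close>

definition translation_average :: "('a::euclidean_space \<Rightarrow> 'b::euclidean_space) \<Rightarrow> ('b \<Rightarrow> ennreal) \<Rightarrow> 'b \<Rightarrow> ennreal" where
  "translation_average c f x = (\<integral>\<^sup>+t. f (x + c t) \<partial>lborel)"

context
  fixes c :: "'a::euclidean_space \<Rightarrow> 'b::euclidean_space"
  assumes c [measurable]: "c \<in> borel_measurable borel"
begin

lemma translation_average_measurable [measurable]:
  assumes [measurable]: "f \<in> borel_measurable borel"
  shows "translation_average c f \<in> borel_measurable borel"
  unfolding translation_average_def[abs_def] by measurable

text \<open>For each \<open>t\<close> the points \<open>x\<close> with \<open>x + c t\<close> in a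
  null set form a translate of it, again a null set; Tonelli exchanges the roles of \<open>x\<close>
  and \<open>t\<close>. This makes the averages insensitive to changes on null sets.\<close>

lemma AE_translation:
  assumes "AE z in lborel. P z"
  shows "AE x in lborel. AE t in lborel. P (x + c t)"
proof -
  obtain N where N: "N \<in> null_sets lborel" "\<And>z. z \<notin> N \<Longrightarrow> P z"
    using assms by (auto elim!: AE_E3)
  have [measurable]: "N \<in> sets borel" using N(1) by auto
  have "(\<integral>\<^sup>+x. \<integral>\<^sup>+t. indicator N (x + c t) \<partial>lborel \<partial>lborel) = (\<integral>\<^sup>+t. \<integral>\<^sup>+x. indicator N (x + c t) \<partial>lborel \<partial>lborel)"
    by (rule lborel_pair.Fubini') measurable
  also have "\<dots> = (\<integral>\<^sup>+(t::'a). 0 \<partial>lborel)"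
  proof (rule nn_integral_cong)
    fix t
    have "(\<integral>\<^sup>+x. indicator N (x + c t) \<partial>lborel) = (\<integral>\<^sup>+x. indicator N x \<partial>lborel :: ennreal)"
      using nn_integral_lborel_scale[of "indicator N" 1 "c t"] by (simp add: add.commute)
    also have "\<dots> = 0" using N(1) by auto
    finally show "(\<integral>\<^sup>+x. indicator N (x + c t) \<partial>lborel) = (0 :: ennreal)" .
  qed
  finally have "AE x in lborel. (\<integral>\<^sup>+t. indicator N (x + c t) \<partial>lborel) = (0 :: ennreal)"
    by (simp add: nn_integral_0_iff_AE)
  then show ?thesis
  proof eventually_elim
    case (elim x)
    then have "AE t in lborel. indicator N (x + c t) = (0 :: ennreal)"
      by (simp add: nn_integral_0_iff_AE)
    then show ?case by eventually_elim (auto intro: N(2) split: split_indicator_asm)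
  qed
qed

lemma translation_average_cong_AE:
  assumes "AE z in lborel. f z = g z"
  shows "AE x in lborel. translation_average c f x = translation_average c g x"
  using AE_translation[OF assms]
  by eventually_elim (simp add: translation_average_def nn_integral_cong_AE)

text \<open>The two endpoints as assumptions: \<open>endpoint\<close> is the case t = 0, and
  \<open>weight\<close> is the case t = 1 tested on \<open>V\<close>, which by positivity implies
  that case for all functions.\<close>

context
  fixes U V :: "'b \<Rightarrow> ennreal" and d C1 C2 :: real
  assumes U [measurable]: "U \<in> borel_measurable borel" and V [measurable]: "V \<in> borel_measurable borel"
    and U01: "\<And>x. 0 < U x" "\<And>x. U x < \<infinity>" and V01: "\<And>x. 0 < V x" "\<And>x. V x < \<infinity>"
    and C: "C1 > 0" "C2 > 0" and d: "d > 0"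
    and weight: "\<And>x. translation_average c V x \<le> ennreal C1 * epow (U x) (1 / d)"
    and endpoint: "\<And>g. g \<in> borel_measurable borel \<Longrightarrow>
      (\<integral>\<^sup>+x. epow (translation_average c g x) (d + 1) \<partial>lborel) \<le> ennreal C2 * epow (\<integral>\<^sup>+x. epow (g x) ((d + 1) / d) \<partial>lborel) d"
begin

lemma weighted_interpolation_borel:
  assumes t: "0 \<le> t" "t < 1" and f [measurable]: "f \<in> borel_measurable borel"
  defines "p \<equiv> (d + 1) / (d * (1 - t))" and "q \<equiv> (d + 1) / (1 - t)"
  shows "epow (\<integral>\<^sup>+x. epow (translation_average c f x) q * epow (U x) (- t * q / d) \<partial>lborel) (1 / q)
     \<le> ennreal (max 1 C1 * max 1 C2) * epow (\<integral>\<^sup>+x. epow (f x) p * epow (V x) (- t * p) \<partial>lborel) (1 / p)"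
proof -
  \<comment> \<open>The solution of f = V^t h^(1-t). Its power of exponent (d+1)/d is the weighted
    integrand on the right-hand side.\<close>
  define h where "h x = epow (f x) (1 / (1 - t)) * epow (V x) (- t / (1 - t))" for x
  have hm [measurable]: "h \<in> borel_measurable borel" unfolding h_def[abs_def] by measurable
  have pq: "p > 0" "q > 0" "(1 - t) * q = d + 1" "(d + 1) / d * (1 / (1 - t)) = p" "d / q = 1 / p" "1 / q \<le> 1"
    using t d by (auto simp: p_def q_def field_simps)
  have f_eq: "f x = epow (V x) t * epow (h x) (1 - t)" for x
  proof -
    have "epow (h x) (1 - t) = f x * epow (V x) (-t)"
      using t by (simp add: h_def epow_mult epow_epow)
    then have "epow (V x) t * epow (h x) (1 - t) = f x * epow (V x) (t + -t)"
      by (simp only: epow_add_pos[OF V01] mult_ac)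
    then show ?thesis by simp
  qed
  have pointwise: "epow (translation_average c f x) q * epow (U x) (- t * q / d)
      \<le> epow (ennreal C1) (t * q) * epow (translation_average c h x) (d + 1)" for x
  proof -
    have "translation_average c f x = (\<integral>\<^sup>+s. epow (V (x + c s)) t * epow (h (x + c s)) (1 - t) \<partial>lborel)"
      unfolding translation_average_def by (intro nn_integral_cong f_eq)
    also have "\<dots> \<le> epow (translation_average c V x) t * epow (translation_average c h x) (1 - t)"
      unfolding translation_average_def using t by (intro nn_integral_Holder2) auto
    also have "\<dots> \<le> epow (ennreal C1 * epow (U x) (1 / d)) t * epow (translation_average c h x) (1 - t)"
      using t by (intro mult_right_mono epow_mono weight) auto
    finally have "epow (translation_average c f x) q \<le> epow (epow (ennreal C1 * epow (U x) (1 / d)) t * epow (translation_average c h x) (1 - t)) q"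
      using pq by (intro epow_mono) auto
    also have "\<dots> = epow (ennreal C1) (t * q) * epow (U x) (t * q / d) * epow (translation_average c h x) (d + 1)"
      using t pq by (simp add: epow_mult epow_epow)
    finally have "epow (translation_average c f x) q * epow (U x) (- t * q / d)
        \<le> epow (ennreal C1) (t * q) * epow (U x) (t * q / d) * epow (translation_average c h x) (d + 1) * epow (U x) (- t * q / d)"
      by (rule mult_right_mono) simp
    also have "\<dots> = epow (ennreal C1) (t * q) * epow (translation_average c h x) (d + 1) * epow (U x) (t * q / d + - t * q / d)"
      by (simp only: epow_add_pos[OF U01] mult_ac)
    finally show ?thesis by simp
  qed
  have hp: "epow (h x) ((d + 1) / d) = epow (f x) p * epow (V x) (- t * p)" for x
  proof -
    have "- t / (1 - t) * ((d + 1) / d) = - t * p" using pq(4) by (metis mult.commute mult.left_commute times_divide_eq_right mult.right_neutral)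
    then show ?thesis using d pq(4) by (simp add: h_def epow_mult epow_epow mult.commute)
  qed
  \<comment> \<open>This makes the constant independent of \<open>t\<close>: the exponents
    \<open>t\<close> and \<open>1 / q\<close> of \<open>C1\<close> and \<open>C2\<close> both lie in
    [0, 1].\<close>
  have small: "epow (ennreal a) b \<le> ennreal (max 1 a)" if "0 \<le> b" "b \<le> 1" for a b
  proof -
    have "epow (ennreal a) b \<le> epow (ennreal (max 1 a)) b" using that by (intro epow_mono ennreal_leI) auto
    also have "\<dots> = ennreal (max 1 a powr b)" by (rule epow_ennreal) simp
    also have "\<dots> \<le> ennreal (max 1 a powr 1)" using that by (intro ennreal_leI powr_mono) auto
    finally show ?thesis by simp
  qed
  have "(\<integral>\<^sup>+x. epow (translation_average c f x) q * epow (U x) (- t * q / d) \<partial>lborel)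
      \<le> (\<integral>\<^sup>+x. epow (ennreal C1) (t * q) * epow (translation_average c h x) (d + 1) \<partial>lborel)"
    by (intro nn_integral_mono pointwise)
  also have "\<dots> = epow (ennreal C1) (t * q) * (\<integral>\<^sup>+x. epow (translation_average c h x) (d + 1) \<partial>lborel)"
    by (rule nn_integral_cmult) measurable
  also have "\<dots> \<le> epow (ennreal C1) (t * q) * (ennreal C2 * epow (\<integral>\<^sup>+x. epow (h x) ((d + 1) / d) \<partial>lborel) d)"
    by (intro mult_left_mono endpoint hm) auto
  finally have "epow (\<integral>\<^sup>+x. epow (translation_average c f x) q * epow (U x) (- t * q / d) \<partial>lborel) (1 / q)
      \<le> epow (epow (ennreal C1) (t * q) * (ennreal C2 * epow (\<integral>\<^sup>+x. epow (h x) ((d + 1) / d) \<partial>lborel) d)) (1 / q)"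
    using pq by (intro epow_mono) auto
  also have "\<dots> = epow (ennreal C1) t * epow (ennreal C2) (1 / q) * epow (\<integral>\<^sup>+x. epow (h x) ((d + 1) / d) \<partial>lborel) (1 / p)"
    using pq by (simp add: epow_mult epow_epow mult.assoc)
  also have "\<dots> \<le> ennreal (max 1 C1) * ennreal (max 1 C2) * epow (\<integral>\<^sup>+x. epow (h x) ((d + 1) / d) \<partial>lborel) (1 / p)"
    using t pq by (intro mult_right_mono mult_mono small) auto
  finally show ?thesis by (simp add: hp ennreal_mult)
qed

text \<open>A Lebesgue measurable \<open>f\<close> agrees almost everywhere with a Borel function,
  and then so do the averages.\<close>

lemma weighted_interpolation:
  assumes t: "0 \<le> t" "t < 1" and f: "f \<in> borel_measurable lebesgue"
  defines "p \<equiv> (d + 1) / (d * (1 - t))" and "q \<equiv> (d + 1) / (1 - t)"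
  shows "epow (\<integral>\<^sup>+x. epow (translation_average c f x) q * epow (U x) (- t * q / d) \<partial>lborel) (1 / q)
     \<le> ennreal (max 1 C1 * max 1 C2) * epow (\<integral>\<^sup>+x. epow (f x) p * epow (V x) (- t * p) \<partial>lborel) (1 / p)"
proof -
  obtain g where g: "g \<in> borel_measurable lborel" "AE x in lborel. f x = g x"
    using completion_ex_borel_measurable[OF f] by blast
  have "(\<integral>\<^sup>+x. epow (translation_average c f x) q * epow (U x) (- t * q / d) \<partial>lborel)
      = (\<integral>\<^sup>+x. epow (translation_average c g x) q * epow (U x) (- t * q / d) \<partial>lborel)"
  proof (rule nn_integral_cong_AE)
    show "AE x in lborel. epow (translation_average c f x) q * epow (U x) (- t * q / d)
        = epow (translation_average c g x) q * epow (U x) (- t * q / d)"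
      using translation_average_cong_AE[OF g(2)] by eventually_elim (simp only:)
  qed
  moreover have "(\<integral>\<^sup>+x. epow (f x) p * epow (V x) (- t * p) \<partial>lborel) = (\<integral>\<^sup>+x. epow (g x) p * epow (V x) (- t * p) \<partial>lborel)"
  proof (rule nn_integral_cong_AE)
    show "AE x in lborel. epow (f x) p * epow (V x) (- t * p) = epow (g x) p * epow (V x) (- t * p)"
      using g(2) by eventually_elim (simp only:)
  qed
  ultimately show ?thesis
    using weighted_interpolation_borel[OF t, of g] g(1) unfolding p_def q_def by simp
qed

text \<open>\<open>f\<close> is at most a multiple of \<open>V\<close> almost everywhere, hence its
  average is almost everywhere at most the same multiple of the average of \<open>V\<close>.\<close>

lemma weighted_esssup_bound:
  assumes f: "f \<in> borel_measurable lebesgue"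
  shows "esssup lebesgue (\<lambda>x. epow (U x) (- 1 / d) * translation_average c f x)
    \<le> ennreal (max 1 C1 * max 1 C2) * esssup lebesgue (\<lambda>x. epow (V x) (- 1) * f x)"
proof (rule esssup_I)
  obtain g where g: "g \<in> borel_measurable lborel" "AE x in lborel. f x = g x"
    using completion_ex_borel_measurable[OF f] by blast
  have gm [measurable]: "g \<in> borel_measurable borel" using g(1) by simp
  have "(\<lambda>x. epow (U x) (- 1 / d) * translation_average c g x) \<in> borel_measurable lborel" by measurable
  moreover have "AE x in lborel. epow (U x) (- 1 / d) * translation_average c g x = epow (U x) (- 1 / d) * translation_average c f x"
    using translation_average_cong_AE[OF g(2)] by eventually_elim (simp only:)
  ultimately show "(\<lambda>x. epow (U x) (- 1 / d) * translation_average c f x) \<in> borel_measurable lebesgue"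
    by (rule borel_measurable_completion_AE[OF measurable_completion])
next
  define M where "M = esssup lebesgue (\<lambda>x. epow (V x) (- 1) * f x)"
  have "AE x in lborel. epow (V x) (- 1) * f x \<le> M"
    using esssup_AE[of "\<lambda>x. epow (V x) (- 1) * f x" lebesgue] by (simp add: M_def AE_completion_iff)
  then have "AE x in lborel. f x \<le> M * V x"
  proof eventually_elim
    case (elim x)
    have "f x = f x * epow (V x) (-1 + 1)" by simp
    also have "\<dots> = epow (V x) (- 1) * f x * V x"
      unfolding epow_add_pos[OF V01] by (simp add: mult_ac)
    also have "\<dots> \<le> M * V x" using elim by (rule mult_right_mono) simp
    finally show ?case .
  qed
  from AE_translation[OF this] have "AE x in lborel. epow (U x) (- 1 / d) * translation_average c f x \<le> ennreal (max 1 C1 * max 1 C2) * M"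
  proof eventually_elim
    case (elim x)
    have "translation_average c f x \<le> (\<integral>\<^sup>+s. M * V (x + c s) \<partial>lborel)"
      unfolding translation_average_def using elim by (rule nn_integral_mono_AE)
    also have "\<dots> = M * translation_average c V x"
      unfolding translation_average_def by (rule nn_integral_cmult) measurable
    also have "\<dots> \<le> M * (ennreal C1 * epow (U x) (1 / d))" by (intro mult_left_mono weight) simp
    finally have "epow (U x) (- 1 / d) * translation_average c f x \<le> epow (U x) (- 1 / d) * (M * (ennreal C1 * epow (U x) (1 / d)))"
      by (rule mult_left_mono) simp
    also have "\<dots> = ennreal C1 * M * epow (U x) (- 1 / d + 1 / d)"
      unfolding epow_add_pos[OF U01] by (simp only: mult_ac)
    also have "\<dots> = ennreal C1 * M" by simp
    also have "\<dots> \<le> ennreal (max 1 C1 * max 1 C2) * M"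
    proof (intro mult_right_mono ennreal_leI)
      have "C1 * 1 \<le> max 1 C1 * max 1 C2" using C by (intro mult_mono) auto
      then show "C1 \<le> max 1 C1 * max 1 C2" by simp
    qed simp
    finally show ?case .
  qed
  then show "AE x in lebesgue. epow (U x) (- 1 / d) * translation_average c f x \<le> ennreal (max 1 C1 * max 1 C2) * M"
    by (rule AE_completion)
qed

end

end

section \<open>The weights as powers of a maximum; shear and reflection\<close>

lemma inverse_ennreal_power:
  assumes "u \<ge> 0" "k > 0"
  shows "inverse (ennreal (u ^ k)) = epow (ennreal u) (- real k)"
proof (cases "u = 0")
  case True
  then show ?thesis using assms by (simp add: epow_zero_left_neg zero_power)
next
  case False
  then have "u > 0" using assms by simp
  then show ?thesis by (simp add: inverse_ennreal epow_ennreal powr_minus powr_realpow)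
qed

lemma min_epow: "a \<le> 0 \<Longrightarrow> min (epow x a) (epow y a) = epow (max x y) a"
  by (metis epow_antimono linorder_le_cases max.absorb1 max.absorb2 min.absorb1 min.absorb2)

lemma ennreal_max: "ennreal (max x y) = max (ennreal x) (ennreal y)"
  by (intro max_of_mono[symmetric] monoI ennreal_leI)

lemma min_weights_eq:
  assumes "u \<ge> 0" "v \<ge> 0"
  shows "min 1 (min (inverse (ennreal (u ^ (k + 1)))) (inverse (ennreal (v ^ (k + 1)))))
    = epow (ennreal (max 1 (max u v))) (- (real k + 1))"
proof -
  have "min (epow (ennreal 1) (- (real k + 1))) (min (epow (ennreal u) (- (real k + 1))) (epow (ennreal v) (- (real k + 1))))
      = epow (ennreal (max 1 (max u v))) (- (real k + 1))"
    using assms by (simp add: min_epow ennreal_max del: ennreal_1)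
  then show ?thesis using assms by (simp only: inverse_ennreal_power) (simp add: inverse_ennreal_power add.commute)
qed

lemma nn_integral_lborel_shear:
  fixes F :: "'n::finite pt \<Rightarrow> ennreal"
  assumes F: "F \<in> borel_measurable borel" and [measurable]: "\<phi> \<in> borel_measurable borel"
  shows "(\<integral>\<^sup>+p. F (fst p, snd p + \<phi> (fst p)) \<partial>lborel) = (\<integral>\<^sup>+p. F p \<partial>lborel)"
proof -
  have [measurable]: "F \<in> borel_measurable (borel \<Otimes>\<^sub>M borel)" using F by (simp add: borel_prod)
  have "(\<integral>\<^sup>+p. F (fst p, snd p + \<phi> (fst p)) \<partial>(lborel \<Otimes>\<^sub>M lborel)) = (\<integral>\<^sup>+a. \<integral>\<^sup>+b. F (a, b + \<phi> a) \<partial>lborel \<partial>lborel)"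
    by (subst lborel.nn_integral_fst[symmetric]) (auto simp: split_beta')
  also have "\<dots> = (\<integral>\<^sup>+a. \<integral>\<^sup>+b. F (a, b) \<partial>lborel \<partial>lborel)"
    by (intro nn_integral_cong nn_integral_shift) measurable
  also have "\<dots> = (\<integral>\<^sup>+p. F p \<partial>(lborel \<Otimes>\<^sub>M lborel))"
    by (rule lborel.nn_integral_fst) measurable
  finally show ?thesis by (simp add: lborel_prod)
qed

lemma nn_integral_lborel_reflect:
  fixes F :: "'n::finite pt \<Rightarrow> ennreal"
  assumes F: "F \<in> borel_measurable borel"
  shows "(\<integral>\<^sup>+p. F (fst p, - snd p) \<partial>lborel) = (\<integral>\<^sup>+p. F p \<partial>lborel)"
proof -
  have [measurable]: "F \<in> borel_measurable (borel \<Otimes>\<^sub>M borel)" using F by (simp add: borel_prod)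
  have "(\<integral>\<^sup>+p. F (fst p, - snd p) \<partial>(lborel \<Otimes>\<^sub>M lborel)) = (\<integral>\<^sup>+a. \<integral>\<^sup>+b. F (a, - b) \<partial>lborel \<partial>lborel)"
    by (subst lborel.nn_integral_fst[symmetric]) (auto simp: split_beta')
  also have "\<dots> = (\<integral>\<^sup>+a. \<integral>\<^sup>+b. F (a, b) \<partial>lborel \<partial>lborel)"
  proof (rule nn_integral_cong)
    fix a
    show "(\<integral>\<^sup>+b. F (a, - b) \<partial>lborel) = (\<integral>\<^sup>+b. F (a, b) \<partial>lborel)"
      using nn_integral_real_affine[of "\<lambda>b. F (a, b)" "-1" 0] by simp
  qed
  also have "\<dots> = (\<integral>\<^sup>+p. F p \<partial>(lborel \<Otimes>\<^sub>M lborel))"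
    by (rule lborel.nn_integral_fst) measurable
  finally show ?thesis by (simp add: lborel_prod)
qed

lemma borel_measurable_pt_continuous:
  fixes F :: "'n::finite pt \<Rightarrow> ennreal" and \<psi> :: "'n pt \<Rightarrow> 'n pt"
  assumes "F \<in> borel_measurable borel" "continuous_on UNIV \<psi>"
  shows "(\<lambda>p. F (\<psi> p)) \<in> borel_measurable borel"
  using measurable_compose[OF borel_measurable_continuous_onI[OF assms(2)] assms(1)] .

section \<open>The operators as averages and as Radon transforms; the two endpoints\<close>

lemma parab_T_eq_translation_average: "parab_T f x = translation_average (\<lambda>t. (- t, - (norm t)\<^sup>2)) f x"
  by (cases x) (simp add: parab_T_def translation_average_def nn_integral_completion)

lemma parab_Tstar_eq_translation_average: "parab_Tstar f x = translation_average (\<lambda>t. (t, (norm t)\<^sup>2)) f x"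
  by (cases x) (simp add: parab_Tstar_def translation_average_def nn_integral_completion)

lemma parab_T_eq_radon:
  fixes f :: "'n::finite pt \<Rightarrow> ennreal"
  assumes f: "f \<in> borel_measurable borel"
  shows "parab_T f x = radon (\<lambda>p. f (fst p, snd p - (norm (fst p))\<^sup>2)) (fst x, snd x - (norm (fst x))\<^sup>2)"
proof -
  have m: "(\<lambda>t. f (fst x - t, snd x - (norm t)\<^sup>2)) \<in> borel_measurable borel"
    by (rule measurable_compose[OF borel_measurable_continuous_onI f]) (intro continuous_intros)
  have "parab_T f x = (\<integral>\<^sup>+t. f (fst x - t, snd x - (norm t)\<^sup>2) \<partial>lborel)"
    by (simp add: parab_T_def nn_integral_completion)
  also have "\<dots> = (\<integral>\<^sup>+y. f (y, snd x - (norm (fst x - y))\<^sup>2) \<partial>lborel)"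
    using nn_integral_lborel_scale[OF m, of "-1" "fst x"] by simp
  also have "\<dots> = (\<integral>\<^sup>+y. f (y, snd x - (norm (fst x))\<^sup>2 + 2 * (fst x \<bullet> y) - (norm y)\<^sup>2) \<partial>lborel)"
    by (intro nn_integral_cong arg_cong[where f = f])
       (simp add: power2_norm_eq_inner inner_diff_left inner_diff_right inner_commute)
  finally show ?thesis by (simp add: radon_def)
qed

text \<open>After reflecting the last coordinate of both the function and the point, the integrands
  differ only in the sign of \<open>t\<close>.\<close>

lemma parab_Tstar_eq_parab_T:
  fixes f :: "'n::finite pt \<Rightarrow> ennreal"
  assumes f: "f \<in> borel_measurable borel"
  shows "parab_Tstar f x = parab_T (\<lambda>p. f (fst p, - snd p)) (fst x, - snd x)"
proof -
  have m: "(\<lambda>t. f (fst x + t, snd x + (norm t)\<^sup>2)) \<in> borel_measurable borel"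
    by (rule measurable_compose[OF borel_measurable_continuous_onI f]) (intro continuous_intros)
  show ?thesis
    using nn_integral_lborel_scale[OF m, of "-1" 0]
    by (simp add: parab_T_def parab_Tstar_def nn_integral_completion add.commute)
qed

lemma upsilon_eq:
  fixes x :: "'n::finite pt"
  shows "upsilon x = epow (ennreal (max 1 (max (norm (fst x)) \<bar>snd x - (norm (fst x))\<^sup>2\<bar>))) (- (real CARD('n) + 1))"
  unfolding upsilon_def by (rule min_weights_eq) auto

lemma upsilon_star_eq:
  fixes x :: "'n::finite pt"
  shows "upsilon_star x = epow (ennreal (max 1 (max (norm (fst x)) \<bar>snd x + (norm (fst x))\<^sup>2\<bar>))) (- (real CARD('n) + 1))"
  unfolding upsilon_star_def by (rule min_weights_eq) auto

lemma upsilon_reflect: "upsilon (fst x, - snd x) = upsilon_star x"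
proof -
  have "\<bar>- snd x - (norm (fst x))\<^sup>2\<bar> = \<bar>snd x + (norm (fst x))\<^sup>2\<bar>" by simp
  then show ?thesis unfolding upsilon_eq upsilon_star_eq fst_conv snd_conv by (simp only:)
qed

lemma upsilon_measurable: "(upsilon :: 'n::finite pt \<Rightarrow> ennreal) \<in> borel_measurable borel"
  unfolding upsilon_eq[abs_def]
  by (intro borel_measurable_epow measurable_compose[OF _ measurable_ennreal] borel_measurable_continuous_onI continuous_intros)

lemma upsilon_star_measurable: "(upsilon_star :: 'n::finite pt \<Rightarrow> ennreal) \<in> borel_measurable borel"
  unfolding upsilon_star_eq[abs_def]
  by (intro borel_measurable_epow measurable_compose[OF _ measurable_ennreal] borel_measurable_continuous_onI continuous_intros)

text \<open>On the hyperplane belonging to \<open>x\<close> the weight is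
  \<open>radial_profile\<close> with slope 2x' and shift x_d - |x'|^2. Its integral decays like the
  reciprocal of a maximum that dominates the one defining \<open>upsilon x\<close>.\<close>

lemma parab_T_upsilon_star_bound:
  "\<exists>C::real. C > 0 \<and> (\<forall>x :: 'n::finite pt. parab_T upsilon_star x \<le> ennreal C * epow (upsilon x) (1 / (real CARD('n) + 1)))"
proof -
  obtain C :: real where C: "C > 0" "\<And>(a :: real^'n) b. (\<integral>\<^sup>+y. radial_profile 1 a b y \<partial>lborel)
      \<le> ennreal C * epow (ennreal (max 1 (max (norm a) \<bar>b\<bar>))) (-1)"
    using radial_profile_integral_bound by blast
  have "parab_T upsilon_star x \<le> ennreal C * epow (upsilon x) (1 / (real CARD('n) + 1))" for x :: "'n pt"
  proof -
    let ?b = "snd x - (norm (fst x))\<^sup>2"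
    have "parab_T upsilon_star x = (\<integral>\<^sup>+y. radial_profile 1 (2 *\<^sub>R fst x) ?b y \<partial>lborel)"
      unfolding parab_T_eq_radon[OF upsilon_star_measurable] radon_def radial_profile_def upsilon_star_eq
      by simp
    also have "\<dots> \<le> ennreal C * epow (ennreal (max 1 (max (norm (2 *\<^sub>R fst x)) \<bar>?b\<bar>))) (-1)"
      by (rule C(2))
    also have "\<dots> \<le> ennreal C * epow (ennreal (max 1 (max (norm (fst x)) \<bar>?b\<bar>))) (-1)"
    proof (intro mult_left_mono epow_antimono ennreal_leI max.mono)
      show "norm (fst x) \<le> norm (2 *\<^sub>R fst x)" by simp
    qed auto
    also have "epow (ennreal (max 1 (max (norm (fst x)) \<bar>?b\<bar>))) (-1) = epow (upsilon x) (1 / (real CARD('n) + 1))"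
    proof -
      have "- (real CARD('n) + 1) * (1 / (real CARD('n) + 1)) = -1"
        using zero_less_card_finite[where 'a='n] by (simp add: field_simps add_eq_0_iff)
      then show ?thesis unfolding upsilon_eq epow_epow by simp
    qed
    finally show ?thesis .
  qed
  then show ?thesis using C(1) by blast
qed

text \<open>A shear by |x'|^2 is applied twice, to the point \<open>x\<close> and in passing from
  \<open>f\<close> to \<open>g\<close>. Both times it preserves Lebesgue measure, so the constant is
  that of \<open>radon_bound\<close>.\<close>

lemma parab_T_endpoint:
  "\<exists>C::real. C > 0 \<and> (\<forall>f :: 'n::finite pt \<Rightarrow> ennreal. f \<in> borel_measurable borel \<longrightarrow>
     (\<integral>\<^sup>+x. epow (parab_T f x) (real CARD('n) + 2) \<partial>lborel)
     \<le> ennreal C * epow (\<integral>\<^sup>+x. epow (f x) ((real CARD('n) + 2) / (real CARD('n) + 1)) \<partial>lborel) (real CARD('n) + 1))"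
proof -
  let ?N = "real CARD('n) + 2" and ?p = "(real CARD('n) + 2) / (real CARD('n) + 1)"
  obtain C :: real where C: "C > 0" "\<And>g :: 'n pt \<Rightarrow> ennreal. g \<in> borel_measurable borel \<Longrightarrow>
     (\<integral>\<^sup>+p. epow (radon g p) ?N \<partial>lborel) \<le> ennreal C * epow (\<integral>\<^sup>+p. epow (g p) ?p \<partial>lborel) (real CARD('n) + 1)"
    using radon_bound by blast
  have "(\<integral>\<^sup>+x. epow (parab_T f x) ?N \<partial>lborel) \<le> ennreal C * epow (\<integral>\<^sup>+x. epow (f x) ?p \<partial>lborel) (real CARD('n) + 1)"
    if f: "f \<in> borel_measurable borel" for f :: "'n pt \<Rightarrow> ennreal"
  proof -
    define g where "g p = f (fst p, snd p - (norm (fst p))\<^sup>2)" for p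
    have gm: "g \<in> borel_measurable borel"
      unfolding g_def[abs_def] by (rule borel_measurable_pt_continuous[OF f]) (intro continuous_intros)
    have gm' [measurable]: "g \<in> borel_measurable (borel \<Otimes>\<^sub>M borel)" using gm by (simp add: borel_prod)
    have "radon g \<in> borel_measurable (borel \<Otimes>\<^sub>M borel)"
      unfolding radon_def[abs_def] by measurable
    then have rm: "radon g \<in> borel_measurable borel" by (simp add: borel_prod)
    have nm: "(\<lambda>a :: real^'n. - (norm a)\<^sup>2) \<in> borel_measurable borel"
      by measurable
    have "(\<integral>\<^sup>+x. epow (parab_T f x) ?N \<partial>lborel) = (\<integral>\<^sup>+x. epow (radon g (fst x, snd x + - (norm (fst x))\<^sup>2)) ?N \<partial>lborel)"
      unfolding parab_T_eq_radon[OF f] g_def by simp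
    also have "\<dots> = (\<integral>\<^sup>+x. epow (radon g x) ?N \<partial>lborel)"
      by (intro nn_integral_lborel_shear[of "\<lambda>x. epow (radon g x) ?N"] nm borel_measurable_epow rm)
    also have "\<dots> \<le> ennreal C * epow (\<integral>\<^sup>+p. epow (g p) ?p \<partial>lborel) (real CARD('n) + 1)"
      by (rule C(2)[OF gm])
    also have "(\<integral>\<^sup>+p. epow (g p) ?p \<partial>lborel) = (\<integral>\<^sup>+p. epow (f p) ?p \<partial>lborel)"
      using nn_integral_lborel_shear[of "\<lambda>x. epow (f x) ?p", OF borel_measurable_epow[OF f] nm] by (simp add: g_def)
    finally show ?thesis .
  qed
  then show ?thesis using C(1) by blast
qed

section \<open>Both operators between their endpoints\<close>

theorem lemma2p2:
  fixes d :: nat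
  assumes "d = CARD('n::finite) + 1" and "d \<ge> 2"
  shows "\<exists>C::ennreal. C < \<infinity> \<and>
    (\<forall>t\<in>{0..1::real}. \<forall>f :: 'n pt \<Rightarrow> ennreal. f \<in> borel_measurable lebesgue \<longrightarrow>
      (t < 1 \<longrightarrow>
        epow (\<integral>\<^sup>+ x. epow (parab_T f x) (q_exp d t)
                   * epow (upsilon x) (- t * q_exp d t / real d) \<partial>lebesgue) (1 / q_exp d t)
          \<le> C * epow (\<integral>\<^sup>+ x. epow (f x) (p_exp d t)
                   * epow (upsilon_star x) (- t * p_exp d t) \<partial>lebesgue) (1 / p_exp d t) \<and>
        epow (\<integral>\<^sup>+ x. epow (parab_Tstar f x) (q_exp d t)
                   * epow (upsilon_star x) (- t * q_exp d t / real d) \<partial>lebesgue) (1 / q_exp d t)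
          \<le> C * epow (\<integral>\<^sup>+ x. epow (f x) (p_exp d t)
                   * epow (upsilon x) (- t * p_exp d t) \<partial>lebesgue) (1 / p_exp d t)) \<and>
      (t = 1 \<longrightarrow>
        esssup lebesgue (\<lambda>x. epow (upsilon x) (- 1 / real d) * parab_T f x)
          \<le> C * esssup lebesgue (\<lambda>x. epow (upsilon_star x) (- 1) * f x) \<and>
        esssup lebesgue (\<lambda>x. epow (upsilon_star x) (- 1 / real d) * parab_Tstar f x)
          \<le> C * esssup lebesgue (\<lambda>x. epow (upsilon x) (- 1) * f x)))"
proof -
  have d: "real d = real CARD('n) + 1" "real d + 1 = real CARD('n) + 2" using assms(1) by auto
  have d0: "real d > 0" using assms(2) by simp
  from parab_T_upsilon_star_bound[where 'n='n, folded d(1)]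
  obtain C1 where C1': "C1 > 0 \<and> (\<forall>x :: 'n pt. parab_T upsilon_star x \<le> ennreal C1 * epow (upsilon x) (1 / real d))" ..
  note C1 = conjunct1[OF C1'] conjunct2[OF C1', rule_format]
  from parab_T_endpoint[where 'n='n, folded d(2), folded d(1)]
  obtain C2 where C2': "C2 > 0 \<and> (\<forall>f :: 'n pt \<Rightarrow> ennreal. f \<in> borel_measurable borel \<longrightarrow>
     (\<integral>\<^sup>+x. epow (parab_T f x) (real d + 1) \<partial>lborel)
     \<le> ennreal C2 * epow (\<integral>\<^sup>+x. epow (f x) ((real d + 1) / real d) \<partial>lborel) (real d))" ..
  note C2 = conjunct1[OF C2'] conjunct2[OF C2', rule_format]
  have refl_meas: "(\<lambda>p. f (fst p, - snd p)) \<in> borel_measurable borel" if "f \<in> borel_measurable borel" for f :: "'n pt \<Rightarrow> ennreal"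
    by (rule borel_measurable_pt_continuous[OF that]) (intro continuous_intros)
  have star_weight: "parab_Tstar upsilon x \<le> ennreal C1 * epow (upsilon_star x) (1 / real d)" for x :: "'n pt"
    using C1(2)[of "(fst x, - snd x)"] upsilon_reflect[of x]
    by (simp add: parab_Tstar_eq_parab_T[OF upsilon_measurable] upsilon_reflect)
  have star_endpoint: "(\<integral>\<^sup>+x. epow (parab_Tstar f x) (real d + 1) \<partial>lborel)
     \<le> ennreal C2 * epow (\<integral>\<^sup>+x. epow (f x) ((real d + 1) / real d) \<partial>lborel) (real d)"
    if f: "f \<in> borel_measurable borel" for f :: "'n pt \<Rightarrow> ennreal"
  proof -
    let ?g = "\<lambda>p. f (fst p, - snd p)"
    have c: "(\<lambda>t :: real^'n. (- t, - (norm t)\<^sup>2)) \<in> borel_measurable borel"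
      by (intro borel_measurable_continuous_onI continuous_intros)
    have Tm: "parab_T ?g \<in> borel_measurable borel"
      unfolding parab_T_eq_translation_average[abs_def] by (rule translation_average_measurable[OF c refl_meas[OF f]])
    have "(\<integral>\<^sup>+x. epow (parab_Tstar f x) (real d + 1) \<partial>lborel) = (\<integral>\<^sup>+x. epow (parab_T ?g (fst x, - snd x)) (real d + 1) \<partial>lborel)"
      by (simp only: parab_Tstar_eq_parab_T[OF f])
    also have "\<dots> = (\<integral>\<^sup>+x. epow (parab_T ?g x) (real d + 1) \<partial>lborel)"
      by (rule nn_integral_lborel_reflect[OF borel_measurable_epow[OF Tm]])
    also have "\<dots> \<le> ennreal C2 * epow (\<integral>\<^sup>+x. epow (?g x) ((real d + 1) / real d) \<partial>lborel) (real d)"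
      by (rule C2(2)[OF refl_meas[OF f]])
    also have "(\<integral>\<^sup>+x. epow (?g x) ((real d + 1) / real d) \<partial>lborel) = (\<integral>\<^sup>+x. epow (f x) ((real d + 1) / real d) \<partial>lborel)"
      by (rule nn_integral_lborel_reflect[OF borel_measurable_epow[OF f]])
    finally show ?thesis .
  qed
  have c: "(\<lambda>t :: real^'n. (- t, - (norm t)\<^sup>2)) \<in> borel_measurable borel" "(\<lambda>t :: real^'n. (t, (norm t)\<^sup>2)) \<in> borel_measurable borel"
    by (intro borel_measurable_continuous_onI continuous_intros)+
  have pos: "0 < upsilon x" "upsilon x < \<infinity>" "0 < upsilon_star x" "upsilon_star x < \<infinity>" for x :: "'n pt"
    using upsilon_pos_le_1[of x] upsilon_star_pos_le_1[of x] by (auto intro: le_less_trans)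
  \<comment> \<open>The assumptions of the interpolation context in their order. For
    \<open>parab_Tstar\<close> the two weights exchange roles while the constants stay the same, so
    one constant serves all four inequalities.\<close>
  note T = c(1) upsilon_measurable upsilon_star_measurable pos C1(1) C2(1) d0
    C1(2)[unfolded parab_T_eq_translation_average] C2(2)[unfolded parab_T_eq_translation_average]
  note Tstar = c(2) upsilon_star_measurable upsilon_measurable pos(3,4,1,2) C1(1) C2(1) d0
    star_weight[unfolded parab_Tstar_eq_translation_average] star_endpoint[unfolded parab_Tstar_eq_translation_average]
  have exps: "p_exp d t = (real d + 1) / (real d * (1 - t))" "q_exp d t = (real d + 1) / (1 - t)" if "t < 1" for t
    using that d0 by (simp_all add: p_exp_def q_exp_def field_simps)
  show ?thesis
  proof (intro exI[of _ "ennreal (max 1 C1 * max 1 C2)"] conjI ballI allI impI)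
    fix t :: real and f :: "'n pt \<Rightarrow> ennreal"
    assume t: "t \<in> {0..1}" and f: "f \<in> borel_measurable lebesgue"
    {
      assume t1: "t < 1"
      have t0: "0 \<le> t" using t by simp
      show "epow (\<integral>\<^sup>+ x. epow (parab_T f x) (q_exp d t)
                   * epow (upsilon x) (- t * q_exp d t / real d) \<partial>lebesgue) (1 / q_exp d t)
          \<le> ennreal (max 1 C1 * max 1 C2) * epow (\<integral>\<^sup>+ x. epow (f x) (p_exp d t)
                   * epow (upsilon_star x) (- t * p_exp d t) \<partial>lebesgue) (1 / p_exp d t)"
        unfolding exps[OF t1] parab_T_eq_translation_average nn_integral_completion
        by (rule weighted_interpolation[OF T t0 t1 f])
      show "epow (\<integral>\<^sup>+ x. epow (parab_Tstar f x) (q_exp d t)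
                   * epow (upsilon_star x) (- t * q_exp d t / real d) \<partial>lebesgue) (1 / q_exp d t)
          \<le> ennreal (max 1 C1 * max 1 C2) * epow (\<integral>\<^sup>+ x. epow (f x) (p_exp d t)
                   * epow (upsilon x) (- t * p_exp d t) \<partial>lebesgue) (1 / p_exp d t)"
        unfolding exps[OF t1] parab_Tstar_eq_translation_average nn_integral_completion
        by (rule weighted_interpolation[OF Tstar t0 t1 f])
    }
    show "esssup lebesgue (\<lambda>x. epow (upsilon x) (- 1 / real d) * parab_T f x)
          \<le> ennreal (max 1 C1 * max 1 C2) * esssup lebesgue (\<lambda>x. epow (upsilon_star x) (- 1) * f x)"
      unfolding parab_T_eq_translation_average by (rule weighted_esssup_bound[OF T f])
    show "esssup lebesgue (\<lambda>x. epow (upsilon_star x) (- 1 / real d) * parab_Tstar f x)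
          \<le> ennreal (max 1 C1 * max 1 C2) * esssup lebesgue (\<lambda>x. epow (upsilon x) (- 1) * f x)"
      unfolding parab_Tstar_eq_translation_average by (rule weighted_esssup_bound[OF Tstar f])
  qed simp
qed

end
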